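(* Let $m\geq N\geq 2$ and $s\geq 1$, let $w$ be a preregular $m$-linear form on $\mathbb K^{s+1}$, and let $\tilde w$ be an $m$-linear form on the dual of $\mathbb K^{s+1}$ with $\tilde W^{\alpha\gamma_1\dots\gamma_{m-1}}W_{\gamma_1\dots\gamma_{m-1}\beta}=\delta^\alpha_\beta$ for all $\alpha,\beta\in\{0,\dots,s\}$. Then there is a unique algebra homomorphism $$\Delta_L:\mathcal A(w,N)\to\mathcal H(w,\tilde w)\otimes\mathcal A(w,N)$$ such that $\Delta_L(x^\mu)=u^\mu_\nu\otimes x^\nu$ for $\mu\in\{0,\dots,s\}$. This endows $\mathcal A(w,N)$ with a structure of $\mathcal H(w,\tilde w)$-comodule.
   Context: $\mathbb K$ is an algebraically closed field of characteristic zero; algebras are unital associative over $\mathbb K$; $\otimes=\otimes_{\mathbb K}$; repeated up-down indices are summed over $\{0,\dots,s\}$. $W_{\lambda_1\dots\lambda_m}=w(e_{\lambda_1},\dots,e_{\lambda_m})$ are the components of $w$ in the canonical basis $(e_\lambda)$ of $\mathbb K^{s+1}$ and $\tilde W^{\lambda_1\dots\lambda_m}$ those of $\tilde w$ in the dual basis. Preregular: an $m$-linear form $w$ on a vector space $V$ ($\dim V\geq 2$, $m\geq 2$) is preregular if (i) $w(X,X_1,\dots,X_{m-1})=0$ for all $X_1,\dots,X_{m-1}\in V$ implies $X=0$, and (ii) there is $Q_w\in GL(V)$ with $w(X_1,\dots,X_m)=w(Q_wX_m,X_1,\dots,X_{m-1})$ for all $X_i\in V$. $\mathcal A(w,N)$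 is the algebra generated by $x^0,\dots,x^s$ with the relations $W_{\lambda_1\dots\lambda_{m-N}\mu_1\dots\mu_N}x^{\mu_1}\cdots x^{\mu_N}=0$ for all $\lambda_i\in\{0,\dots,s\}$. $\mathcal H(w,\tilde w)$ is the algebra generated by elements $u^\alpha_\beta$ $(\alpha,\beta\in\{0,\dots,s\})$ with the relations $W_{\alpha_1\dots\alpha_m}u^{\alpha_1}_{\beta_1}\cdots u^{\alpha_m}_{\beta_m}=W_{\beta_1\dots\beta_m}\mathbf 1$ and $\tilde W^{\beta_1\dots\beta_m}u^{\alpha_1}_{\beta_1}\cdots u^{\alpha_m}_{\beta_m}=\tilde W^{\alpha_1\dots\alpha_m}\mathbf 1$. It is a Hopf algebra with coproduct $\Delta(u^\mu_\nu)=u^\mu_\lambda\otimes u^\lambda_\nu$, counit $\varepsilon(u^\mu_\nu)=\delta^\mu_\nu$ and antipode $S(u^\mu_\nu)=\tilde W^{\mu\lambda_1\dots\lambda_{m-1}}u^{\rho_1}_{\lambda_1}\cdots u^{\rho_{m-1}}_{\lambda_{m-1}}W_{\rho_1\dots\rho_{m-1}\nu}$. The comodule structure is the left one: $(\Delta\otimes\mathrm{Id})\circ\Delta_L=(\mathrm{Id}\otimes\Delta_L)\circ\Delta_L$ and $(\varepsilon\otimes\mathrm{Id})\circ\Delta_L=\mathrm{Id}$. *)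

theory Defs
  imports
    "HOL-Analysis.Cartesian_Space"
    "HOL-Library.Poly_Mapping"
    "HOL-Library.Function_Algebras"
    "HOL-Algebra.QuotRing"
    "HOL-Algebra.Module"
    "HOL-Algebra.Algebraic_Closure_Type"
begin

section \<open>Algebras given by generators and relations\<close>

text \<open>
  Associative unital algebras over a field \<open>'k\<close> are carried by the record type
  \<open>('k, 'a) module\<close>, which extends the ring record by a scalar multiplication.
  (The library locale \<open>algebra\<close> is restricted to commutative algebras.)
  Vector spaces over \<open>'k\<close> are instances of the library locale \<open>module\<close>.
\<close>

abbreviation vector_space_rec :: "('k::field, 'a, 'm) module_scheme \<Rightarrow> bool" where
  "vector_space_rec M \<equiv> Module.module (ring_of_type_algebra :: 'k ring) M"

definition scalar_algebra :: "('k::field, 'k) module" where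
  "scalar_algebra = ring.extend ring_of_type_algebra (module.fields (*))"

definition monoid_algebra :: "('g, 'm) monoid_scheme \<Rightarrow> ('k::field, 'g \<Rightarrow>\<^sub>0 'k) module" where
  "monoid_algebra G =
    \<lparr>carrier = {p. Poly_Mapping.keys p \<subseteq> carrier G},
     monoid.mult = (\<lambda>p q. \<Sum>a\<in>Poly_Mapping.keys p. \<Sum>b\<in>Poly_Mapping.keys q.
        Poly_Mapping.single (a \<otimes>\<^bsub>G\<^esub> b) (Poly_Mapping.lookup p a * Poly_Mapping.lookup q b)),
     one = Poly_Mapping.single \<one>\<^bsub>G\<^esub> 1,
     ring.zero = 0,
     add = (+),
     module.smult = (\<lambda>c. Poly_Mapping.map ((*) c))\<rparr>"

definition quotient_algebra ::
  "('k::field, 'a, 'm) module_scheme \<Rightarrow> 'a set \<Rightarrow> ('k, 'a set) module" where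
  "quotient_algebra R I =
    ring.extend (R Quot I) (module.fields (\<lambda>c S. \<Union>x\<in>S. I +>\<^bsub>R\<^esub> (c \<odot>\<^bsub>R\<^esub> x)))"

definition free_monoid :: "'g list monoid" where
  "free_monoid = \<lparr>carrier = UNIV, monoid.mult = (@), one = []\<rparr>"

abbreviation free_algebra :: "('k::field, 'g list \<Rightarrow>\<^sub>0 'k) module" where
  "free_algebra \<equiv> monoid_algebra free_monoid"

text \<open>The relation \<open>r = 0\<close> is imposed for every \<open>r\<close> in the given set.\<close>

definition presented_algebra ::
  "('g list \<Rightarrow>\<^sub>0 'k::field) set \<Rightarrow> ('k, ('g list \<Rightarrow>\<^sub>0 'k) set) module" where
  "presented_algebra rels = quotient_algebra free_algebra (Idl\<^bsub>free_algebra\<^esub> rels)"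

definition presented_gen ::
  "('g list \<Rightarrow>\<^sub>0 'k::field) set \<Rightarrow> 'g \<Rightarrow> ('g list \<Rightarrow>\<^sub>0 'k) set" where
  "presented_gen rels g =
    Idl\<^bsub>free_algebra\<^esub> rels +>\<^bsub>free_algebra\<^esub> Poly_Mapping.single [g] 1"

text \<open>
  Homomorphisms preserve the unit; they are taken to be extensional, so that equality of
  homomorphisms is equality on the carrier.
\<close>

definition alg_hom ::
  "('k::field, 'a, 'm) module_scheme \<Rightarrow> ('k, 'b, 'n) module_scheme \<Rightarrow> ('a \<Rightarrow> 'b) set" where
  "alg_hom A B = {f \<in> ring_hom A B \<inter> extensional (carrier A).
     \<forall>c. \<forall>x\<in>carrier A. f (c \<odot>\<^bsub>A\<^esub> x) = c \<odot>\<^bsub>B\<^esub> f x}"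

definition linear_maps ::
  "('k::field, 'a, 'm) module_scheme \<Rightarrow> ('k, 'b, 'n) module_scheme \<Rightarrow> ('a \<Rightarrow> 'b) set" where
  "linear_maps M L = {f \<in> carrier M \<rightarrow> carrier L.
     (\<forall>x\<in>carrier M. \<forall>y\<in>carrier M. f (x \<oplus>\<^bsub>M\<^esub> y) = f x \<oplus>\<^bsub>L\<^esub> f y) \<and>
     (\<forall>c. \<forall>x\<in>carrier M. f (c \<odot>\<^bsub>M\<^esub> x) = c \<odot>\<^bsub>L\<^esub> f x)}"


section \<open>Tensor products of algebras\<close>

text \<open>
  The vector space with basis \<open>carrier A \<times> carrier B\<close>, with the product
  \<open>(a, b) (a', b') = (a a', b b')\<close>, is the monoid algebra of the product of the multiplicative
  monoids.  The product of a bilinearity relation with a basis element is again a bilinearity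
  relation, so the ideal generated by these relations is their linear span, and the vector
  space underlying \<open>tensor_algebra A B\<close> is the usual tensor product.
\<close>

definition bilinearity_relations ::
  "('k::field, 'a, 'm) module_scheme \<Rightarrow> ('k, 'b, 'n) module_scheme \<Rightarrow> ('a \<times> 'b \<Rightarrow>\<^sub>0 'k) set" where
  "bilinearity_relations A B =
     {Poly_Mapping.single (a \<oplus>\<^bsub>A\<^esub> a', b) 1
        - Poly_Mapping.single (a, b) 1 - Poly_Mapping.single (a', b) 1
        | a a' b. a \<in> carrier A \<and> a' \<in> carrier A \<and> b \<in> carrier B} \<union>
     {Poly_Mapping.single (a, b \<oplus>\<^bsub>B\<^esub> b') 1
        - Poly_Mapping.single (a, b) 1 - Poly_Mapping.single (a, b') 1
        | a b b'. a \<in> carrier A \<and> b \<in> carrier B \<and> b' \<in> carrier B} \<union>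
     {Poly_Mapping.single (c \<odot>\<^bsub>A\<^esub> a, b) 1 - Poly_Mapping.single (a, b) c
        | c a b. a \<in> carrier A \<and> b \<in> carrier B} \<union>
     {Poly_Mapping.single (a, c \<odot>\<^bsub>B\<^esub> b) 1 - Poly_Mapping.single (a, b) c
        | c a b. a \<in> carrier A \<and> b \<in> carrier B}"

definition tensor_algebra ::
  "('k::field, 'a, 'm) module_scheme \<Rightarrow> ('k, 'b, 'n) module_scheme
    \<Rightarrow> ('k, ('a \<times> 'b \<Rightarrow>\<^sub>0 'k) set) module" where
  "tensor_algebra A B =
     quotient_algebra (monoid_algebra (A \<times>\<times> B))
       (Idl\<^bsub>monoid_algebra (A \<times>\<times> B)\<^esub> (bilinearity_relations A B))"

definition pure_tensor ::
  "('k::field, 'a, 'm) module_scheme \<Rightarrow> ('k, 'b, 'n) module_scheme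
    \<Rightarrow> 'a \<Rightarrow> 'b \<Rightarrow> ('a \<times> 'b \<Rightarrow>\<^sub>0 'k) set" where
  "pure_tensor A B a b =
     Idl\<^bsub>monoid_algebra (A \<times>\<times> B)\<^esub> (bilinearity_relations A B)
       +>\<^bsub>monoid_algebra (A \<times>\<times> B)\<^esub> Poly_Mapping.single (a, b) 1"

text \<open>
  The linear map out of a tensor product induced by a bilinear map \<open>\<phi>\<close> into \<open>M\<close>.  For
  bilinear \<open>\<phi>\<close> the value of the sum is the same for all representatives \<open>p\<close> of the class \<open>t\<close>,
  so that the image is a singleton.
\<close>

definition tensor_lift ::
  "('k::field, 'c, 'l) module_scheme \<Rightarrow> ('a \<Rightarrow> 'b \<Rightarrow> 'c) \<Rightarrow> ('a \<times> 'b \<Rightarrow>\<^sub>0 'k) set \<Rightarrow> 'c" where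
  "tensor_lift M \<phi> t = the_elem
     ((\<lambda>p. \<Oplus>\<^bsub>M\<^esub>z\<in>Poly_Mapping.keys p. Poly_Mapping.lookup p z \<odot>\<^bsub>M\<^esub> \<phi> (fst z) (snd z)) ` t)"

text \<open>\<open>f \<otimes> g\<close>, with values in the tensor product of \<open>C\<close> and \<open>D\<close>\<close>

definition tensor_map ::
  "('k::field, 'c, 'm) module_scheme \<Rightarrow> ('k, 'd, 'n) module_scheme \<Rightarrow> ('a \<Rightarrow> 'c) \<Rightarrow> ('b \<Rightarrow> 'd)
    \<Rightarrow> ('a \<times> 'b \<Rightarrow>\<^sub>0 'k) set \<Rightarrow> ('c \<times> 'd \<Rightarrow>\<^sub>0 'k) set" where
  "tensor_map C D f g = tensor_lift (tensor_algebra C D) (\<lambda>a b. pure_tensor C D (f a) (g b))"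

text \<open>The canonical identification \<open>(a \<otimes> b) \<otimes> c \<mapsto> a \<otimes> (b \<otimes> c)\<close>\<close>

definition tensor_assoc ::
  "('k::field, 'a, 'm) module_scheme \<Rightarrow> ('k, 'b, 'n) module_scheme \<Rightarrow> ('k, 'c, 'l) module_scheme
    \<Rightarrow> (('a \<times> 'b \<Rightarrow>\<^sub>0 'k) set \<times> 'c \<Rightarrow>\<^sub>0 'k) set \<Rightarrow> ('a \<times> ('b \<times> 'c \<Rightarrow>\<^sub>0 'k) set \<Rightarrow>\<^sub>0 'k) set" where
  "tensor_assoc A B C =
     (let T = tensor_algebra A (tensor_algebra B C) in
      tensor_lift T (\<lambda>t c. tensor_lift T
        (\<lambda>a b. pure_tensor A (tensor_algebra B C) a (pure_tensor B C b c)) t))"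

text \<open>The canonical identifications \<open>c \<otimes> x \<mapsto> c x\<close> and \<open>x \<otimes> c \<mapsto> c x\<close>\<close>

definition tensor_unit_left ::
  "('k::field, 'a, 'm) module_scheme \<Rightarrow> ('k \<times> 'a \<Rightarrow>\<^sub>0 'k) set \<Rightarrow> 'a" where
  "tensor_unit_left M = tensor_lift M (\<lambda>c x. c \<odot>\<^bsub>M\<^esub> x)"

definition tensor_unit_right ::
  "('k::field, 'a, 'm) module_scheme \<Rightarrow> ('a \<times> 'k \<Rightarrow>\<^sub>0 'k) set \<Rightarrow> 'a" where
  "tensor_unit_right M = tensor_lift M (\<lambda>x c. c \<odot>\<^bsub>M\<^esub> x)"


section \<open>Coalgebras and left comodules\<close>

definition coalgebra ::
  "('k::field, 'c, 'm) module_scheme \<Rightarrow> ('c \<Rightarrow> ('c \<times> 'c \<Rightarrow>\<^sub>0 'k) set) \<Rightarrow> ('c \<Rightarrow> 'k) \<Rightarrow> bool" where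
  "coalgebra C \<Delta> \<epsilon> \<longleftrightarrow>
     vector_space_rec C \<and>
     \<Delta> \<in> linear_maps C (tensor_algebra C C) \<and>
     \<epsilon> \<in> linear_maps C scalar_algebra \<and>
     (\<forall>x\<in>carrier C.
        tensor_assoc C C C (tensor_map (tensor_algebra C C) C \<Delta> id (\<Delta> x))
          = tensor_map C (tensor_algebra C C) id \<Delta> (\<Delta> x) \<and>
        tensor_unit_left C (tensor_map scalar_algebra C \<epsilon> id (\<Delta> x)) = x \<and>
        tensor_unit_right C (tensor_map C scalar_algebra id \<epsilon> (\<Delta> x)) = x)"

definition left_comodule ::
  "('k::field, 'c, 'm) module_scheme \<Rightarrow> ('c \<Rightarrow> ('c \<times> 'c \<Rightarrow>\<^sub>0 'k) set) \<Rightarrow> ('c \<Rightarrow> 'k)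
    \<Rightarrow> ('k, 'a, 'n) module_scheme \<Rightarrow> ('a \<Rightarrow> ('c \<times> 'a \<Rightarrow>\<^sub>0 'k) set) \<Rightarrow> bool" where
  "left_comodule C \<Delta> \<epsilon> M \<rho> \<longleftrightarrow>
     coalgebra C \<Delta> \<epsilon> \<and>
     vector_space_rec M \<and>
     \<rho> \<in> linear_maps M (tensor_algebra C M) \<and>
     (\<forall>x\<in>carrier M.
        tensor_assoc C C M (tensor_map (tensor_algebra C C) M \<Delta> id (\<rho> x))
          = tensor_map C (tensor_algebra C M) id \<rho> (\<rho> x) \<and>
        tensor_unit_left M (tensor_map scalar_algebra M \<epsilon> id (\<rho> x)) = x)"


section \<open>Multilinear forms\<close>

text \<open>
  An \<open>m\<close>-linear form on the subspace \<open>V\<close> is a function on lists; only its values on lists of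
  length \<open>m\<close> with entries in \<open>V\<close> are relevant.
\<close>

definition multilinear_form ::
  "('k::field \<Rightarrow> 'v::ab_group_add \<Rightarrow> 'v) \<Rightarrow> 'v set \<Rightarrow> nat \<Rightarrow> ('v list \<Rightarrow> 'k) \<Rightarrow> bool" where
  "multilinear_form smul V m f \<longleftrightarrow>
     (\<forall>xs ys. \<forall>x\<in>V. \<forall>y\<in>V. \<forall>a b.
        set xs \<subseteq> V \<and> set ys \<subseteq> V \<and> length xs + 1 + length ys = m \<longrightarrow>
        f (xs @ (smul a x + smul b y) # ys) = a * f (xs @ x # ys) + b * f (xs @ y # ys))"

abbreviation form_on_space :: "nat \<Rightarrow> (('k::field ^ 'n) list \<Rightarrow> 'k) \<Rightarrow> bool" where
  "form_on_space m w \<equiv> multilinear_form (*s) UNIV m w"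

text \<open>The dual space consists of the linear functionals, with pointwise operations.\<close>

abbreviation form_on_dual :: "nat \<Rightarrow> (('k::field ^ 'n \<Rightarrow> 'k) list \<Rightarrow> 'k) \<Rightarrow> bool" where
  "form_on_dual m wt \<equiv>
     multilinear_form (\<lambda>c \<phi> v. c * \<phi> v) {\<phi>. Vector_Spaces.linear (*s) (*) \<phi>} m wt"

definition preregular :: "nat \<Rightarrow> (('k::field ^ 'n) list \<Rightarrow> 'k) \<Rightarrow> bool" where
  "preregular m w \<longleftrightarrow>
     2 \<le> m \<and> 2 \<le> CARD('n) \<and> form_on_space m w \<and>
     (\<forall>x. (\<forall>xs. length xs = m - 1 \<longrightarrow> w (x # xs) = 0) \<longrightarrow> x = 0) \<and>
     (\<exists>Q. Vector_Spaces.linear (*s) (*s) Q \<and> bij Q \<and>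
        (\<forall>xs x. length xs = m - 1 \<longrightarrow> w (xs @ [x]) = w (Q x # xs)))"

definition comps :: "(('k::field ^ 'n) list \<Rightarrow> 'k) \<Rightarrow> 'n list \<Rightarrow> 'k" where
  "comps w is = w (map (\<lambda>i. axis i 1) is)"

definition dual_comps :: "(('k::field ^ 'n \<Rightarrow> 'k) list \<Rightarrow> 'k) \<Rightarrow> 'n list \<Rightarrow> 'k" where
  "dual_comps wt is = wt (map (\<lambda>i v. v $ i) is)"


section \<open>The algebra of a multilinear form and its quantum group\<close>

text \<open>The generator \<open>x\<^sup>\<mu>\<close> is \<open>\<mu> :: 'n\<close>, so that a product of generators is the list of their indices.\<close>

definition A_rels ::
  "nat \<Rightarrow> (('k::field ^ 'n) list \<Rightarrow> 'k) \<Rightarrow> nat \<Rightarrow> ('n list \<Rightarrow>\<^sub>0 'k) set" where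
  "A_rels m w N =
     {(\<Sum>\<mu> | length \<mu> = N. Poly_Mapping.single \<mu> (comps w (\<kappa> @ \<mu>))) | \<kappa>. length \<kappa> = m - N}"

definition A_alg ::
  "nat \<Rightarrow> (('k::field ^ 'n) list \<Rightarrow> 'k) \<Rightarrow> nat \<Rightarrow> ('k, ('n list \<Rightarrow>\<^sub>0 'k) set) module" where
  "A_alg m w N = presented_algebra (A_rels m w N)"

definition A_gen ::
  "nat \<Rightarrow> (('k::field ^ 'n) list \<Rightarrow> 'k) \<Rightarrow> nat \<Rightarrow> 'n \<Rightarrow> ('n list \<Rightarrow>\<^sub>0 'k) set" where
  "A_gen m w N = presented_gen (A_rels m w N)"

text \<open>
  The generator \<open>u\<^sup>\<alpha>\<^sub>\<beta>\<close> is the pair \<open>(\<alpha>, \<beta>)\<close>, so that the word \<open>zip \<alpha> \<beta>\<close> is the product of the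
  \<open>u\<close> with upper indices \<open>\<alpha>\<close> and lower indices \<open>\<beta>\<close>.
\<close>

definition H_rels ::
  "nat \<Rightarrow> (('k::field ^ 'n) list \<Rightarrow> 'k) \<Rightarrow> (('k ^ 'n \<Rightarrow> 'k) list \<Rightarrow> 'k)
    \<Rightarrow> (('n \<times> 'n) list \<Rightarrow>\<^sub>0 'k) set" where
  "H_rels m w wt =
     {(\<Sum>\<alpha> | length \<alpha> = m. Poly_Mapping.single (zip \<alpha> \<beta>) (comps w \<alpha>))
        - Poly_Mapping.single [] (comps w \<beta>) | \<beta>. length \<beta> = m} \<union>
     {(\<Sum>\<beta> | length \<beta> = m. Poly_Mapping.single (zip \<alpha> \<beta>) (dual_comps wt \<beta>))
        - Poly_Mapping.single [] (dual_comps wt \<alpha>) | \<alpha>. length \<alpha> = m}"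

definition H_alg ::
  "nat \<Rightarrow> (('k::field ^ 'n) list \<Rightarrow> 'k) \<Rightarrow> (('k ^ 'n \<Rightarrow> 'k) list \<Rightarrow> 'k)
    \<Rightarrow> ('k, (('n \<times> 'n) list \<Rightarrow>\<^sub>0 'k) set) module" where
  "H_alg m w wt = presented_algebra (H_rels m w wt)"

definition H_gen ::
  "nat \<Rightarrow> (('k::field ^ 'n) list \<Rightarrow> 'k) \<Rightarrow> (('k ^ 'n \<Rightarrow> 'k) list \<Rightarrow> 'k)
    \<Rightarrow> 'n \<Rightarrow> 'n \<Rightarrow> (('n \<times> 'n) list \<Rightarrow>\<^sub>0 'k) set" where
  "H_gen m w wt \<alpha> \<beta> = presented_gen (H_rels m w wt) (\<alpha>, \<beta>)"

text \<open>The coproduct and the counit are algebra homomorphisms, determined by their values on generators.\<close>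

definition H_comult ::
  "nat \<Rightarrow> (('k::field ^ 'n) list \<Rightarrow> 'k) \<Rightarrow> (('k ^ 'n \<Rightarrow> 'k) list \<Rightarrow> 'k)
    \<Rightarrow> (('n \<times> 'n) list \<Rightarrow>\<^sub>0 'k) set
    \<Rightarrow> ((('n \<times> 'n) list \<Rightarrow>\<^sub>0 'k) set \<times> (('n \<times> 'n) list \<Rightarrow>\<^sub>0 'k) set \<Rightarrow>\<^sub>0 'k) set" where
  "H_comult m w wt =
     (let H = H_alg m w wt; u = H_gen m w wt in
      THE D. D \<in> alg_hom H (tensor_algebra H H) \<and>
        (\<forall>\<mu> \<nu>. D (u \<mu> \<nu>) =
           (\<Oplus>\<^bsub>tensor_algebra H H\<^esub>\<kappa>\<in>UNIV. pure_tensor H H (u \<mu> \<kappa>) (u \<kappa> \<nu>))))"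

definition H_counit ::
  "nat \<Rightarrow> (('k::field ^ 'n) list \<Rightarrow> 'k) \<Rightarrow> (('k ^ 'n \<Rightarrow> 'k) list \<Rightarrow> 'k)
    \<Rightarrow> (('n \<times> 'n) list \<Rightarrow>\<^sub>0 'k) set \<Rightarrow> 'k" where
  "H_counit m w wt =
     (THE e. e \<in> alg_hom (H_alg m w wt) scalar_algebra \<and>
        (\<forall>\<mu> \<nu>. e (H_gen m w wt \<mu> \<nu>) = (if \<mu> = \<nu> then 1 else 0)))"

end

theory Submission
  imports Defs
begin

text \<open>
  Write \<open>u\<^sup>\<alpha>\<^sub>\<beta>\<close> and \<open>x\<^sup>\<mu>\<close> for the words with multi-indices \<open>\<alpha>\<close>, \<open>\<beta>\<close>, \<open>\<mu>\<close>.  The coaction has to send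
  \<open>x\<^sup>\<mu>\<close> to the sum of \<open>u\<^sup>\<mu>\<^sub>\<nu> \<otimes> x\<^sup>\<nu>\<close>, so that the only question is whether this respects the relations
  \<open>W\<^sub>\<kappa>\<^sub>\<mu> x\<^sup>\<mu> = 0\<close>.  Since \<open>w\<close> is invariant under rotation of its arguments up to the invertible map
  \<open>Q\<close>, these relations are equivalent to \<open>W\<^sub>\<mu>\<^sub>\<kappa> x\<^sup>\<mu> = 0\<close>.  The matrix \<open>u\<close> has a right inverse, and
  multiplying \<open>W\<^sub>\<mu>\<^sub>\<lambda> u\<^sup>\<mu>\<^sub>\<nu> u\<^sup>\<lambda>\<^sub>\<kappa> = W\<^sub>\<nu>\<^sub>\<kappa>\<close> on the right by the inverse \<open>T\<close> of the words \<open>u\<^sup>\<lambda>\<^sub>\<kappa>\<close> gives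
  \<open>W\<^sub>\<mu>\<^sub>\<sigma> u\<^sup>\<mu>\<^sub>\<nu> = W\<^sub>\<nu>\<^sub>\<kappa> T\<^sup>\<kappa>\<^sub>\<sigma>\<close>, hence \<open>W\<^sub>\<mu>\<^sub>\<sigma> u\<^sup>\<mu>\<^sub>\<nu> \<otimes> x\<^sup>\<nu> = T\<^sup>\<kappa>\<^sub>\<sigma> \<otimes> W\<^sub>\<nu>\<^sub>\<kappa> x\<^sup>\<nu> = 0\<close>.  Without the
  rotation one would have to cancel \<open>u\<close> on the left by an inverse of its transpose, which the
  hypotheses do not provide.
  All coalgebra and comodule axioms are linear, so they need only be checked on words.
\<close>


section \<open>Vector spaces and algebras over a field\<close>

text \<open>The right inverse of u is the formula for the antipode. The second family of relations
  gives Wt^{i \<gamma>} u^a_i u^\<rho>_\<gamma> = Wt^{a \<rho>}, and contraction with W_{\<rho> b}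
  gives the Kronecker symbol by the hypothesis that links the two forms. The rotation is used in
  both directions: through the inverse of Q it brings the relations to be checked into the form with
  \<mu> in front, and through Q it shows that W_{\<nu> \<kappa>} x^\<nu> vanishes in A. The comodule
  axioms could be compared on generators only, but then the canonical maps between tensor products
  would have to be shown multiplicative. Comparison on words needs their linearity alone. It costs
  nothing extra, since the words u^\<alpha>_\<beta> with indices of a fixed length form a matrix
  whose coproduct is again \<Sum> u^\<alpha>_\<kappa> \<otimes> u^\<kappa>_\<beta>: a word is a
  matrix entry just as a generator is.\<close>

locale kvec = abelian_group M for M :: "('k::field, 'a, 'm) module_scheme" (structure) +
  assumes smult_closed [simp, intro]: "x \<in> carrier M \<Longrightarrow> c \<odot> x \<in> carrier M"
    and smult_l_distr: "x \<in> carrier M \<Longrightarrow> (b + c) \<odot> x = b \<odot> x \<oplus> c \<odot> x"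
    and smult_r_distr:
      "x \<in> carrier M \<Longrightarrow> y \<in> carrier M \<Longrightarrow> c \<odot> (x \<oplus> y) = c \<odot> x \<oplus> c \<odot> y"
    and smult_assoc1: "x \<in> carrier M \<Longrightarrow> (b * c) \<odot> x = b \<odot> (c \<odot> x)"
    and smult_one [simp]: "x \<in> carrier M \<Longrightarrow> 1 \<odot> x = x"

text \<open>The scalars range over the type \<open>'k\<close>, so no membership conditions on them
  arise. As the product need not commute, compatibility with scalars is a separate axiom on each
  side.\<close>

locale kalg = kvec A + ring A for A :: "('k::field, 'a, 'm) module_scheme" (structure) +
  assumes smult_mult_left:
      "x \<in> carrier A \<Longrightarrow> y \<in> carrier A \<Longrightarrow> (c \<odot> x) \<otimes> y = c \<odot> (x \<otimes> y)"
    and smult_mult_right: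
      "x \<in> carrier A \<Longrightarrow> y \<in> carrier A \<Longrightarrow> x \<otimes> (c \<odot> y) = c \<odot> (x \<otimes> y)"

section \<open>Scalars and finite sums in a vector space\<close>

context kvec
begin

text \<open>The bridge from \<open>kvec\<close> to the predicate that \<open>coalgebra\<close> and
  \<open>left_comodule\<close> demand.\<close>

lemma vector_space_rec: "vector_space_rec M"
proof (rule moduleI)
  show "cring (ring_of_type_algebra :: 'k ring)" ..
  show "abelian_group M" by (rule abelian_group_axioms)
qed (auto simp: ring_of_type_algebra_def smult_l_distr smult_r_distr smult_assoc1)

lemma smult_zero_left [simp]:
  assumes x: "x \<in> carrier M"
  shows "0 \<odot> x = \<zero>"
proof -
  have "0 \<odot> x \<oplus> 0 \<odot> x = 0 \<odot> x"
    using smult_l_distr[OF x, of 0 0] by simp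
  then show ?thesis
    using add.l_cancel_one[of "0 \<odot> x" "0 \<odot> x"] x by simp
qed

lemma smult_zero_right [simp]: "c \<odot> \<zero> = \<zero>"
proof -
  have "c \<odot> \<zero> = c \<odot> (0 \<odot> \<zero>)" by simp
  also have "\<dots> = (c * 0) \<odot> \<zero>" by (simp only: smult_assoc1 zero_closed)
  also have "\<dots> = \<zero>" by simp
  finally show ?thesis .
qed

lemma smult_minus_one:
  assumes x: "x \<in> carrier M"
  shows "(-1) \<odot> x = \<ominus> x"
proof -
  have "(-1) \<odot> x \<oplus> x = \<zero>"
    using smult_l_distr[OF x, of "-1" 1] x by simp
  then show ?thesis
    using x by (simp add: minus_equality)
qed

lemma smult_commute: "x \<in> carrier M \<Longrightarrow> b \<odot> (c \<odot> x) = c \<odot> (b \<odot> x)"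
  by (simp add: smult_assoc1[symmetric] mult.commute)

lemma smult_finsum:
  assumes "f \<in> S \<rightarrow> carrier M"
  shows "c \<odot> (\<Oplus>i\<in>S. f i) = (\<Oplus>i\<in>S. c \<odot> f i)"
  using assms
proof (induction S rule: infinite_finite_induct)
  case (insert a S)
  then show ?case
    by (simp add: Pi_iff smult_r_distr)
qed auto

text \<open>Membership in the carrier is asked of the new summands only, so that in a chain of
  equations nothing has to be known about the old ones.\<close>

lemma finsum_cong_simple:
  assumes "\<And>i. i \<in> S \<Longrightarrow> f i = g i" and "\<And>i. i \<in> S \<Longrightarrow> g i \<in> carrier M"
  shows "finsum M f S = finsum M g S"
  by (rule finsum_cong') (use assms in auto)

lemma finsum_smult_left:
  assumes "x \<in> carrier M" "finite S"
  shows "(\<Oplus>i\<in>S. f i \<odot> x) = sum f S \<odot> x"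
  using assms(2)
proof (induction S)
  case (insert a S)
  then show ?case
    using assms(1) by (simp add: smult_l_distr Pi_iff)
qed (use assms(1) in simp)

lemma finsum_delta:
  assumes "finite S" "i \<in> S" "\<And>j. j \<in> S \<Longrightarrow> f j \<in> carrier M"
  shows "(\<Oplus>j\<in>S. (if j = i then c else 0) \<odot> f j) = c \<odot> f i"
proof -
  have "(\<Oplus>j\<in>S. (if j = i then c else 0) \<odot> f j) = (\<Oplus>j\<in>S. if j = i then c \<odot> f j else \<zero>)"
    by (rule finsum_cong_simple) (use assms in auto)
  also have "\<dots> = c \<odot> f i"
    by (rule add.finprod_singleton_swap) (use assms in auto)
  finally show ?thesis .
qed

lemma finsum_swap:
  assumes "finite S" "finite T" "\<And>i j. i \<in> S \<Longrightarrow> j \<in> T \<Longrightarrow> f i j \<in> carrier M"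
  shows "(\<Oplus>i\<in>S. \<Oplus>j\<in>T. f i j) = (\<Oplus>j\<in>T. \<Oplus>i\<in>S. f i j)"
  using assms(1,3)
proof (induction S)
  case empty
  show ?case by simp
next
  case (insert a S)
  have "(\<Oplus>i\<in>insert a S. \<Oplus>j\<in>T. f i j) = (\<Oplus>j\<in>T. f a j) \<oplus> (\<Oplus>i\<in>S. \<Oplus>j\<in>T. f i j)"
    by (rule finsum_insert) (use insert in \<open>auto intro!: finsum_closed\<close>)
  also have "\<dots> = (\<Oplus>j\<in>T. f a j) \<oplus> (\<Oplus>j\<in>T. \<Oplus>i\<in>S. f i j)"
    using insert by simp
  also have "\<dots> = (\<Oplus>j\<in>T. f a j \<oplus> (\<Oplus>i\<in>S. f i j))"
    by (rule finsum_addf[symmetric]) (use insert in \<open>auto intro!: finsum_closed\<close>)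
  also have "\<dots> = (\<Oplus>j\<in>T. \<Oplus>i\<in>insert a S. f i j)"
    by (rule finsum_cong_simple) (use insert in \<open>auto intro!: finsum_closed simp: Pi_iff\<close>)
  finally show ?case .
qed

lemma finsum_Sigma:
  assumes "finite S" "\<And>i. i \<in> S \<Longrightarrow> finite (T i)"
    and "\<And>i j. i \<in> S \<Longrightarrow> j \<in> T i \<Longrightarrow> f i j \<in> carrier M"
  shows "(\<Oplus>i\<in>S. \<Oplus>j\<in>T i. f i j) = (\<Oplus>z\<in>Sigma S T. f (fst z) (snd z))"
  using assms
proof (induction S)
  case empty
  show ?case by simp
next
  case (insert a S)
  have eq: "Sigma (insert a S) T = (Pair a ` T a) \<union> Sigma S T" by auto
  have "(\<Oplus>z\<in>Sigma (insert a S) T. f (fst z) (snd z)) =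
      (\<Oplus>z\<in>Pair a ` T a. f (fst z) (snd z)) \<oplus> (\<Oplus>z\<in>Sigma S T. f (fst z) (snd z))"
    unfolding eq by (rule finsum_Un_disjoint) (use insert in auto)
  also have "(\<Oplus>z\<in>Pair a ` T a. f (fst z) (snd z)) = (\<Oplus>j\<in>T a. f a j)"
    by (subst finsum_reindex) (use insert in \<open>auto simp: inj_on_def\<close>)
  also have "(\<Oplus>z\<in>Sigma S T. f (fst z) (snd z)) = (\<Oplus>i\<in>S. \<Oplus>j\<in>T i. f i j)"
    using insert by simp
  also have "(\<Oplus>j\<in>T a. f a j) \<oplus> (\<Oplus>i\<in>S. \<Oplus>j\<in>T i. f i j) = (\<Oplus>i\<in>insert a S. \<Oplus>j\<in>T i. f i j)"
    by (rule finsum_insert[symmetric]) (use insert in \<open>auto intro!: finsum_closed\<close>)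
  finally show ?case ..
qed

end

text \<open>Every axiom is an identity or the existence of negatives, and so passes to the image
  under a map that respects all operations. This is how quotients are recognised as
  algebras.\<close>

lemma kalg_image:
  fixes R :: "('k::field, 'a, 'm) module_scheme" and S :: "('k, 'b, 'n) module_scheme"
  assumes "kalg R"
    and carrier: "carrier S = f ` carrier R"
    and add: "\<And>x y. x \<in> carrier R \<Longrightarrow> y \<in> carrier R \<Longrightarrow> f x \<oplus>\<^bsub>S\<^esub> f y = f (x \<oplus>\<^bsub>R\<^esub> y)"
    and mult: "\<And>x y. x \<in> carrier R \<Longrightarrow> y \<in> carrier R \<Longrightarrow> f x \<otimes>\<^bsub>S\<^esub> f y = f (x \<otimes>\<^bsub>R\<^esub> y)"
    and smult: "\<And>c x. x \<in> carrier R \<Longrightarrow> c \<odot>\<^bsub>S\<^esub> f x = f (c \<odot>\<^bsub>R\<^esub> x)"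
    and zero: "\<zero>\<^bsub>S\<^esub> = f \<zero>\<^bsub>R\<^esub>" and one: "\<one>\<^bsub>S\<^esub> = f \<one>\<^bsub>R\<^esub>"
  shows "kalg S"
proof -
  interpret R: kalg R by fact
  note simps = carrier add mult smult zero one
  have "abelian_group S"
  proof (rule abelian_groupI)
    fix x assume "x \<in> carrier S"
    then obtain a where a: "a \<in> carrier R" "x = f a" using carrier by auto
    have "f (\<ominus>\<^bsub>R\<^esub> a) \<oplus>\<^bsub>S\<^esub> x = \<zero>\<^bsub>S\<^esub>" using a by (simp add: simps R.l_neg)
    then show "\<exists>y\<in>carrier S. y \<oplus>\<^bsub>S\<^esub> x = \<zero>\<^bsub>S\<^esub>" using a carrier by auto
  qed (auto simp: simps R.a_ac)
  then interpret S: abelian_group S .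
  show ?thesis
    by unfold_locales
      (auto simp: simps R.smult_l_distr R.smult_r_distr R.smult_assoc1 R.m_assoc R.l_distr
        R.r_distr R.smult_mult_left R.smult_mult_right)
qed

context kalg
begin

lemma finsum_mult_finsum:
  assumes "finite S" "finite T" "\<And>i. i \<in> S \<Longrightarrow> f i \<in> carrier A" "\<And>j. j \<in> T \<Longrightarrow> g j \<in> carrier A"
  shows "(\<Oplus>i\<in>S. f i) \<otimes> (\<Oplus>j\<in>T. g j) = (\<Oplus>i\<in>S. \<Oplus>j\<in>T. f i \<otimes> g j)"
proof -
  have "(\<Oplus>i\<in>S. f i) \<otimes> (\<Oplus>j\<in>T. g j) = (\<Oplus>i\<in>S. f i \<otimes> (\<Oplus>j\<in>T. g j))"
    by (rule finsum_ldistr) (use assms in \<open>auto intro!: finsum_closed\<close>)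
  also have "\<dots> = (\<Oplus>i\<in>S. \<Oplus>j\<in>T. f i \<otimes> g j)"
    by (rule finsum_cong_simple) (use assms in \<open>auto intro!: finsum_rdistr finsum_closed\<close>)
  finally show ?thesis .
qed

lemma finsum_smult_mult_left:
  assumes "finite S" "b \<in> carrier A" "\<And>i. i \<in> S \<Longrightarrow> f i \<in> carrier A"
  shows "(\<Oplus>i\<in>S. c i \<odot> f i) \<otimes> b = (\<Oplus>i\<in>S. c i \<odot> (f i \<otimes> b))"
proof -
  have "(\<Oplus>i\<in>S. c i \<odot> f i) \<otimes> b = (\<Oplus>i\<in>S. (c i \<odot> f i) \<otimes> b)"
    by (rule finsum_ldistr) (use assms in auto)
  also have "\<dots> = (\<Oplus>i\<in>S. c i \<odot> (f i \<otimes> b))"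
    by (rule finsum_cong_simple) (use assms in \<open>auto simp: smult_mult_left\<close>)
  finally show ?thesis .
qed

lemma finsum_smult_mult_right:
  assumes "finite S" "b \<in> carrier A" "\<And>i. i \<in> S \<Longrightarrow> f i \<in> carrier A"
  shows "b \<otimes> (\<Oplus>i\<in>S. c i \<odot> f i) = (\<Oplus>i\<in>S. c i \<odot> (b \<otimes> f i))"
proof -
  have "b \<otimes> (\<Oplus>i\<in>S. c i \<odot> f i) = (\<Oplus>i\<in>S. b \<otimes> (c i \<odot> f i))"
    by (rule finsum_rdistr) (use assms in auto)
  also have "\<dots> = (\<Oplus>i\<in>S. c i \<odot> (b \<otimes> f i))"
    by (rule finsum_cong_simple) (use assms in \<open>auto simp: smult_mult_right\<close>)
  finally show ?thesis .
qed

end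

text \<open>Serves the change between W_{\<kappa>\<mu>} and W_{\<mu>\<sigma>}: if the coefficients
  of a relation are a combination of the coefficients of other relations, then the relation is the
  same combination of those relations.\<close>

lemma (in kvec) finsum_sum_smult:
  assumes "finite S" "finite T" "\<And>i. i \<in> S \<Longrightarrow> f i \<in> carrier M"
  shows "(\<Oplus>i\<in>S. (\<Sum>j\<in>T. c j * d j i) \<odot> f i) = (\<Oplus>j\<in>T. c j \<odot> (\<Oplus>i\<in>S. d j i \<odot> f i))"
proof -
  have "(\<Oplus>i\<in>S. (\<Sum>j\<in>T. c j * d j i) \<odot> f i) = (\<Oplus>i\<in>S. \<Oplus>j\<in>T. (c j * d j i) \<odot> f i)"
    by (rule finsum_cong_simple) (use assms in \<open>auto simp: finsum_smult_left intro!: finsum_closed\<close>)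
  also have "\<dots> = (\<Oplus>j\<in>T. \<Oplus>i\<in>S. (c j * d j i) \<odot> f i)"
    by (rule finsum_swap) (use assms in auto)
  also have "\<dots> = (\<Oplus>j\<in>T. c j \<odot> (\<Oplus>i\<in>S. d j i \<odot> f i))"
  proof (rule finsum_cong_simple)
    fix j
    have "c j \<odot> (\<Oplus>i\<in>S. d j i \<odot> f i) = (\<Oplus>i\<in>S. c j \<odot> (d j i \<odot> f i))"
      by (rule smult_finsum) (use assms in auto)
    also have "\<dots> = (\<Oplus>i\<in>S. (c j * d j i) \<odot> f i)"
      by (rule finsum_cong_simple) (use assms in \<open>auto simp: smult_assoc1\<close>)
    finally show "(\<Oplus>i\<in>S. (c j * d j i) \<odot> f i) = c j \<odot> (\<Oplus>i\<in>S. d j i \<odot> f i)" ..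
  qed (use assms in \<open>auto intro!: finsum_closed\<close>)
  finally show ?thesis .
qed

lemma (in kvec) finsum_smult_finsum:
  assumes "finite S" "finite T" "\<And>i j. i \<in> S \<Longrightarrow> j \<in> T \<Longrightarrow> f i j \<in> carrier M"
  shows "(\<Oplus>i\<in>S. c i \<odot> (\<Oplus>j\<in>T. f i j)) = (\<Oplus>j\<in>T. \<Oplus>i\<in>S. c i \<odot> f i j)"
proof -
  have "(\<Oplus>i\<in>S. c i \<odot> (\<Oplus>j\<in>T. f i j)) = (\<Oplus>i\<in>S. \<Oplus>j\<in>T. c i \<odot> f i j)"
    by (rule finsum_cong_simple)
      (use assms in \<open>auto intro!: smult_finsum finsum_closed\<close>)
  also have "\<dots> = (\<Oplus>j\<in>T. \<Oplus>i\<in>S. c i \<odot> f i j)"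
    by (rule finsum_swap) (use assms in auto)
  finally show ?thesis .
qed


section \<open>Sums over multi-indices\<close>

abbreviation multi :: "nat \<Rightarrow> 'n list set" where
  "multi l \<equiv> {\<kappa>. length \<kappa> = l}"

lemma finite_lists_of_length [simp, intro]: "finite {\<kappa> :: 'n::finite list. length \<kappa> = l}"
  using finite_lists_length_eq[of "UNIV :: 'n set" l] by simp

lemma lists_of_length_append:
  "bij_betw (\<lambda>z. fst z @ snd z) ({\<kappa>. length \<kappa> = k} \<times> {\<mu>. length \<mu> = l})
    {\<nu>. length \<nu> = k + l}"
proof (rule bij_betw_byWitness[where f' = "\<lambda>\<nu>. (take k \<nu>, drop k \<nu>)"])
qed auto

lemma (in kvec) finsum_lists_append:
  fixes f :: "'n::finite list \<Rightarrow> 'a"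
  assumes f: "\<And>\<nu>. length \<nu> = k + l \<Longrightarrow> f \<nu> \<in> carrier M"
  shows "(\<Oplus>\<nu>\<in>multi (k + l). f \<nu>)
    = (\<Oplus>\<kappa>\<in>multi k. \<Oplus>\<mu>\<in>multi l. f (\<kappa> @ \<mu>))"
proof -
  let ?S = "{\<kappa> :: 'n list. length \<kappa> = k} \<times> {\<mu> :: 'n list. length \<mu> = l}"
  have img: "(\<lambda>z. fst z @ snd z) ` ?S = {\<nu> :: 'n list. length \<nu> = k + l}"
    and inj: "inj_on (\<lambda>z. fst z @ snd z) ?S"
    using lists_of_length_append[of k l, where 'a = 'n] by (auto simp: bij_betw_def)
  have "(\<Oplus>\<nu>\<in>multi (k + l). f \<nu>) = (\<Oplus>z\<in>?S. f (fst z @ snd z))"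
    unfolding img[symmetric] by (rule finsum_reindex) (use f inj in auto)
  also have "\<dots> = (\<Oplus>\<kappa>\<in>multi k. \<Oplus>\<mu>\<in>multi l. f (\<kappa> @ \<mu>))"
    by (rule finsum_Sigma[symmetric]) (use f in auto)
  finally show ?thesis .
qed

lemma (in kvec) finsum_lists_one:
  fixes f :: "'n::finite list \<Rightarrow> 'a"
  assumes f: "\<And>i. f [i] \<in> carrier M"
  shows "(\<Oplus>\<nu>\<in>multi (Suc 0). f \<nu>) = (\<Oplus>i\<in>UNIV. f [i])"
proof -
  have "(multi (Suc 0) :: 'n list set) = (\<lambda>i. [i]) ` UNIV"
    by (auto simp: length_Suc_conv)
  then show ?thesis
    by (simp only:) (rule finsum_reindex, use f in \<open>auto simp: inj_on_def\<close>)
qed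

lemma (in kvec) finsum_lists_Cons:
  fixes f :: "'n::finite list \<Rightarrow> 'a"
  assumes f: "\<And>\<nu>. length \<nu> = Suc l \<Longrightarrow> f \<nu> \<in> carrier M"
  shows "(\<Oplus>\<nu>\<in>multi (Suc l). f \<nu>) = (\<Oplus>i\<in>UNIV. \<Oplus>\<mu>\<in>multi l. f (i # \<mu>))"
proof -
  let ?S = "(UNIV :: 'n set) \<times> multi l"
  have img: "(\<lambda>z. fst z # snd z) ` ?S = multi (Suc l)"
    by (force simp: length_Suc_conv image_iff)
  have "(\<Oplus>\<nu>\<in>multi (Suc l). f \<nu>) = (\<Oplus>z\<in>?S. f (fst z # snd z))"
    unfolding img[symmetric] by (rule finsum_reindex) (use f in \<open>auto simp: inj_on_def\<close>)
  also have "\<dots> = (\<Oplus>i\<in>UNIV. \<Oplus>\<mu>\<in>multi l. f (i # \<mu>))"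
    by (rule finsum_Sigma[symmetric]) (use f in auto)
  finally show ?thesis .
qed

lemma sum_lists_Cons:
  fixes f :: "'n::finite list \<Rightarrow> 'k::comm_monoid_add"
  shows "(\<Sum>\<nu>\<in>multi (Suc l). f \<nu>) = (\<Sum>i\<in>UNIV. \<Sum>\<mu>\<in>multi l. f (i # \<mu>))"
proof -
  have "(\<Sum>\<nu>\<in>multi (Suc l). f \<nu>) = (\<Sum>z\<in>UNIV \<times> multi l. f (fst z # snd z))"
    by (rule sum.reindex_bij_witness[of _ "\<lambda>z. fst z # snd z" "\<lambda>\<nu>. (hd \<nu>, tl \<nu>)"])
      (auto simp: length_Suc_conv)
  then show ?thesis by (simp add: sum.cartesian_product case_prod_beta)
qed


section \<open>Linear maps and algebra homomorphisms\<close>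

lemma linear_mapsI:
  assumes "\<And>x. x \<in> carrier M \<Longrightarrow> f x \<in> carrier L"
    and "\<And>x y. x \<in> carrier M \<Longrightarrow> y \<in> carrier M \<Longrightarrow> f (x \<oplus>\<^bsub>M\<^esub> y) = f x \<oplus>\<^bsub>L\<^esub> f y"
    and "\<And>c x. x \<in> carrier M \<Longrightarrow> f (c \<odot>\<^bsub>M\<^esub> x) = c \<odot>\<^bsub>L\<^esub> f x"
  shows "f \<in> linear_maps M L"
  using assms by (auto simp: linear_maps_def)

lemma linear_mapsD:
  assumes "f \<in> linear_maps M L"
  shows "x \<in> carrier M \<Longrightarrow> f x \<in> carrier L"
    and "x \<in> carrier M \<Longrightarrow> y \<in> carrier M \<Longrightarrow> f (x \<oplus>\<^bsub>M\<^esub> y) = f x \<oplus>\<^bsub>L\<^esub> f y"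
    and "x \<in> carrier M \<Longrightarrow> f (c \<odot>\<^bsub>M\<^esub> x) = c \<odot>\<^bsub>L\<^esub> f x"
  using assms by (auto simp: linear_maps_def)

lemma id_linear: "id \<in> linear_maps M M"
  by (auto simp: linear_maps_def)

lemma linear_maps_comp:
  "g \<in> linear_maps L P \<Longrightarrow> f \<in> linear_maps M L \<Longrightarrow> (\<lambda>x. g (f x)) \<in> linear_maps M P"
  by (auto simp: linear_maps_def Pi_iff)

lemma linear_maps_zero:
  assumes "kvec M" "kvec L" "f \<in> linear_maps M L"
  shows "f \<zero>\<^bsub>M\<^esub> = \<zero>\<^bsub>L\<^esub>"
proof -
  interpret M: kvec M by fact
  interpret L: kvec L by fact
  have "f (0 \<odot>\<^bsub>M\<^esub> \<zero>\<^bsub>M\<^esub>) = 0 \<odot>\<^bsub>L\<^esub> f \<zero>\<^bsub>M\<^esub>"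
    using assms(3) by (simp only: linear_mapsD M.zero_closed)
  then show ?thesis
    using linear_mapsD(1)[OF assms(3) M.zero_closed] by simp
qed

text \<open>Finiteness of the index set is not an assumption: over an infinite set both sums are
  zero by convention, and a linear map preserves zero.\<close>

lemma linear_maps_finsum:
  assumes "kvec M" "kvec L" "f \<in> linear_maps M L" "\<And>i. i \<in> S \<Longrightarrow> g i \<in> carrier M"
  shows "f (finsum M g S) = (\<Oplus>\<^bsub>L\<^esub>i\<in>S. f (g i))"
proof -
  interpret M: kvec M by fact
  interpret L: kvec L by fact
  show ?thesis
    using assms(4)
  proof (induction S rule: infinite_finite_induct)
    case (insert a S)
    have "f (finsum M g (insert a S)) = f (g a \<oplus>\<^bsub>M\<^esub> finsum M g S)"
      using insert by (simp add: Pi_iff)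
    also have "\<dots> = f (g a) \<oplus>\<^bsub>L\<^esub> f (finsum M g S)"
      by (rule linear_mapsD[OF assms(3)]) (use insert in \<open>auto intro!: M.finsum_closed\<close>)
    also have "\<dots> = (\<Oplus>\<^bsub>L\<^esub>i\<in>insert a S. f (g i))"
      using insert linear_mapsD(1)[OF assms(3)] by (simp add: Pi_iff)
    finally show ?case .
  qed (auto simp: linear_maps_zero[OF assms(1-3)])
qed

lemma alg_homD:
  assumes "f \<in> alg_hom A B"
  shows "x \<in> carrier A \<Longrightarrow> f x \<in> carrier B"
    and "x \<in> carrier A \<Longrightarrow> y \<in> carrier A \<Longrightarrow> f (x \<oplus>\<^bsub>A\<^esub> y) = f x \<oplus>\<^bsub>B\<^esub> f y"
    and "x \<in> carrier A \<Longrightarrow> y \<in> carrier A \<Longrightarrow> f (x \<otimes>\<^bsub>A\<^esub> y) = f x \<otimes>\<^bsub>B\<^esub> f y"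
    and "x \<in> carrier A \<Longrightarrow> f (c \<odot>\<^bsub>A\<^esub> x) = c \<odot>\<^bsub>B\<^esub> f x"
    and "f \<one>\<^bsub>A\<^esub> = \<one>\<^bsub>B\<^esub>"
    and "f \<in> extensional (carrier A)"
  using assms by (auto simp: alg_hom_def ring_hom_def)

lemma alg_hom_linear: "f \<in> alg_hom A B \<Longrightarrow> f \<in> linear_maps A B"
  by (rule linear_mapsI) (auto dest: alg_homD)


section \<open>Monoid algebras\<close>

lemma lookup_map_times: "Poly_Mapping.lookup (Poly_Mapping.map ((*) c) p) k
    = c * Poly_Mapping.lookup p (k :: 'g) " for c :: "'k::field"
  by (simp add: Poly_Mapping.map.rep_eq when_def)

lemma map_times_single: "Poly_Mapping.map ((*) c) (Poly_Mapping.single a b)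
    = Poly_Mapping.single a (c * b)" for c :: "'k::field"
  by (rule poly_mapping_eqI) (simp add: lookup_map_times lookup_single when_def)

lemma poly_mapping_sum_single:
  "(\<Sum>a\<in>Poly_Mapping.keys p. Poly_Mapping.single a (Poly_Mapping.lookup p a)) = p"
proof (rule poly_mapping_eqI)
  fix k
  show "Poly_Mapping.lookup (\<Sum>a\<in>Poly_Mapping.keys p. Poly_Mapping.single a (Poly_Mapping.lookup p a)) k
      = Poly_Mapping.lookup p k"
    by (cases "k \<in> Poly_Mapping.keys p")
      (auto simp: lookup_sum lookup_single when_def in_keys_iff sum.delta)
qed

lemma monoid_algebra_simps:
  "carrier (monoid_algebra G) = {p. Poly_Mapping.keys p \<subseteq> carrier G}"
  "\<one>\<^bsub>monoid_algebra G\<^esub> = Poly_Mapping.single \<one>\<^bsub>G\<^esub> 1"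
  "\<zero>\<^bsub>monoid_algebra G\<^esub> = 0"
  "p \<oplus>\<^bsub>monoid_algebra G\<^esub> q = p + q"
  "c \<odot>\<^bsub>monoid_algebra G\<^esub> p = Poly_Mapping.map ((*) c) p"
  by (simp_all add: monoid_algebra_def)

lemma monoid_algebra_add_closed:
  "p \<in> carrier (monoid_algebra G) \<Longrightarrow> q \<in> carrier (monoid_algebra G) \<Longrightarrow> 
    p + q \<in> carrier (monoid_algebra G)"
  using keys_add[of p q] by (auto simp: monoid_algebra_simps)

text \<open>An element is the sum of its monomials. The partial sums stay in the carrier, and the
  inner induction carries this along so that the case \<open>add\<close> can be applied to
  them.\<close>

lemma monoid_algebra_induct [consumes 1, case_names zero single add]:
  assumes "p \<in> carrier (monoid_algebra G)"
    and "P 0"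
    and "\<And>a c. a \<in> carrier G \<Longrightarrow> P (Poly_Mapping.single a c)"
    and "\<And>p q. p \<in> carrier (monoid_algebra G) \<Longrightarrow> q \<in> carrier (monoid_algebra G) \<Longrightarrow>
        P p \<Longrightarrow> P q \<Longrightarrow> P (p + q)"
  shows "P p"
proof -
  let ?q = "\<lambda>S. \<Sum>a\<in>S. Poly_Mapping.single a (Poly_Mapping.lookup p a)"
  have "?q S \<in> carrier (monoid_algebra G) \<and> P (?q S)" if "finite S" "S \<subseteq> carrier G" for S
    using that
  proof (induction S)
    case empty
    then show ?case using assms(2) by (simp add: monoid_algebra_simps)
  next
    case (insert a S)
    have s: "Poly_Mapping.single a (Poly_Mapping.lookup p a) \<in> carrier (monoid_algebra G)"
      using insert by (auto simp: monoid_algebra_simps)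
    then have "Poly_Mapping.single a (Poly_Mapping.lookup p a) + ?q S \<in> carrier (monoid_algebra G)"
      using insert by (intro monoid_algebra_add_closed) auto
    moreover have "P (Poly_Mapping.single a (Poly_Mapping.lookup p a) + ?q S)"
      by (rule assms(4)) (use s insert assms(3) in auto)
    ultimately show ?case using insert by simp
  qed
  from this[of "Poly_Mapping.keys p"] show ?thesis
    using assms(1) by (simp add: monoid_algebra_simps poly_mapping_sum_single)
qed

section \<open>The product of a monoid algebra\<close>

context
  fixes G :: "('g, 'm) monoid_scheme" (structure)
begin

abbreviation (input) "KG \<equiv> (monoid_algebra G :: ('k::field, 'g \<Rightarrow>\<^sub>0 'k) module)"

text \<open>The defining double sum runs over the supports, which change when elements are added.
  Over common larger index sets the product is visibly additive term by term.\<close>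

lemma monoid_algebra_mult_superset:
  assumes "finite S" "finite T" "Poly_Mapping.keys p \<subseteq> S" "Poly_Mapping.keys q \<subseteq> T"
  shows "p \<otimes>\<^bsub>KG\<^esub> q = (\<Sum>a\<in>S. \<Sum>b\<in>T. Poly_Mapping.single (a \<otimes> b)
      (Poly_Mapping.lookup p a * Poly_Mapping.lookup q b))"
proof -
  have "p \<otimes>\<^bsub>KG\<^esub> q = (\<Sum>a\<in>Poly_Mapping.keys p. \<Sum>b\<in>Poly_Mapping.keys q.
      Poly_Mapping.single (a \<otimes> b) (Poly_Mapping.lookup p a * Poly_Mapping.lookup q b))"
    by (simp add: monoid_algebra_def)
  also have "\<dots> = (\<Sum>a\<in>Poly_Mapping.keys p. \<Sum>b\<in>T.
      Poly_Mapping.single (a \<otimes> b) (Poly_Mapping.lookup p a * Poly_Mapping.lookup q b))"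
    by (intro sum.cong refl sum.mono_neutral_left) (use assms in \<open>auto simp: in_keys_iff\<close>)
  also have "\<dots> = (\<Sum>a\<in>S. \<Sum>b\<in>T.
      Poly_Mapping.single (a \<otimes> b) (Poly_Mapping.lookup p a * Poly_Mapping.lookup q b))"
    by (intro sum.mono_neutral_left) (use assms in \<open>auto simp: in_keys_iff\<close>)
  finally show ?thesis .
qed

lemma monoid_algebra_mult_single:
  "Poly_Mapping.single a c \<otimes>\<^bsub>KG\<^esub> Poly_Mapping.single b d = Poly_Mapping.single (a \<otimes> b) (c * d)"
  by (subst monoid_algebra_mult_superset[of "{a}" "{b}"]) auto

lemma monoid_algebra_mult_add_left: "(p + p') \<otimes>\<^bsub>KG\<^esub> q = p \<otimes>\<^bsub>KG\<^esub> q + p' \<otimes>\<^bsub>KG\<^esub> q"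
proof -
  let ?S = "Poly_Mapping.keys p \<union> Poly_Mapping.keys p'" and ?T = "Poly_Mapping.keys q"
  have "Poly_Mapping.keys (p + p') \<subseteq> ?S" by (rule keys_add)
  then show ?thesis
    by (simp add: monoid_algebra_mult_superset[of ?S ?T] lookup_add distrib_right single_add sum.distrib)
qed

lemma monoid_algebra_mult_add_right: "q \<otimes>\<^bsub>KG\<^esub> (p + p') = q \<otimes>\<^bsub>KG\<^esub> p + q \<otimes>\<^bsub>KG\<^esub> p'"
proof -
  let ?S = "Poly_Mapping.keys p \<union> Poly_Mapping.keys p'" and ?T = "Poly_Mapping.keys q"
  have "Poly_Mapping.keys (p + p') \<subseteq> ?S" by (rule keys_add)
  then show ?thesis
    by (simp add: monoid_algebra_mult_superset[of ?T ?S] lookup_add distrib_left single_add sum.distrib)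
qed

lemma monoid_algebra_mult_zero: "0 \<otimes>\<^bsub>KG\<^esub> q = 0" "q \<otimes>\<^bsub>KG\<^esub> 0 = 0"
  by (simp_all add: monoid_algebra_def)

end

lemma map_times_add:
  "Poly_Mapping.map ((*) c) (p + q) = Poly_Mapping.map ((*) c) p + Poly_Mapping.map ((*) c) q"
  for c :: "'k::field"
  by (rule poly_mapping_eqI) (simp add: lookup_map_times lookup_add distrib_left)

lemma map_times_zero: "Poly_Mapping.map ((*) c) 0 = 0" for c :: "'k::field"
  by (rule poly_mapping_eqI) (simp add: lookup_map_times)

lemma keys_map_times: "Poly_Mapping.keys (Poly_Mapping.map ((*) c) p) \<subseteq> Poly_Mapping.keys p"
  for c :: "'k::field"
  by (auto simp: in_keys_iff lookup_map_times)

text \<open>The identities that involve the product are additive in each argument, so nested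
  inductions reduce them to monomials, where they are the laws of the monoid and of the field. The
  remaining identities for the scalars hold coefficientwise.\<close>

lemma monoid_algebra_kalg:
  assumes "monoid G"
  shows "kalg (monoid_algebra G :: ('k::field, 'g \<Rightarrow>\<^sub>0 'k) module)" (is "kalg ?KG")
proof -
  interpret G: monoid G by fact
  note simps = monoid_algebra_simps
  note mults = monoid_algebra_mult_add_left monoid_algebra_mult_add_right
    monoid_algebra_mult_zero monoid_algebra_mult_single
  have single: "Poly_Mapping.single a c \<in> carrier ?KG" if "a \<in> carrier G" for a c
    using that by (auto simp: simps)
  have mult_closed: "p \<otimes>\<^bsub>?KG\<^esub> q \<in> carrier ?KG" if "p \<in> carrier ?KG" "q \<in> carrier ?KG" for p q
    using that(1)
  proof (induction rule: monoid_algebra_induct)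
    case (single a c)
    from that(2) show ?case
      by (induction rule: monoid_algebra_induct)
        (use single in \<open>auto simp: mults \<open>\<And>c a. a \<in> carrier G \<Longrightarrow> Poly_Mapping.single a c \<in> carrier ?KG\<close>
            monoid_algebra_add_closed\<close>, auto simp: simps)
  qed (auto simp: mults monoid_algebra_add_closed, auto simp: simps)
  have assoc: "p \<otimes>\<^bsub>?KG\<^esub> q \<otimes>\<^bsub>?KG\<^esub> r = p \<otimes>\<^bsub>?KG\<^esub> (q \<otimes>\<^bsub>?KG\<^esub> r)"
    if "p \<in> carrier ?KG" "q \<in> carrier ?KG" "r \<in> carrier ?KG" for p q r
    using that(1)
  proof (induction rule: monoid_algebra_induct)
    case (single a c)
    from that(2) show ?case
    proof (induction rule: monoid_algebra_induct)
      case (single b d)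
      from that(3) show ?case
        by (induction rule: monoid_algebra_induct)
          (use single \<open>a \<in> carrier G\<close> in \<open>auto simp: mults G.m_assoc mult.assoc\<close>)
    qed (auto simp: mults)
  qed (auto simp: mults)
  have one_left: "\<one>\<^bsub>?KG\<^esub> \<otimes>\<^bsub>?KG\<^esub> p = p" if "p \<in> carrier ?KG" for p
    using that by (induction rule: monoid_algebra_induct) (auto simp: mults simps(2))
  have one_right: "p \<otimes>\<^bsub>?KG\<^esub> \<one>\<^bsub>?KG\<^esub> = p" if "p \<in> carrier ?KG" for p
    using that by (induction rule: monoid_algebra_induct) (auto simp: mults simps(2))
  have smult_left: "c \<odot>\<^bsub>?KG\<^esub> p \<otimes>\<^bsub>?KG\<^esub> q = c \<odot>\<^bsub>?KG\<^esub> (p \<otimes>\<^bsub>?KG\<^esub> q)"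
    if "p \<in> carrier ?KG" "q \<in> carrier ?KG" for c p q
    using that(1)
  proof (induction rule: monoid_algebra_induct)
    case (single a b)
    from that(2) show ?case
      by (induction rule: monoid_algebra_induct)
        (auto simp: mults simps(5) map_times_zero map_times_add map_times_single mult.assoc)
  qed (auto simp: mults simps(5) map_times_zero map_times_add)
  have smult_right: "p \<otimes>\<^bsub>?KG\<^esub> (c \<odot>\<^bsub>?KG\<^esub> q) = c \<odot>\<^bsub>?KG\<^esub> (p \<otimes>\<^bsub>?KG\<^esub> q)"
    if "p \<in> carrier ?KG" "q \<in> carrier ?KG" for c p q
    using that(1)
  proof (induction rule: monoid_algebra_induct)
    case (single a b)
    from that(2) show ?case
      by (induction rule: monoid_algebra_induct)
        (auto simp: mults simps(5) map_times_zero map_times_add map_times_single mult.left_commute)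
  qed (auto simp: mults simps(5) map_times_zero map_times_add)
  have "abelian_group ?KG"
  proof (rule abelian_groupI)
    fix p assume p: "p \<in> carrier ?KG"
    show "\<exists>q\<in>carrier ?KG. q \<oplus>\<^bsub>?KG\<^esub> p = \<zero>\<^bsub>?KG\<^esub>"
    proof
      show "- p \<in> carrier ?KG" using p by (auto simp: simps in_keys_iff)
    qed (simp add: simps)
  next
    show "\<zero>\<^bsub>?KG\<^esub> \<in> carrier ?KG" by (simp add: simps)
  qed (simp_all only: simps(3,4) add_0_left add_0_right add.assoc add.commute add.left_commute monoid_algebra_add_closed)
  then interpret KG: abelian_group ?KG .
  show ?thesis
  proof unfold_locales
    fix c p assume "p \<in> carrier ?KG"
    then show "c \<odot>\<^bsub>?KG\<^esub> p \<in> carrier ?KG"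
      using keys_map_times[of c p] by (auto simp: simps)
    fix b
    show "(b + c) \<odot>\<^bsub>?KG\<^esub> p = b \<odot>\<^bsub>?KG\<^esub> p \<oplus>\<^bsub>?KG\<^esub> c \<odot>\<^bsub>?KG\<^esub> p"
      by (rule poly_mapping_eqI) (simp add: simps lookup_map_times lookup_add distrib_right)
    show "(b * c) \<odot>\<^bsub>?KG\<^esub> p = b \<odot>\<^bsub>?KG\<^esub> (c \<odot>\<^bsub>?KG\<^esub> p)"
      by (rule poly_mapping_eqI) (simp add: simps lookup_map_times mult.assoc)
    show "1 \<odot>\<^bsub>?KG\<^esub> p = p"
      by (rule poly_mapping_eqI) (simp add: simps lookup_map_times)
  next
    show "\<one>\<^bsub>?KG\<^esub> \<in> carrier ?KG" using single by (simp add: simps(2))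
  qed (simp_all only: mult_closed assoc one_left one_right smult_left[unfolded simps(5)]
      smult_right[unfolded simps(5)]
      simps(4,5) mults map_times_add)
qed


text \<open>Defining relations are written with the type class sum, whereas linear maps are known to
  respect \<open>finsum\<close>; here the two are identified.\<close>

lemma monoid_algebra_finsum:
  assumes "monoid G" "\<And>i. i \<in> S \<Longrightarrow> f i \<in> carrier (monoid_algebra G)"
  shows "finsum (monoid_algebra G) f S = sum f S"
proof -
  interpret kalg "monoid_algebra G" by (rule monoid_algebra_kalg) fact
  show ?thesis
    using assms(2)
  proof (induction S rule: infinite_finite_induct)
    case (insert a S)
    then have "finsum (monoid_algebra G) f (insert a S) = f a \<oplus>\<^bsub>monoid_algebra G\<^esub> sum f S"
      by (simp add: Pi_iff)
    then show ?case using insert by (simp add: monoid_algebra_simps(4))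
  qed (auto simp: monoid_algebra_simps(3))
qed

text \<open>The linear extension of a map given on basis vectors. The sum inside
  \<open>tensor_lift\<close> has this form, and so do the maps from which homomorphisms out of a
  presented algebra are obtained.\<close>

definition lin_ext ::
  "('k::field, 'c, 'l) module_scheme \<Rightarrow> ('g \<Rightarrow> 'c) \<Rightarrow> ('g \<Rightarrow>\<^sub>0 'k) \<Rightarrow> 'c" where
  "lin_ext M f p = (\<Oplus>\<^bsub>M\<^esub>z\<in>Poly_Mapping.keys p. Poly_Mapping.lookup p z \<odot>\<^bsub>M\<^esub> f z)"

context kvec
begin

lemma lin_ext_superset:
  assumes "finite S" "Poly_Mapping.keys p \<subseteq> S" "f \<in> S \<rightarrow> carrier M"
  shows "lin_ext M f p = (\<Oplus>z\<in>S. Poly_Mapping.lookup p z \<odot> f z)"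
  unfolding lin_ext_def
  by (rule add.finprod_mono_neutral_cong_left) (use assms in \<open>auto simp: in_keys_iff Pi_iff\<close>)

lemma lin_ext_single:
  assumes "f z \<in> carrier M"
  shows "lin_ext M f (Poly_Mapping.single z c) = c \<odot> f z"
  using assms by (subst lin_ext_superset[of "{z}"]) auto

lemma lin_ext_linear:
  fixes G :: "('g, 'n) monoid_scheme"
  assumes "f \<in> carrier G \<rightarrow> carrier M"
  shows "lin_ext M f \<in> linear_maps (monoid_algebra G) M"
proof (rule linear_mapsI)
  fix p :: "'g \<Rightarrow>\<^sub>0 'k"
  assume p: "p \<in> carrier (monoid_algebra G)"
  then have fp: "f \<in> Poly_Mapping.keys p \<rightarrow> carrier M"
    using assms by (auto simp: monoid_algebra_simps)
  then show "lin_ext M f p \<in> carrier M"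
    unfolding lin_ext_def by (intro finsum_closed) auto
  show "lin_ext M f (c \<odot>\<^bsub>monoid_algebra G\<^esub> p) = c \<odot> lin_ext M f p" for c
  proof -
    have "lin_ext M f (Poly_Mapping.map ((*) c) p)
        = (\<Oplus>z\<in>Poly_Mapping.keys p. (c * Poly_Mapping.lookup p z) \<odot> f z)"
      by (subst lin_ext_superset[OF _ keys_map_times]) (use fp in \<open>auto simp: lookup_map_times\<close>)
    also have "\<dots> = (\<Oplus>z\<in>Poly_Mapping.keys p. c \<odot> (Poly_Mapping.lookup p z \<odot> f z))"
      by (rule finsum_cong_simple) (use fp in \<open>auto simp: smult_assoc1 Pi_iff\<close>)
    also have "\<dots> = c \<odot> lin_ext M f p"
      unfolding lin_ext_def by (rule smult_finsum[symmetric]) (use fp in auto)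
    finally show ?thesis by (simp add: monoid_algebra_simps)
  qed
  fix q :: "'g \<Rightarrow>\<^sub>0 'k"
  assume q: "q \<in> carrier (monoid_algebra G)"
  let ?S = "Poly_Mapping.keys p \<union> Poly_Mapping.keys q"
  have fS: "f \<in> ?S \<rightarrow> carrier M"
    using p q assms by (auto simp: monoid_algebra_simps)
  have "lin_ext M f (p + q) = (\<Oplus>z\<in>?S. Poly_Mapping.lookup (p + q) z \<odot> f z)"
    by (rule lin_ext_superset) (use keys_add[of p q] fS in auto)
  also have "\<dots> = (\<Oplus>z\<in>?S. Poly_Mapping.lookup p z \<odot> f z \<oplus> Poly_Mapping.lookup q z \<odot> f z)"
    by (rule finsum_cong_simple) (use fS in \<open>auto simp: lookup_add smult_l_distr Pi_iff\<close>)
  also have "\<dots> = (\<Oplus>z\<in>?S. Poly_Mapping.lookup p z \<odot> f z) \<oplus> (\<Oplus>z\<in>?S. Poly_Mapping.lookup q z \<odot> f z)"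
    by (rule finsum_addf) (use fS in auto)
  also have "\<dots> = lin_ext M f p \<oplus> lin_ext M f q"
    using fS by (simp add: lin_ext_superset[of ?S])
  finally show "lin_ext M f (p \<oplus>\<^bsub>monoid_algebra G\<^esub> q) = lin_ext M f p \<oplus> lin_ext M f q"
    by (simp add: monoid_algebra_simps)
qed

end

text \<open>Both sides are additive in \<open>p\<close> and in \<open>q\<close>. On monomials the
  claim is the hypothesis \<open>mult\<close>, once the coefficients have been moved out of the
  products.\<close>

lemma lin_ext_mult:
  fixes G :: "('g, 'm) monoid_scheme" and B :: "('k::field, 'c, 'l) module_scheme"
  assumes "monoid G" "kalg B" and f: "f \<in> carrier G \<rightarrow> carrier B"
    and mult: "\<And>a b. a \<in> carrier G \<Longrightarrow> b \<in> carrier G \<Longrightarrow> f (a \<otimes>\<^bsub>G\<^esub> b) = f a \<otimes>\<^bsub>B\<^esub> f b"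
    and "p \<in> carrier (monoid_algebra G)" "q \<in> carrier (monoid_algebra G)"
  shows "lin_ext B f (p \<otimes>\<^bsub>monoid_algebra G\<^esub> q) = lin_ext B f p \<otimes>\<^bsub>B\<^esub> lin_ext B f q"
proof -
  interpret G: monoid G by fact
  interpret B: kalg B by fact
  interpret KG: kalg "monoid_algebra G" by (rule monoid_algebra_kalg) fact
  note lin = B.lin_ext_linear[OF f]
  note simps = monoid_algebra_mult_zero monoid_algebra_mult_add_left monoid_algebra_mult_add_right
    monoid_algebra_mult_single
  have ext_zero: "lin_ext B f 0 = \<zero>\<^bsub>B\<^esub>" by (simp add: lin_ext_def)
  have ext_add: "lin_ext B f (p + q) = lin_ext B f p \<oplus>\<^bsub>B\<^esub> lin_ext B f q"
    if "p \<in> carrier (monoid_algebra G)" "q \<in> carrier (monoid_algebra G)" for p q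
    using linear_mapsD(2)[OF lin that] by (simp add: monoid_algebra_simps)
  have ext_closed: "p \<in> carrier (monoid_algebra G) \<Longrightarrow> lin_ext B f p \<in> carrier B" for p
    using linear_mapsD(1)[OF lin] by blast
  have sc: "Poly_Mapping.single a c \<in> carrier (monoid_algebra G)" if "a \<in> carrier G"
    for a and c :: 'k
    using that by (auto simp: monoid_algebra_simps)
  from assms(5) show ?thesis
  proof (induction rule: monoid_algebra_induct)
    case zero
    show ?case using ext_closed[OF assms(6)] by (simp add: simps ext_zero)
  next
    case (single a c)
    note a = single
    from assms(6) show ?case
    proof (induction rule: monoid_algebra_induct)
      case zero
      show ?case using ext_closed[OF sc[OF a]]
        by (simp add: simps ext_zero)
    next
      case (single b d)
      have "f a \<in> carrier B" "f b \<in> carrier B" "f (a \<otimes>\<^bsub>G\<^esub> b) \<in> carrier B" using f a single by auto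
      then show ?case
        by (simp add: simps B.lin_ext_single mult a single B.smult_mult_left B.smult_mult_right
          B.smult_assoc1 B.smult_commute[of _ c])
    next
      case (add q q')
      have s: "Poly_Mapping.single a c \<in> carrier (monoid_algebra G)"
        using a by (auto simp: monoid_algebra_simps)
      show ?case
        using add s ext_closed ext_add
        by (simp add: simps B.r_distr)
    qed
  next
    case (add p p')
    then show ?case
      using assms(6) ext_closed ext_add
      by (simp add: simps B.l_distr)
  qed
qed


section \<open>Quotient algebras\<close>

locale kalg_ideal = kalg R + ideal I R for I and R :: "('k::field, 'a, 'm) module_scheme" (structure)
begin

text \<open>In a unital algebra scalars act through multiples of the unit, so a ring ideal is a
  subspace and the ring quotient is a quotient of algebras.\<close>

lemma smult_ideal:
  assumes "x \<in> I"
  shows "c \<odot> x \<in> I"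
proof -
  have x: "x \<in> carrier R" using assms by (rule a_Hcarr)
  then have "c \<odot> x = (c \<odot> \<one>) \<otimes> x" by (simp add: smult_mult_left)
  then show ?thesis using assms by (simp add: I_l_closed)
qed

lemma rcosE:
  assumes "x \<in> I +> a"
  obtains i where "i \<in> I" "x = i \<oplus> a"
  using assms by (auto simp: a_r_coset_def')

lemma coset_eqI:
  assumes "i \<in> I" "q \<in> carrier R" "p = i \<oplus> q"
  shows "I +> p = I +> q"
proof -
  have "p \<in> I +> q" using assms by (auto simp: a_r_coset_def')
  then show ?thesis
    using a_repr_independence[of p I q] assms(2) a_subgroup by simp
qed

lemma quotient_carrier: "carrier (quotient_algebra R I) = (+>) I ` carrier R"
  by (auto simp: quotient_algebra_def ring.defs module.defs FactRing_def A_RCOSETS_def')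

lemma quotient_ops:
  "x \<in> carrier R \<Longrightarrow> y \<in> carrier R \<Longrightarrow> (I +> x) \<oplus>\<^bsub>quotient_algebra R I\<^esub> (I +> y) = I +> (x \<oplus> y)"
  "x \<in> carrier R \<Longrightarrow> y \<in> carrier R \<Longrightarrow> (I +> x) \<otimes>\<^bsub>quotient_algebra R I\<^esub> (I +> y) = I +> (x \<otimes> y)"
  "\<one>\<^bsub>quotient_algebra R I\<^esub> = I +> \<one>"
  "\<zero>\<^bsub>quotient_algebra R I\<^esub> = I +> \<zero>"
  by (simp_all add: quotient_algebra_def ring.defs module.defs FactRing_def a_rcos_sum
    rcoset_mult_add a_subset)

text \<open>The union in the definition of the scalar multiplication runs over representatives; two
  of them differ by an element of the ideal, hence so do their multiples, and all the cosets in the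
  union agree.\<close>

lemma quotient_smult:
  assumes x: "x \<in> carrier R"
  shows "c \<odot>\<^bsub>quotient_algebra R I\<^esub> (I +> x) = I +> (c \<odot> x)"
proof -
  have "I +> (c \<odot> y) = I +> (c \<odot> x)" if y: "y \<in> I +> x" for y
  proof -
    obtain i where "i \<in> I" "y = i \<oplus> x" using y by (rule rcosE)
    then have "c \<odot> y = c \<odot> i \<oplus> c \<odot> x" using x by (simp add: smult_r_distr a_Hcarr)
    then show ?thesis by (intro coset_eqI[of "c \<odot> i"] smult_ideal) (use x \<open>i \<in> I\<close> in auto)
  qed
  moreover have "x \<in> I +> x" using x by (rule a_rcos_self)
  ultimately have "(\<Union>y\<in>I +> x. I +> (c \<odot> y)) = I +> (c \<odot> x)" by blast
  then show ?thesis by (simp add: quotient_algebra_def ring.defs module.defs)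
qed

lemma quotient_kalg: "kalg (quotient_algebra R I)"
  by (rule kalg_image[where f = "(+>) I", OF kalg_axioms])
    (simp_all add: quotient_carrier quotient_ops quotient_smult)

lemma coset_linear: "(+>) I \<in> linear_maps R (quotient_algebra R I)"
  by (rule linear_mapsI) (simp_all add: quotient_carrier quotient_ops quotient_smult)

lemma coset_zero: "i \<in> I \<Longrightarrow> I +> i = \<zero>\<^bsub>quotient_algebra R I\<^esub>"
  unfolding quotient_ops by (rule coset_eqI[of i]) (auto simp: a_Hcarr)

text \<open>A map that vanishes on the ideal is constant on cosets. The image is therefore a
  singleton, from which \<open>the_elem\<close> reads off the induced map.\<close>

lemma linear_image_coset:
  assumes "kvec M" "f \<in> linear_maps R M" "\<And>i. i \<in> I \<Longrightarrow> f i = \<zero>\<^bsub>M\<^esub>" "x \<in> carrier R"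
  shows "f ` (I +> x) = {f x}"
proof -
  interpret M: kvec M by fact
  have "f y = f x" if "y \<in> I +> x" for y
  proof -
    obtain i where i: "i \<in> I" "y = i \<oplus> x" using \<open>y \<in> I +> x\<close> by (rule rcosE)
    then show ?thesis
      using assms(3,4) linear_mapsD[OF assms(2)] by (simp add: a_Hcarr)
  qed
  then show ?thesis using a_rcos_self[OF assms(4)] by blast
qed

lemma linear_factor:
  assumes "kvec M" "f \<in> linear_maps R M" "\<And>i. i \<in> I \<Longrightarrow> f i = \<zero>\<^bsub>M\<^esub>"
  shows "(\<lambda>t. the_elem (f ` t)) \<in> linear_maps (quotient_algebra R I) M"
proof -
  have eq: "the_elem (f ` (I +> x)) = f x" if "x \<in> carrier R" for x
    using linear_image_coset[OF assms that] by simp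
  show ?thesis
    by (rule linear_mapsI)
      (auto simp: quotient_carrier quotient_ops quotient_smult eq linear_mapsD[OF assms(2)])
qed

end

text \<open>The elements p with f (q p r) = 0 for all q and r form the largest two-sided ideal
  inside the kernel of \<open>f\<close>. It contains \<open>S\<close>, hence the ideal generated by
  \<open>S\<close>, whose elements need no explicit description. Only linearity of \<open>f\<close>
  enters, so the target may lack a product.\<close>

lemma (in kalg) linear_vanishes_Idl:
  assumes "kvec M" and f: "f \<in> linear_maps A M" and "S \<subseteq> carrier A"
    and van: "\<And>s q r. s \<in> S \<Longrightarrow> q \<in> carrier A \<Longrightarrow> r \<in> carrier A \<Longrightarrow> f (q \<otimes> s \<otimes> r) = \<zero>\<^bsub>M\<^esub>"
    and x: "x \<in> Idl S"
  shows "f x = \<zero>\<^bsub>M\<^esub>"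
proof -
  interpret M: kvec M by fact
  define J where
    "J = {p \<in> carrier A. \<forall>q\<in>carrier A. \<forall>r\<in>carrier A. f (q \<otimes> p \<otimes> r) = \<zero>\<^bsub>M\<^esub>}"
  have JD: "f (q \<otimes> p \<otimes> r) = \<zero>\<^bsub>M\<^esub>" if "p \<in> J" "q \<in> carrier A" "r \<in> carrier A" for p q r
    using that by (auto simp: J_def)
  have JC: "p \<in> carrier A" if "p \<in> J" for p
    using that by (auto simp: J_def)
  have f_zero: "f \<zero> = \<zero>\<^bsub>M\<^esub>"
    by (rule linear_maps_zero[OF kvec_axioms assms(1) f])
  have "ideal J A"
  proof (rule idealI)
    show "ring A" by (rule ring_axioms)
    show "subgroup J (add_monoid A)"
    proof (rule add.subgroupI)
      show "J \<subseteq> carrier A" by (auto simp: J_def)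
      have "\<zero> \<in> J" by (auto simp: J_def f_zero)
      then show "J \<noteq> {}" by auto
    next
      fix p assume p: "p \<in> J"
      then have "f (q \<otimes> ((-1) \<odot> p) \<otimes> r) = (-1) \<odot>\<^bsub>M\<^esub> f (q \<otimes> p \<otimes> r)"
        if "q \<in> carrier A" "r \<in> carrier A" for q r
        using that JC[OF p]
        by (simp add: linear_mapsD(3)[OF f, symmetric] smult_mult_left smult_mult_right
          del: linear_mapsD(3))
      then show "\<ominus> p \<in> J"
        using p JC[OF p] by (auto simp: J_def smult_minus_one[symmetric])
    next
      fix p p' assume p: "p \<in> J" "p' \<in> J"
      have "f (q \<otimes> (p \<oplus> p') \<otimes> r) = \<zero>\<^bsub>M\<^esub>" if q: "q \<in> carrier A" and r: "r \<in> carrier A" for q r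
      proof -
        have "f (q \<otimes> (p \<oplus> p') \<otimes> r) = f (q \<otimes> p \<otimes> r \<oplus> q \<otimes> p' \<otimes> r)"
          using q r JC[OF p(1)] JC[OF p(2)] by (simp add: r_distr l_distr)
        also have "\<dots> = f (q \<otimes> p \<otimes> r) \<oplus>\<^bsub>M\<^esub> f (q \<otimes> p' \<otimes> r)"
          using q r JC[OF p(1)] JC[OF p(2)] by (intro linear_mapsD[OF f]) auto
        finally show ?thesis using JD[OF p(1) q r] JD[OF p(2) q r] by simp
      qed
      then show "p \<oplus> p' \<in> J" using JC[OF p(1)] JC[OF p(2)] by (simp add: J_def)
    qed
  next
    fix p a assume p: "p \<in> J" "a \<in> carrier A"
    note pC = JC[OF p(1)]
    have "f (q \<otimes> (a \<otimes> p) \<otimes> r) = \<zero>\<^bsub>M\<^esub>" if "q \<in> carrier A" "r \<in> carrier A" for q r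
      using that p(2) pC JD[OF p(1), of "q \<otimes> a" r] by (simp add: m_assoc)
    then show "a \<otimes> p \<in> J" using p(2) pC by (simp add: J_def)
    have "f (q \<otimes> (p \<otimes> a) \<otimes> r) = \<zero>\<^bsub>M\<^esub>" if "q \<in> carrier A" "r \<in> carrier A" for q r
      using that p(2) pC JD[OF p(1), of q "a \<otimes> r"] by (simp add: m_assoc)
    then show "p \<otimes> a \<in> J" using p(2) pC by (simp add: J_def)
  qed
  moreover have "S \<subseteq> J" using van assms(3) by (auto simp: J_def)
  ultimately have "x \<in> J" using x genideal_minimal by blast
  then show ?thesis using JD[of x \<one> \<one>] JC by simp
qed

text \<open>In a monoid algebra the two-sided test against q and r reduces to monomials by
  additivity. This form is meant for maps out of a tensor product into a mere vector space, where f
  (q s r) cannot be split into a product of values.\<close>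

lemma lin_ext_vanishes_Idl:
  fixes G :: "('g, 'm) monoid_scheme" and M :: "('k::field, 'c, 'l) module_scheme"
  assumes "monoid G" "kvec M" and f: "f \<in> carrier G \<rightarrow> carrier M"
    and "S \<subseteq> carrier (monoid_algebra G)"
    and van: "\<And>s a b. s \<in> S \<Longrightarrow> a \<in> carrier G \<Longrightarrow> b \<in> carrier G \<Longrightarrow>
      lin_ext M f (Poly_Mapping.single a 1 \<otimes>\<^bsub>monoid_algebra G\<^esub> s
        \<otimes>\<^bsub>monoid_algebra G\<^esub> Poly_Mapping.single b 1) = \<zero>\<^bsub>M\<^esub>"
    and "x \<in> Idl\<^bsub>monoid_algebra G\<^esub> S"
  shows "lin_ext M f x = \<zero>\<^bsub>M\<^esub>"
proof -
  let ?KG = "monoid_algebra G :: ('k, 'g \<Rightarrow>\<^sub>0 'k) module"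
  interpret M: kvec M by fact
  interpret KG: kalg ?KG by (rule monoid_algebra_kalg) fact
  note lin = M.lin_ext_linear[OF f]
  have ext_zero: "lin_ext M f 0 = \<zero>\<^bsub>M\<^esub>" by (simp add: lin_ext_def)
  have sc: "Poly_Mapping.single a c \<in> carrier ?KG" if "a \<in> carrier G" for a c
    using that by (auto simp: monoid_algebra_simps)
  have s1: "Poly_Mapping.single a c = c \<odot>\<^bsub>?KG\<^esub> Poly_Mapping.single a 1" for a c
    by (simp add: monoid_algebra_simps map_times_single)
  have ext_add: "lin_ext M f (p + q) = lin_ext M f p \<oplus>\<^bsub>M\<^esub> lin_ext M f q"
    if "p \<in> carrier ?KG" "q \<in> carrier ?KG" for p q
    using linear_mapsD(2)[OF lin that] by (simp add: monoid_algebra_simps)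
  show ?thesis
  proof (rule KG.linear_vanishes_Idl[OF assms(2) lin assms(4) _ assms(6)])
    fix s q r assume s: "s \<in> S" and q: "q \<in> carrier ?KG" and r: "r \<in> carrier ?KG"
    then have sC: "s \<in> carrier ?KG" using assms(4) by blast
    from q show "lin_ext M f (q \<otimes>\<^bsub>?KG\<^esub> s \<otimes>\<^bsub>?KG\<^esub> r) = \<zero>\<^bsub>M\<^esub>"
    proof (induction rule: monoid_algebra_induct)
      case zero
      show ?case by (simp add: monoid_algebra_mult_zero ext_zero)
    next
      case (add p p')
      then show ?case
        using sC r ext_add 
        by (simp add: monoid_algebra_mult_add_left)
    next
      case (single a c)
      note a = single
      from r show ?case
      proof (induction rule: monoid_algebra_induct)
        case zero
        show ?case by (simp add: monoid_algebra_mult_zero ext_zero)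
      next
        case (add p p')
        then show ?case
          using sC sc[OF a] ext_add
          by (simp add: monoid_algebra_mult_add_right)
      next
        case (single b d)
        \<comment> \<open>The coefficients \<open>c\<close> and \<open>d\<close> are pulled out as
          scalars, which leaves the monomials with coefficient 1 that \<open>van\<close>
          covers.\<close>
        show ?case
          using sC sc[OF a] sc[OF single] van[OF s a single]
          by (subst s1, subst (2) s1)
            (simp add: KG.smult_mult_left KG.smult_mult_right linear_mapsD(3)[OF lin])
      qed
    qed
  qed
qed


section \<open>Tensor products\<close>

definition bilinear_map ::
  "('k::field, 'a, 'm) module_scheme \<Rightarrow> ('k, 'b, 'n) module_scheme \<Rightarrow> ('k, 'c, 'l) module_scheme
    \<Rightarrow> ('a \<Rightarrow> 'b \<Rightarrow> 'c) \<Rightarrow> bool" where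
  "bilinear_map A B M \<phi> \<longleftrightarrow>
     (\<forall>b\<in>carrier B. (\<lambda>a. \<phi> a b) \<in> linear_maps A M) \<and> (\<forall>a\<in>carrier A. \<phi> a \<in> linear_maps B M)"

lemma bilinear_mapD:
  assumes "bilinear_map A B M \<phi>"
  shows "b \<in> carrier B \<Longrightarrow> (\<lambda>a. \<phi> a b) \<in> linear_maps A M"
    and "a \<in> carrier A \<Longrightarrow> \<phi> a \<in> linear_maps B M"
    and "a \<in> carrier A \<Longrightarrow> b \<in> carrier B \<Longrightarrow> \<phi> a b \<in> carrier M"
  using assms by (auto simp: bilinear_map_def dest: linear_mapsD)

lemma bilinear_map_comp:
  assumes "bilinear_map A B M \<phi>" "f \<in> linear_maps A' A" "g \<in> linear_maps B' B"
  shows "bilinear_map A' B' M (\<lambda>a b. \<phi> (f a) (g b))"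
  unfolding bilinear_map_def
proof (intro conjI ballI)
  show "(\<lambda>a. \<phi> (f a) (g b)) \<in> linear_maps A' M" if "b \<in> carrier B'" for b
    using linear_maps_comp[OF bilinear_mapD(1)[OF assms(1) linear_mapsD(1)[OF assms(3) that]] assms(2)] .
  show "(\<lambda>b. \<phi> (f a) (g b)) \<in> linear_maps B' M" if "a \<in> carrier A'" for a
    using linear_maps_comp[OF bilinear_mapD(2)[OF assms(1) linear_mapsD(1)[OF assms(2) that]] assms(3)] .
qed

text \<open>The additive relations are regrouped as p - (q + r), so that all four kinds have the
  shape p - q and state an equality of two classes.\<close>

lemma bilinearity_relationsI:
  "a \<in> carrier A \<Longrightarrow> a' \<in> carrier A \<Longrightarrow> b \<in> carrier B \<Longrightarrow>
    Poly_Mapping.single (a \<oplus>\<^bsub>A\<^esub> a', b) 1 - (Poly_Mapping.single (a, b) 1 + Poly_Mapping.single (a', b) 1)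
      \<in> bilinearity_relations A B"
  "a \<in> carrier A \<Longrightarrow> b \<in> carrier B \<Longrightarrow> b' \<in> carrier B \<Longrightarrow>
    Poly_Mapping.single (a, b \<oplus>\<^bsub>B\<^esub> b') 1 - (Poly_Mapping.single (a, b) 1 + Poly_Mapping.single (a, b') 1)
      \<in> bilinearity_relations A B"
  "a \<in> carrier A \<Longrightarrow> b \<in> carrier B \<Longrightarrow>
    Poly_Mapping.single (c \<odot>\<^bsub>A\<^esub> a, b) 1 - Poly_Mapping.single (a, b) c \<in> bilinearity_relations A B"
  "a \<in> carrier A \<Longrightarrow> b \<in> carrier B \<Longrightarrow>
    Poly_Mapping.single (a, c \<odot>\<^bsub>B\<^esub> b) 1 - Poly_Mapping.single (a, b) c \<in> bilinearity_relations A B"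
  unfolding bilinearity_relations_def diff_diff_eq[symmetric] Un_iff mem_Collect_eq by blast+

lemma bilinearity_relationsE:
  assumes "s \<in> bilinearity_relations A B"
  obtains
    (add_left) a a' b where "a \<in> carrier A" "a' \<in> carrier A" "b \<in> carrier B"
      "s = Poly_Mapping.single (a \<oplus>\<^bsub>A\<^esub> a', b) 1
        - (Poly_Mapping.single (a, b) 1 + Poly_Mapping.single (a', b) 1)"
  | (add_right) a b b' where "a \<in> carrier A" "b \<in> carrier B" "b' \<in> carrier B"
      "s = Poly_Mapping.single (a, b \<oplus>\<^bsub>B\<^esub> b') 1
        - (Poly_Mapping.single (a, b) 1 + Poly_Mapping.single (a, b') 1)"
  | (smult_left) c a b where "a \<in> carrier A" "b \<in> carrier B"
      "s = Poly_Mapping.single (c \<odot>\<^bsub>A\<^esub> a, b) 1 - Poly_Mapping.single (a, b) c"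
  | (smult_right) c a b where "a \<in> carrier A" "b \<in> carrier B"
      "s = Poly_Mapping.single (a, c \<odot>\<^bsub>B\<^esub> b) 1 - Poly_Mapping.single (a, b) c"
  using assms unfolding bilinearity_relations_def diff_diff_eq
  by (elim UnE CollectE exE conjE) (rule that; assumption)+

lemma monoid_algebra_mult_diff:
  fixes p q r :: "'g \<Rightarrow>\<^sub>0 'k::field"
  shows "(p - q) \<otimes>\<^bsub>monoid_algebra G\<^esub> r = p \<otimes>\<^bsub>monoid_algebra G\<^esub> r - q \<otimes>\<^bsub>monoid_algebra G\<^esub> r"
    and "r \<otimes>\<^bsub>monoid_algebra G\<^esub> (p - q) = r \<otimes>\<^bsub>monoid_algebra G\<^esub> p - r \<otimes>\<^bsub>monoid_algebra G\<^esub> q"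
  using monoid_algebra_mult_add_left[of G "p - q" q r] monoid_algebra_mult_add_right[of G r "p - q" q]
  by simp_all

locale kalg_pair = A: kalg A + B: kalg B
  for A :: "('k::field, 'a, 'm) module_scheme" and B :: "('k, 'b, 'n) module_scheme"
begin

abbreviation "KAB \<equiv> (monoid_algebra (A \<times>\<times> B) :: ('k, 'a \<times> 'b \<Rightarrow>\<^sub>0 'k) module)"

lemma monoid_AB: "monoid (A \<times>\<times> B)"
  by (rule DirProd_monoid) (rule A.is_monoid B.is_monoid)+

lemma relations_carrier: "bilinearity_relations A B \<subseteq> carrier KAB"
proof -
  have diff: "p - q \<in> carrier KAB" if "p \<in> carrier KAB" "q \<in> carrier KAB" for p q
    using that keys_diff[of p q] by (auto simp: monoid_algebra_simps)
  have single: "Poly_Mapping.single (a, b) c \<in> carrier KAB"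
    if "a \<in> carrier A" "b \<in> carrier B" for a b c
    using that by (auto simp: monoid_algebra_simps)
  show ?thesis
    unfolding bilinearity_relations_def by (auto intro!: diff single)
qed

sublocale KAB: kalg KAB
  by (rule monoid_algebra_kalg[OF monoid_AB])

sublocale tensor: kalg_ideal "Idl\<^bsub>KAB\<^esub> (bilinearity_relations A B)" KAB
  by (intro kalg_ideal.intro KAB.kalg_axioms KAB.genideal_ideal relations_carrier)

lemma tensor_kalg: "kalg (tensor_algebra A B)"
  unfolding tensor_algebra_def by (rule tensor.quotient_kalg)

sublocale T: kalg "tensor_algebra A B"
  by (rule tensor_kalg)

lemma single_closed: "a \<in> carrier A \<Longrightarrow> b \<in> carrier B \<Longrightarrow> Poly_Mapping.single (a, b) c \<in> carrier KAB"
  by (auto simp: monoid_algebra_simps)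

lemma pure_closed [simp, intro]:
  "a \<in> carrier A \<Longrightarrow> b \<in> carrier B \<Longrightarrow> pure_tensor A B a b \<in> carrier (tensor_algebra A B)"
  by (simp add: pure_tensor_def tensor_algebra_def tensor.quotient_carrier single_closed)

lemma pure_mult:
  assumes "a \<in> carrier A" "b \<in> carrier B" "a' \<in> carrier A" "b' \<in> carrier B"
  shows "pure_tensor A B a b \<otimes>\<^bsub>tensor_algebra A B\<^esub> pure_tensor A B a' b'
    = pure_tensor A B (a \<otimes>\<^bsub>A\<^esub> a') (b \<otimes>\<^bsub>B\<^esub> b')"
  using assms
  by (simp add: pure_tensor_def tensor_algebra_def tensor.quotient_ops single_closed
    monoid_algebra_mult_single)

lemma pure_one: "\<one>\<^bsub>tensor_algebra A B\<^esub> = pure_tensor A B \<one>\<^bsub>A\<^esub> \<one>\<^bsub>B\<^esub>"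
  by (simp add: pure_tensor_def tensor_algebra_def tensor.quotient_ops monoid_algebra_simps)

lemma coset_eq_of_relation:
  assumes "p - q \<in> bilinearity_relations A B" "q \<in> carrier KAB"
  shows "Idl\<^bsub>KAB\<^esub> (bilinearity_relations A B) +>\<^bsub>KAB\<^esub> p
    = Idl\<^bsub>KAB\<^esub> (bilinearity_relations A B) +>\<^bsub>KAB\<^esub> q"
  by (rule tensor.coset_eqI[of "p - q"])
    (use assms KAB.genideal_self[OF relations_carrier] in \<open>auto simp: monoid_algebra_simps(4)\<close>)

lemma pure_bilinear: "bilinear_map A B (tensor_algebra A B) (pure_tensor A B)"
  unfolding bilinear_map_def
proof (intro conjI ballI; rule linear_mapsI)
  let ?I = "Idl\<^bsub>KAB\<^esub> (bilinearity_relations A B)"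
  fix b a a' assume b: "b \<in> carrier B" and a: "a \<in> carrier A"
  show "pure_tensor A B (c \<odot>\<^bsub>A\<^esub> a) b = c \<odot>\<^bsub>tensor_algebra A B\<^esub> pure_tensor A B a b" for c
  proof -
    have "?I +>\<^bsub>KAB\<^esub> Poly_Mapping.single (c \<odot>\<^bsub>A\<^esub> a, b) 1
        = ?I +>\<^bsub>KAB\<^esub> (c \<odot>\<^bsub>KAB\<^esub> Poly_Mapping.single (a, b) 1)"
      unfolding monoid_algebra_simps map_times_single mult_1_right
      using a b by (intro coset_eq_of_relation bilinearity_relationsI single_closed)
    then show ?thesis
      using a b by (simp add: pure_tensor_def tensor_algebra_def tensor.quotient_smult single_closed)
  qed
  assume a': "a' \<in> carrier A"
  show "pure_tensor A B (a \<oplus>\<^bsub>A\<^esub> a') b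
      = pure_tensor A B a b \<oplus>\<^bsub>tensor_algebra A B\<^esub> pure_tensor A B a' b"
  proof -
    have "?I +>\<^bsub>KAB\<^esub> Poly_Mapping.single (a \<oplus>\<^bsub>A\<^esub> a', b) 1
        = ?I +>\<^bsub>KAB\<^esub> (Poly_Mapping.single (a, b) 1 \<oplus>\<^bsub>KAB\<^esub> Poly_Mapping.single (a', b) 1)"
      unfolding monoid_algebra_simps(4)
      using a b a' by (intro coset_eq_of_relation bilinearity_relationsI single_closed
        monoid_algebra_add_closed)
    then show ?thesis
      using a b a' by (simp add: pure_tensor_def tensor_algebra_def tensor.quotient_ops single_closed)
  qed
next
  let ?I = "Idl\<^bsub>KAB\<^esub> (bilinearity_relations A B)"
  fix a b b' assume a: "a \<in> carrier A" and b: "b \<in> carrier B"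
  show "pure_tensor A B a (c \<odot>\<^bsub>B\<^esub> b) = c \<odot>\<^bsub>tensor_algebra A B\<^esub> pure_tensor A B a b" for c
  proof -
    have "?I +>\<^bsub>KAB\<^esub> Poly_Mapping.single (a, c \<odot>\<^bsub>B\<^esub> b) 1
        = ?I +>\<^bsub>KAB\<^esub> (c \<odot>\<^bsub>KAB\<^esub> Poly_Mapping.single (a, b) 1)"
      unfolding monoid_algebra_simps map_times_single mult_1_right
      using a b by (intro coset_eq_of_relation bilinearity_relationsI single_closed)
    then show ?thesis
      using a b by (simp add: pure_tensor_def tensor_algebra_def tensor.quotient_smult single_closed)
  qed
  assume b': "b' \<in> carrier B"
  show "pure_tensor A B a (b \<oplus>\<^bsub>B\<^esub> b')
      = pure_tensor A B a b \<oplus>\<^bsub>tensor_algebra A B\<^esub> pure_tensor A B a b'"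
  proof -
    have "?I +>\<^bsub>KAB\<^esub> Poly_Mapping.single (a, b \<oplus>\<^bsub>B\<^esub> b') 1
        = ?I +>\<^bsub>KAB\<^esub> (Poly_Mapping.single (a, b) 1 \<oplus>\<^bsub>KAB\<^esub> Poly_Mapping.single (a, b') 1)"
      unfolding monoid_algebra_simps(4)
      using a b b' by (intro coset_eq_of_relation bilinearity_relationsI single_closed
        monoid_algebra_add_closed)
    then show ?thesis
      using a b b' by (simp add: pure_tensor_def tensor_algebra_def tensor.quotient_ops single_closed)
  qed
qed auto

text \<open>No cases for scalar multiples or zero are needed: a scalar is absorbed into the left
  factor of a pure tensor, and the zero class is a pure tensor with coefficient 0.\<close>

lemma tensor_induct [consumes 1, case_names pure add]:
  assumes "t \<in> carrier (tensor_algebra A B)"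
    and pure: "\<And>a b. a \<in> carrier A \<Longrightarrow> b \<in> carrier B \<Longrightarrow> P (pure_tensor A B a b)"
    and add: "\<And>t t'. t \<in> carrier (tensor_algebra A B) \<Longrightarrow> t' \<in> carrier (tensor_algebra A B) \<Longrightarrow>
      P t \<Longrightarrow> P t' \<Longrightarrow> P (t \<oplus>\<^bsub>tensor_algebra A B\<^esub> t')"
  shows "P t"
proof -
  let ?I = "Idl\<^bsub>KAB\<^esub> (bilinearity_relations A B)"
  obtain p where p: "p \<in> carrier KAB" "t = ?I +>\<^bsub>KAB\<^esub> p"
    using assms(1) by (auto simp: tensor_algebra_def tensor.quotient_carrier)
  have P_single: "P (?I +>\<^bsub>KAB\<^esub> Poly_Mapping.single (a, b) c)" if "a \<in> carrier A" "b \<in> carrier B" for a b c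
  proof -
    have "?I +>\<^bsub>KAB\<^esub> Poly_Mapping.single (a, b) c
        = c \<odot>\<^bsub>quotient_algebra KAB ?I\<^esub> (?I +>\<^bsub>KAB\<^esub> Poly_Mapping.single (a, b) 1)"
      by (simp add: tensor.quotient_smult single_closed that)
        (simp add: monoid_algebra_simps map_times_single)
    also have "\<dots> = c \<odot>\<^bsub>tensor_algebra A B\<^esub> pure_tensor A B a b"
      by (simp add: tensor_algebra_def pure_tensor_def)
    also have "\<dots> = pure_tensor A B (c \<odot>\<^bsub>A\<^esub> a) b"
      using linear_mapsD(3)[OF bilinear_mapD(1)[OF pure_bilinear that(2)] that(1)] by simp
    finally show ?thesis using pure that by simp
  qed
  from p(1) have "P (?I +>\<^bsub>KAB\<^esub> p)"
  proof (induction rule: monoid_algebra_induct)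
    case zero
    show ?case using P_single[of "\<zero>\<^bsub>A\<^esub>" "\<zero>\<^bsub>B\<^esub>" 0] by simp
  next
    case (single z c)
    then show ?case using P_single by (cases z) auto
  next
    case (add p q)
    then have "P ((?I +>\<^bsub>KAB\<^esub> p) \<oplus>\<^bsub>tensor_algebra A B\<^esub> (?I +>\<^bsub>KAB\<^esub> q))"
      by (intro assms(3)) (auto simp: tensor_algebra_def tensor.quotient_carrier)
    then show ?case
      using add by (simp add: tensor_algebra_def tensor.quotient_ops)
        (simp add: monoid_algebra_simps)
  qed
  then show ?thesis using p by simp
qed

text \<open>By distributivity in both factors, the linear span of the relations is already an ideal.
  Hence the quotient by the generated ideal has the universal property of the tensor product of
  vector spaces, for bilinear maps that know nothing of products.\<close>

lemma relation_mult_single: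
  assumes s: "s \<in> bilinearity_relations A B" and "u \<in> carrier (A \<times>\<times> B)" "v \<in> carrier (A \<times>\<times> B)"
  shows "Poly_Mapping.single u 1 \<otimes>\<^bsub>KAB\<^esub> s \<otimes>\<^bsub>KAB\<^esub> Poly_Mapping.single v 1
    \<in> bilinearity_relations A B"
proof -
  obtain a b a' b' where uv: "u = (a, b)" "v = (a', b')"
    and C: "a \<in> carrier A" "b \<in> carrier B" "a' \<in> carrier A" "b' \<in> carrier B"
    using assms(2,3) by (cases u; cases v) auto
  note simps = uv C monoid_algebra_mult_diff monoid_algebra_mult_single
    monoid_algebra_mult_add_left monoid_algebra_mult_add_right
    A.l_distr A.r_distr B.l_distr B.r_distr
    A.smult_mult_left A.smult_mult_right B.smult_mult_left B.smult_mult_right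
  from s show ?thesis
    by (cases rule: bilinearity_relationsE) (simp_all add: simps bilinearity_relationsI)
qed

lemma lin_ext_relation:
  assumes "kvec M" and bil: "bilinear_map A B M \<phi>" and s: "s \<in> bilinearity_relations A B"
  shows "lin_ext M (\<lambda>z. \<phi> (fst z) (snd z)) s = \<zero>\<^bsub>M\<^esub>"
proof -
  interpret M: kvec M by fact
  let ?L = "lin_ext M (\<lambda>z. \<phi> (fst z) (snd z))"
  have lin: "?L \<in> linear_maps KAB M"
    by (rule M.lin_ext_linear) (use bilinear_mapD(3)[OF bil] in auto)
  have single: "?L (Poly_Mapping.single (a, b) c) = c \<odot>\<^bsub>M\<^esub> \<phi> a b"
    if "a \<in> carrier A" "b \<in> carrier B" for a b c
    using that bilinear_mapD(3)[OF bil] by (simp add: M.lin_ext_single)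
  \<comment> \<open>Linearity is stated for sums only, so the value at p - q is found by adding q
    back and cancelling.\<close>
  have eq: "?L (p - q) = \<zero>\<^bsub>M\<^esub>" if "p - q \<in> carrier KAB" "q \<in> carrier KAB" "?L p = ?L q" for p q
  proof -
    have "?L ((p - q) \<oplus>\<^bsub>KAB\<^esub> q) = ?L (p - q) \<oplus>\<^bsub>M\<^esub> ?L q"
      using that(1,2) by (rule linear_mapsD[OF lin])
    then have "?L (p - q) \<oplus>\<^bsub>M\<^esub> ?L q = ?L q"
      using that(3) by (simp add: monoid_algebra_simps(4))
    then show ?thesis
      using M.add.l_cancel_one'[of "?L q" "?L (p - q)"] that(1,2) linear_mapsD(1)[OF lin]
      by (simp add: M.a_comm)
  qed
  have ext_add: "?L (p + q) = ?L p \<oplus>\<^bsub>M\<^esub> ?L q" if "p \<in> carrier KAB" "q \<in> carrier KAB" for p q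
    using linear_mapsD(2)[OF lin that] by (simp add: monoid_algebra_simps(4))
  have sC: "s \<in> carrier KAB" using s relations_carrier by blast
  show ?thesis
    using s
  proof (cases rule: bilinearity_relationsE)
    case (add_left a a' b)
    show ?thesis
      unfolding add_left using add_left(1-3) sC[unfolded add_left]
      by (intro eq) (simp_all add: ext_add single single_closed monoid_algebra_add_closed
        linear_mapsD[OF bilinear_mapD(1)[OF bil]] bilinear_mapD(3)[OF bil])
  next
    case (add_right a b b')
    show ?thesis
      unfolding add_right using add_right(1-3) sC[unfolded add_right]
      by (intro eq) (simp_all add: ext_add single single_closed monoid_algebra_add_closed
        linear_mapsD[OF bilinear_mapD(2)[OF bil]] bilinear_mapD(3)[OF bil])
  next
    case (smult_left c a b)
    show ?thesis
      unfolding smult_left using smult_left(1-2) sC[unfolded smult_left]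
      by (intro eq) (simp_all add: single single_closed
        linear_mapsD[OF bilinear_mapD(1)[OF bil]] bilinear_mapD(3)[OF bil])
  next
    case (smult_right c a b)
    show ?thesis
      unfolding smult_right using smult_right(1-2) sC[unfolded smult_right]
      by (intro eq) (simp_all add: single single_closed
        linear_mapsD[OF bilinear_mapD(2)[OF bil]] bilinear_mapD(3)[OF bil])
  qed
qed

text \<open>A bilinear map kills the relations and, by \<open>relation_mult_single\<close>, the
  ideal they generate; so the image taken in \<open>tensor_lift\<close> is a singleton. This is the
  universal property, and later uses of \<open>tensor_lift\<close> go through linearity and the
  value on pure tensors.\<close>

lemma
  assumes "kvec M" and bil: "bilinear_map A B M \<phi>"
  shows tensor_lift_linear: "tensor_lift M \<phi> \<in> linear_maps (tensor_algebra A B) M"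
    and tensor_lift_pure: "a \<in> carrier A \<Longrightarrow> b \<in> carrier B \<Longrightarrow>
      tensor_lift M \<phi> (pure_tensor A B a b) = \<phi> a b"
proof -
  interpret M: kvec M by fact
  let ?L = "lin_ext M (\<lambda>z. \<phi> (fst z) (snd z))"
  have Pi: "(\<lambda>z. \<phi> (fst z) (snd z)) \<in> carrier (A \<times>\<times> B) \<rightarrow> carrier M"
    using bilinear_mapD(3)[OF bil] by auto
  have lin: "?L \<in> linear_maps KAB M"
    by (rule M.lin_ext_linear[OF Pi])
  have van: "?L x = \<zero>\<^bsub>M\<^esub>" if "x \<in> Idl\<^bsub>KAB\<^esub> (bilinearity_relations A B)" for x
    by (rule lin_ext_vanishes_Idl[OF monoid_AB assms(1) Pi relations_carrier _ that])
      (rule lin_ext_relation[OF assms relation_mult_single])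
  have lift: "tensor_lift M \<phi> = (\<lambda>t. the_elem (?L ` t))"
    by (simp add: fun_eq_iff tensor_lift_def lin_ext_def[abs_def])
  show "tensor_lift M \<phi> \<in> linear_maps (tensor_algebra A B) M"
    unfolding lift tensor_algebra_def by (rule tensor.linear_factor[OF assms(1) lin van])
  show "tensor_lift M \<phi> (pure_tensor A B a b) = \<phi> a b" if "a \<in> carrier A" "b \<in> carrier B"
  proof -
    have "?L ` pure_tensor A B a b = {?L (Poly_Mapping.single (a, b) 1)}"
      unfolding pure_tensor_def
      by (rule tensor.linear_image_coset[OF assms(1) lin van]) (use that single_closed in auto)
    then show ?thesis
      using that bilinear_mapD(3)[OF bil] by (simp add: lift M.lin_ext_single)
  qed
qed

end

section \<open>Sums of pure tensors\<close>

context kalg_pair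
begin

lemma pure_finsum_left:
  assumes "b \<in> carrier B" "\<And>i. i \<in> S \<Longrightarrow> f i \<in> carrier A"
  shows "pure_tensor A B (\<Oplus>\<^bsub>A\<^esub>i\<in>S. c i \<odot>\<^bsub>A\<^esub> f i) b
    = (\<Oplus>\<^bsub>tensor_algebra A B\<^esub>i\<in>S. c i \<odot>\<^bsub>tensor_algebra A B\<^esub> pure_tensor A B (f i) b)"
proof -
  note lin = bilinear_mapD(1)[OF pure_bilinear assms(1)]
  have "pure_tensor A B (\<Oplus>\<^bsub>A\<^esub>i\<in>S. c i \<odot>\<^bsub>A\<^esub> f i) b
      = (\<Oplus>\<^bsub>tensor_algebra A B\<^esub>i\<in>S. pure_tensor A B (c i \<odot>\<^bsub>A\<^esub> f i) b)"
    by (rule linear_maps_finsum[OF A.kvec_axioms T.kvec_axioms lin]) (use assms in auto)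
  also have "\<dots> = (\<Oplus>\<^bsub>tensor_algebra A B\<^esub>i\<in>S. c i \<odot>\<^bsub>tensor_algebra A B\<^esub> pure_tensor A B (f i) b)"
    by (rule T.finsum_cong_simple) (use assms linear_mapsD(3)[OF lin] in auto)
  finally show ?thesis .
qed

lemma pure_finsum_right:
  assumes "a \<in> carrier A" "\<And>i. i \<in> S \<Longrightarrow> f i \<in> carrier B"
  shows "pure_tensor A B a (\<Oplus>\<^bsub>B\<^esub>i\<in>S. c i \<odot>\<^bsub>B\<^esub> f i)
    = (\<Oplus>\<^bsub>tensor_algebra A B\<^esub>i\<in>S. c i \<odot>\<^bsub>tensor_algebra A B\<^esub> pure_tensor A B a (f i))"
proof -
  note lin = bilinear_mapD(2)[OF pure_bilinear assms(1)]
  have "pure_tensor A B a (\<Oplus>\<^bsub>B\<^esub>i\<in>S. c i \<odot>\<^bsub>B\<^esub> f i)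
      = (\<Oplus>\<^bsub>tensor_algebra A B\<^esub>i\<in>S. pure_tensor A B a (c i \<odot>\<^bsub>B\<^esub> f i))"
    by (rule linear_maps_finsum[OF B.kvec_axioms T.kvec_axioms lin]) (use assms in auto)
  also have "\<dots> = (\<Oplus>\<^bsub>tensor_algebra A B\<^esub>i\<in>S. c i \<odot>\<^bsub>tensor_algebra A B\<^esub> pure_tensor A B a (f i))"
    by (rule T.finsum_cong_simple) (use assms linear_mapsD(3)[OF lin] in auto)
  finally show ?thesis .
qed

lemma pure_smult:
  assumes "a \<in> carrier A" "b \<in> carrier B"
  shows "pure_tensor A B (c \<odot>\<^bsub>A\<^esub> a) b = c \<odot>\<^bsub>tensor_algebra A B\<^esub> pure_tensor A B a b"
    and "pure_tensor A B a (c \<odot>\<^bsub>B\<^esub> b) = c \<odot>\<^bsub>tensor_algebra A B\<^esub> pure_tensor A B a b"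
  using linear_mapsD(3)[OF bilinear_mapD(1)[OF pure_bilinear assms(2)] assms(1)]
    linear_mapsD(3)[OF bilinear_mapD(2)[OF pure_bilinear assms(1)] assms(2)] by simp_all

lemma pure_zero_right: "a \<in> carrier A \<Longrightarrow> pure_tensor A B a \<zero>\<^bsub>B\<^esub> = \<zero>\<^bsub>tensor_algebra A B\<^esub>"
  by (rule linear_maps_zero[OF B.kvec_axioms T.kvec_axioms bilinear_mapD(2)[OF pure_bilinear]])

text \<open>Collects a combination of matrix coactions inside the left factor, where a relation for
  the matrix entries can be applied.\<close>

lemma finsum_smult_pure_left:
  assumes "finite S" "finite T" "\<And>i j. i \<in> S \<Longrightarrow> j \<in> T \<Longrightarrow> f i j \<in> carrier A"
    and "\<And>j. j \<in> T \<Longrightarrow> g j \<in> carrier B"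
  shows "(\<Oplus>\<^bsub>tensor_algebra A B\<^esub>i\<in>S. c i \<odot>\<^bsub>tensor_algebra A B\<^esub>
      (\<Oplus>\<^bsub>tensor_algebra A B\<^esub>j\<in>T. pure_tensor A B (f i j) (g j)))
    = (\<Oplus>\<^bsub>tensor_algebra A B\<^esub>j\<in>T. pure_tensor A B (\<Oplus>\<^bsub>A\<^esub>i\<in>S. c i \<odot>\<^bsub>A\<^esub> f i j) (g j))"
  by (subst T.finsum_smult_finsum)
    (use assms in \<open>auto intro!: T.finsum_cong_simple A.finsum_closed simp: pure_finsum_left\<close>)

lemma finsum_smult_pure_right:
  assumes "finite S" "finite T" "\<And>i j. i \<in> S \<Longrightarrow> j \<in> T \<Longrightarrow> g i j \<in> carrier B"
    and "\<And>j. j \<in> T \<Longrightarrow> f j \<in> carrier A"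
  shows "(\<Oplus>\<^bsub>tensor_algebra A B\<^esub>i\<in>S. c i \<odot>\<^bsub>tensor_algebra A B\<^esub>
      (\<Oplus>\<^bsub>tensor_algebra A B\<^esub>j\<in>T. pure_tensor A B (f j) (g i j)))
    = (\<Oplus>\<^bsub>tensor_algebra A B\<^esub>j\<in>T. pure_tensor A B (f j) (\<Oplus>\<^bsub>B\<^esub>i\<in>S. c i \<odot>\<^bsub>B\<^esub> g i j))"
  by (subst T.finsum_smult_finsum)
    (use assms in \<open>auto intro!: T.finsum_cong_simple B.finsum_closed simp: pure_finsum_right\<close>)

text \<open>Indices of length k + l are pairs of indices of lengths k and l, and the product of pure
  tensors is taken factorwise. This is the multiplicativity on words shared by the coproduct and the
  coaction.\<close>

lemma finsum_pure_append:
  fixes f f' f'' :: "'i::finite list \<Rightarrow> 'a" and g g' g'' :: "'i list \<Rightarrow> 'b"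
  assumes "\<And>\<kappa>. length \<kappa> = k \<Longrightarrow> f \<kappa> \<in> carrier A" "\<And>\<kappa>. length \<kappa> = k \<Longrightarrow> g \<kappa> \<in> carrier B"
    and "\<And>\<mu>. length \<mu> = l \<Longrightarrow> f' \<mu> \<in> carrier A" "\<And>\<mu>. length \<mu> = l \<Longrightarrow> g' \<mu> \<in> carrier B"
    and f'': "\<And>\<kappa> \<mu>. length \<kappa> = k \<Longrightarrow> length \<mu> = l \<Longrightarrow> f'' (\<kappa> @ \<mu>) = f \<kappa> \<otimes>\<^bsub>A\<^esub> f' \<mu>"
    and g'': "\<And>\<kappa> \<mu>. length \<kappa> = k \<Longrightarrow> length \<mu> = l \<Longrightarrow> g'' (\<kappa> @ \<mu>) = g \<kappa> \<otimes>\<^bsub>B\<^esub> g' \<mu>"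
  shows "(\<Oplus>\<^bsub>tensor_algebra A B\<^esub>\<nu>\<in>multi (k + l). pure_tensor A B (f'' \<nu>) (g'' \<nu>))
    = (\<Oplus>\<^bsub>tensor_algebra A B\<^esub>\<kappa>\<in>multi k. pure_tensor A B (f \<kappa>) (g \<kappa>))
      \<otimes>\<^bsub>tensor_algebra A B\<^esub> (\<Oplus>\<^bsub>tensor_algebra A B\<^esub>\<mu>\<in>multi l. pure_tensor A B (f' \<mu>) (g' \<mu>))"
    (is "?lhs = ?S \<otimes>\<^bsub>_\<^esub> ?S'")
proof -
  have closed: "pure_tensor A B (f'' \<nu>) (g'' \<nu>) \<in> carrier (tensor_algebra A B)"
    if "length \<nu> = k + l" for \<nu>
  proof -
    have "\<nu> = take k \<nu> @ drop k \<nu>" "length (take k \<nu>) = k" "length (drop k \<nu>) = l"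
      using that by auto
    then show ?thesis
      by (metis assms(1-4) f'' g'' A.m_closed B.m_closed pure_closed)
  qed
  have "?lhs = (\<Oplus>\<^bsub>tensor_algebra A B\<^esub>\<kappa>\<in>multi k. \<Oplus>\<^bsub>tensor_algebra A B\<^esub>\<mu>\<in>multi l.
      pure_tensor A B (f'' (\<kappa> @ \<mu>)) (g'' (\<kappa> @ \<mu>)))"
    by (rule T.finsum_lists_append) (rule closed)
  also have "\<dots> = (\<Oplus>\<^bsub>tensor_algebra A B\<^esub>\<kappa>\<in>multi k. \<Oplus>\<^bsub>tensor_algebra A B\<^esub>\<mu>\<in>multi l.
      pure_tensor A B (f \<kappa>) (g \<kappa>) \<otimes>\<^bsub>tensor_algebra A B\<^esub> pure_tensor A B (f' \<mu>) (g' \<mu>))"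
    by (intro T.finsum_cong_simple T.finsum_closed) (use assms in \<open>auto simp: pure_mult\<close>)
  also have "\<dots> = ?S \<otimes>\<^bsub>tensor_algebra A B\<^esub> ?S'"
    by (rule T.finsum_mult_finsum[symmetric]) (use assms in auto)
  finally show ?thesis .
qed

end

section \<open>Tensor products of linear maps and the canonical identifications\<close>

lemma tensor_map_linear:
  assumes "kalg_pair A B" "kalg_pair C D" "f \<in> linear_maps A C" "g \<in> linear_maps B D"
  shows "tensor_map C D f g \<in> linear_maps (tensor_algebra A B) (tensor_algebra C D)"
proof -
  interpret AB: kalg_pair A B by fact
  interpret CD: kalg_pair C D by fact
  show ?thesis
    unfolding tensor_map_def
    by (rule AB.tensor_lift_linear[OF CD.T.kvec_axioms bilinear_map_comp[OF CD.pure_bilinear assms(3,4)]])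
qed

lemma tensor_map_pure:
  assumes "kalg_pair A B" "kalg_pair C D" "f \<in> linear_maps A C" "g \<in> linear_maps B D"
    and "a \<in> carrier A" "b \<in> carrier B"
  shows "tensor_map C D f g (pure_tensor A B a b) = pure_tensor C D (f a) (g b)"
proof -
  interpret AB: kalg_pair A B by fact
  interpret CD: kalg_pair C D by fact
  show ?thesis
    unfolding tensor_map_def
    using AB.tensor_lift_pure[OF CD.T.kvec_axioms bilinear_map_comp[OF CD.pure_bilinear assms(3,4)]]
      assms(5,6) by simp
qed

text \<open>The map is a lift inside a lift. The inner lift is linear in t by the universal
  property. Its linearity in c is proved by induction on t: on a pure tensor it is the linearity of
  the iterated pure tensor in its last entry, and it is stable under sums.\<close>

lemma
  assumes A: "kalg A" and B: "kalg B" and C: "kalg C"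
  shows tensor_assoc_linear: "tensor_assoc A B C \<in> linear_maps
      (tensor_algebra (tensor_algebra A B) C) (tensor_algebra A (tensor_algebra B C))"
    and tensor_assoc_pure: "a \<in> carrier A \<Longrightarrow> b \<in> carrier B \<Longrightarrow> c \<in> carrier C \<Longrightarrow>
      tensor_assoc A B C (pure_tensor (tensor_algebra A B) C (pure_tensor A B a b) c)
        = pure_tensor A (tensor_algebra B C) a (pure_tensor B C b c)"
proof -
  let ?AB = "tensor_algebra A B" and ?BC = "tensor_algebra B C"
  let ?T = "tensor_algebra A ?BC"
  interpret AB: kalg_pair A B using A B by (rule kalg_pair.intro)
  interpret BC: kalg_pair B C using B C by (rule kalg_pair.intro)
  interpret AB_C: kalg_pair ?AB C using AB.tensor_kalg C by (rule kalg_pair.intro)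
  interpret A_BC: kalg_pair A ?BC using A BC.tensor_kalg by (rule kalg_pair.intro)
  define \<psi> where "\<psi> = (\<lambda>c a b. pure_tensor A ?BC a (pure_tensor B C b c))"
  have \<psi>: "bilinear_map A B ?T (\<psi> c)" if c: "c \<in> carrier C" for c
    unfolding bilinear_map_def \<psi>_def
  proof (intro conjI ballI)
    show "(\<lambda>a. pure_tensor A ?BC a (pure_tensor B C b c)) \<in> linear_maps A ?T"
      if "b \<in> carrier B" for b
      by (rule bilinear_mapD(1)[OF A_BC.pure_bilinear]) (use that c in auto)
    show "(\<lambda>b. pure_tensor A ?BC a (pure_tensor B C b c)) \<in> linear_maps B ?T"
      if "a \<in> carrier A" for a
      by (rule linear_maps_comp[OF bilinear_mapD(2)[OF A_BC.pure_bilinear that]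
            bilinear_mapD(1)[OF BC.pure_bilinear c]])
  qed
  note lift_linear = AB.tensor_lift_linear[OF A_BC.T.kvec_axioms \<psi>]
  note lift_pure = AB.tensor_lift_pure[OF A_BC.T.kvec_axioms \<psi>]
  have \<psi>C: "(\<lambda>c. \<psi> c a b) \<in> linear_maps C ?T" if "a \<in> carrier A" "b \<in> carrier B" for a b
    unfolding \<psi>_def
    by (rule linear_maps_comp[OF bilinear_mapD(2)[OF A_BC.pure_bilinear that(1)]
          bilinear_mapD(2)[OF BC.pure_bilinear that(2)]])
  have bil: "bilinear_map ?AB C ?T (\<lambda>t c. tensor_lift ?T (\<psi> c) t)"
    unfolding bilinear_map_def
  proof (intro conjI ballI)
    show "(\<lambda>t. tensor_lift ?T (\<psi> c) t) \<in> linear_maps ?AB ?T" if "c \<in> carrier C" for c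
      using lift_linear[OF that] by simp
    fix t assume "t \<in> carrier ?AB"
    then show "(\<lambda>c. tensor_lift ?T (\<psi> c) t) \<in> linear_maps C ?T"
    proof (induction rule: AB.tensor_induct)
      case (pure a b)
      show ?case
        by (rule linear_mapsI)
          (use pure linear_mapsD[OF \<psi>C] in \<open>auto simp: lift_pure\<close>)
    next
      case (add t t')
      have eq: "tensor_lift ?T (\<psi> c) (t \<oplus>\<^bsub>?AB\<^esub> t')
          = tensor_lift ?T (\<psi> c) t \<oplus>\<^bsub>?T\<^esub> tensor_lift ?T (\<psi> c) t'" if "c \<in> carrier C" for c
        using add by (intro linear_mapsD[OF lift_linear[OF that]]) auto
      show ?case
        by (rule linear_mapsI)
          (simp_all add: eq linear_mapsD[OF add.IH(1)] linear_mapsD[OF add.IH(2)]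
            A_BC.T.a_ac A_BC.T.smult_r_distr)
    qed
  qed
  have assoc: "tensor_assoc A B C = tensor_lift ?T (\<lambda>t c. tensor_lift ?T (\<psi> c) t)"
    by (simp add: tensor_assoc_def \<psi>_def Let_def)
  show "tensor_assoc A B C \<in> linear_maps (tensor_algebra ?AB C) ?T"
    unfolding assoc by (rule AB_C.tensor_lift_linear[OF A_BC.T.kvec_axioms bil])
  show "tensor_assoc A B C (pure_tensor ?AB C (pure_tensor A B a b) c)
      = pure_tensor A ?BC a (pure_tensor B C b c)"
    if "a \<in> carrier A" "b \<in> carrier B" "c \<in> carrier C"
    unfolding assoc using that
    by (simp add: AB_C.tensor_lift_pure[OF A_BC.T.kvec_axioms bil] lift_pure) (simp add: \<psi>_def)
qed

section \<open>The ground field as unit of the tensor product\<close>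

lemma scalar_algebra_simps:
  "carrier scalar_algebra = UNIV"
  "x \<oplus>\<^bsub>scalar_algebra\<^esub> y = x + y"
  "x \<otimes>\<^bsub>scalar_algebra\<^esub> y = x * y"
  "x \<odot>\<^bsub>scalar_algebra\<^esub> y = x * y"
  "\<one>\<^bsub>scalar_algebra\<^esub> = 1"
  "\<zero>\<^bsub>scalar_algebra\<^esub> = 0"
  by (simp_all add: scalar_algebra_def ring.defs module.defs ring_of_type_algebra_def)

lemma scalar_algebra_kalg: "kalg (scalar_algebra :: ('k::field, 'k) module)"
proof -
  have "abelian_group (scalar_algebra :: ('k, 'k) module)"
  proof (rule abelian_groupI)
    show "\<exists>y\<in>carrier scalar_algebra. y \<oplus>\<^bsub>scalar_algebra\<^esub> x = \<zero>\<^bsub>scalar_algebra\<^esub>" for x :: 'k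
      by (rule bexI[of _ "- x"]) (simp_all add: scalar_algebra_simps)
  qed (simp_all add: scalar_algebra_simps algebra_simps)
  then interpret abelian_group "scalar_algebra :: ('k, 'k) module" .
  show ?thesis
    by unfold_locales (simp_all add: scalar_algebra_simps algebra_simps)
qed

lemma
  assumes "kalg M"
  shows tensor_unit_left_linear:
      "tensor_unit_left M \<in> linear_maps (tensor_algebra scalar_algebra M) M"
    and tensor_unit_left_pure: "x \<in> carrier M \<Longrightarrow>
      tensor_unit_left M (pure_tensor scalar_algebra M c x) = c \<odot>\<^bsub>M\<^esub> x"
    and tensor_unit_right_linear:
      "tensor_unit_right M \<in> linear_maps (tensor_algebra M scalar_algebra) M"
    and tensor_unit_right_pure: "x \<in> carrier M \<Longrightarrow>
      tensor_unit_right M (pure_tensor M scalar_algebra x c) = c \<odot>\<^bsub>M\<^esub> x"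
proof -
  interpret M: kalg M by fact
  interpret KM: kalg_pair scalar_algebra M
    using scalar_algebra_kalg assms by (rule kalg_pair.intro)
  interpret MK: kalg_pair M scalar_algebra
    using assms scalar_algebra_kalg by (rule kalg_pair.intro)
  have l: "bilinear_map scalar_algebra M M (\<lambda>c x. c \<odot>\<^bsub>M\<^esub> x)"
    by (auto simp: bilinear_map_def scalar_algebra_simps M.smult_l_distr M.smult_r_distr
        M.smult_assoc1 M.smult_commute intro!: linear_mapsI)
  have r: "bilinear_map M scalar_algebra M (\<lambda>x c. c \<odot>\<^bsub>M\<^esub> x)"
    by (auto simp: bilinear_map_def scalar_algebra_simps M.smult_l_distr M.smult_r_distr
        M.smult_assoc1 M.smult_commute intro!: linear_mapsI)
  show "tensor_unit_left M \<in> linear_maps (tensor_algebra scalar_algebra M) M"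
    unfolding tensor_unit_left_def by (rule KM.tensor_lift_linear[OF M.kvec_axioms l])
  show "tensor_unit_left M (pure_tensor scalar_algebra M c x) = c \<odot>\<^bsub>M\<^esub> x" if "x \<in> carrier M"
    unfolding tensor_unit_left_def
    by (rule KM.tensor_lift_pure[OF M.kvec_axioms l]) (use that in \<open>auto simp: scalar_algebra_simps\<close>)
  show "tensor_unit_right M \<in> linear_maps (tensor_algebra M scalar_algebra) M"
    unfolding tensor_unit_right_def by (rule MK.tensor_lift_linear[OF M.kvec_axioms r])
  show "tensor_unit_right M (pure_tensor M scalar_algebra x c) = c \<odot>\<^bsub>M\<^esub> x" if "x \<in> carrier M"
    unfolding tensor_unit_right_def
    by (rule MK.tensor_lift_pure[OF M.kvec_axioms r]) (use that in \<open>auto simp: scalar_algebra_simps\<close>)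
qed


section \<open>Presented algebras\<close>

lemma free_monoid_simps:
  "carrier free_monoid = UNIV" "v \<otimes>\<^bsub>free_monoid\<^esub> w = v @ w" "\<one>\<^bsub>free_monoid\<^esub> = []"
  by (simp_all add: free_monoid_def)

lemma free_monoid: "monoid free_monoid"
  by (rule monoidI) (simp_all add: free_monoid_simps)

lemma free_algebra_kalg: "kalg (free_algebra :: ('k::field, 'g list \<Rightarrow>\<^sub>0 'k) module)"
  by (rule monoid_algebra_kalg[OF free_monoid])

lemma free_algebra_carrier: "carrier free_algebra = UNIV"
  by (simp add: monoid_algebra_simps free_monoid_simps)

definition word_class :: "('g list \<Rightarrow>\<^sub>0 'k::field) set \<Rightarrow> 'g list \<Rightarrow> ('g list \<Rightarrow>\<^sub>0 'k) set" where
  "word_class rels v = Idl\<^bsub>free_algebra\<^esub> rels +>\<^bsub>free_algebra\<^esub> Poly_Mapping.single v 1"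

locale presentation =
  fixes rels :: "('g list \<Rightarrow>\<^sub>0 'k::field) set"
begin

sublocale free_algebra: kalg "free_algebra :: ('k, 'g list \<Rightarrow>\<^sub>0 'k) module"
  by (rule free_algebra_kalg)

sublocale presented:
  kalg_ideal "Idl\<^bsub>free_algebra\<^esub> rels" "free_algebra :: ('k, 'g list \<Rightarrow>\<^sub>0 'k) module"
  by (intro kalg_ideal.intro free_algebra.kalg_axioms free_algebra.genideal_ideal)
    (simp add: free_algebra_carrier)

lemma presented_kalg: "kalg (presented_algebra rels)"
  unfolding presented_algebra_def by (rule presented.quotient_kalg)

sublocale presented_algebra: kalg "presented_algebra rels"
  by (rule presented_kalg)

lemma word_class_gen: "presented_gen rels g = word_class rels [g]"
  by (simp add: presented_gen_def word_class_def)

lemma word_class_closed [simp, intro]: "word_class rels v \<in> carrier (presented_algebra rels)"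
  by (simp add: word_class_def presented_algebra_def presented.quotient_carrier free_algebra_carrier)

lemma word_class_Nil: "word_class rels [] = \<one>\<^bsub>presented_algebra rels\<^esub>"
  by (simp add: word_class_def presented_algebra_def presented.quotient_ops)
    (simp add: monoid_algebra_simps free_monoid_simps)

lemma word_class_append:
  "word_class rels (v @ w) = word_class rels v \<otimes>\<^bsub>presented_algebra rels\<^esub> word_class rels w"
  by (simp add: word_class_def presented_algebra_def presented.quotient_ops free_algebra_carrier
    monoid_algebra_mult_single free_monoid_simps)

lemma word_class_sum:
  assumes "finite S"
  shows "Idl\<^bsub>free_algebra\<^esub> rels +>\<^bsub>free_algebra\<^esub> (\<Sum>i\<in>S. Poly_Mapping.single (g i) (c i))
    = (\<Oplus>\<^bsub>presented_algebra rels\<^esub>i\<in>S. c i \<odot>\<^bsub>presented_algebra rels\<^esub> word_class rels (g i))"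
proof -
  let ?I = "Idl\<^bsub>free_algebra\<^esub> rels"
  have single: "?I +>\<^bsub>free_algebra\<^esub> Poly_Mapping.single v b
      = b \<odot>\<^bsub>presented_algebra rels\<^esub> word_class rels v" for v b
    by (simp add: word_class_def presented_algebra_def presented.quotient_smult free_algebra_carrier)
      (simp add: monoid_algebra_simps map_times_single)
  have "?I +>\<^bsub>free_algebra\<^esub> (\<Sum>i\<in>S. Poly_Mapping.single (g i) (c i))
      = ?I +>\<^bsub>free_algebra\<^esub> (\<Oplus>\<^bsub>free_algebra\<^esub>i\<in>S. Poly_Mapping.single (g i) (c i))"
    by (simp add: monoid_algebra_finsum free_monoid free_algebra_carrier)
  also have "\<dots> = (\<Oplus>\<^bsub>presented_algebra rels\<^esub>i\<in>S. ?I +>\<^bsub>free_algebra\<^esub> Poly_Mapping.single (g i) (c i))"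
    unfolding presented_algebra_def
    by (rule linear_maps_finsum[OF free_algebra.kvec_axioms
          presented_algebra.kvec_axioms[unfolded presented_algebra_def] presented.coset_linear])
      (simp add: free_algebra_carrier)
  finally show ?thesis by (simp add: single)
qed

lemma coset_relation:
  assumes "r \<in> rels"
  shows "Idl\<^bsub>free_algebra\<^esub> rels +>\<^bsub>free_algebra\<^esub> r = \<zero>\<^bsub>presented_algebra rels\<^esub>"
proof -
  have "r \<in> Idl\<^bsub>free_algebra\<^esub> rels"
    using free_algebra.genideal_self[of rels] assms free_algebra_carrier by blast
  then show ?thesis
    unfolding presented_algebra_def by (rule presented.coset_zero)
qed

lemma presented_relation:
  assumes "finite S" "(\<Sum>i\<in>S. Poly_Mapping.single (g i) (c i)) \<in> rels"
  shows "(\<Oplus>\<^bsub>presented_algebra rels\<^esub>i\<in>S. c i \<odot>\<^bsub>presented_algebra rels\<^esub> word_class rels (g i))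
    = \<zero>\<^bsub>presented_algebra rels\<^esub>"
  using word_class_sum[OF assms(1)] coset_relation[OF assms(2)] by metis

lemma presented_relation_const:
  assumes "finite S" "(\<Sum>i\<in>S. Poly_Mapping.single (g i) (c i)) - Poly_Mapping.single [] d \<in> rels"
  shows "(\<Oplus>\<^bsub>presented_algebra rels\<^esub>i\<in>S. c i \<odot>\<^bsub>presented_algebra rels\<^esub> word_class rels (g i))
    = d \<odot>\<^bsub>presented_algebra rels\<^esub> \<one>\<^bsub>presented_algebra rels\<^esub>"
proof -
  let ?I = "Idl\<^bsub>free_algebra\<^esub> rels" and ?p = "\<Sum>i\<in>S. Poly_Mapping.single (g i) (c i)"
  \<comment> \<open>The constant is written as a sum over a one-element index set, so that
    \<open>word_class_sum\<close> covers it as well.\<close>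
  let ?q = "\<Sum>i\<in>{()}. Poly_Mapping.single [] d"
  have "?p - ?q \<in> ?I"
    using free_algebra.genideal_self[of rels] assms(2) free_algebra_carrier by auto
  then have "?I +>\<^bsub>free_algebra\<^esub> ?p = ?I +>\<^bsub>free_algebra\<^esub> ?q"
    by (rule presented.coset_eqI) (simp_all add: free_algebra_carrier monoid_algebra_simps(4))
  then show ?thesis
    unfolding word_class_sum[OF assms(1)] word_class_sum[OF finite.insertI[OF finite.emptyI]]
    by (simp add: word_class_Nil)
qed

lemma presented_induct [consumes 1, case_names zero word add]:
  assumes "t \<in> carrier (presented_algebra rels)"
    and "P \<zero>\<^bsub>presented_algebra rels\<^esub>"
    and "\<And>v c. P (c \<odot>\<^bsub>presented_algebra rels\<^esub> word_class rels v)"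
    and "\<And>t t'. t \<in> carrier (presented_algebra rels) \<Longrightarrow> t' \<in> carrier (presented_algebra rels) \<Longrightarrow>
      P t \<Longrightarrow> P t' \<Longrightarrow> P (t \<oplus>\<^bsub>presented_algebra rels\<^esub> t')"
  shows "P t"
proof -
  let ?I = "Idl\<^bsub>free_algebra\<^esub> rels"
  obtain p where p: "p \<in> carrier free_algebra" "t = ?I +>\<^bsub>free_algebra\<^esub> p"
    using assms(1) by (auto simp: presented_algebra_def presented.quotient_carrier)
  from p(1) have "P (?I +>\<^bsub>free_algebra\<^esub> p)"
  proof (induction rule: monoid_algebra_induct)
    case zero
    then show ?case
      using assms(2) by (simp add: presented_algebra_def presented.quotient_ops)
        (simp add: monoid_algebra_simps)
  next
    case (single v c)
    have "?I +>\<^bsub>free_algebra\<^esub> Poly_Mapping.single v c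
        = c \<odot>\<^bsub>presented_algebra rels\<^esub> word_class rels v"
      by (simp add: word_class_def presented_algebra_def presented.quotient_smult free_algebra_carrier)
        (simp add: monoid_algebra_simps map_times_single)
    then show ?case using assms(3) by simp
  next
    case (add p q)
    then have "P ((?I +>\<^bsub>free_algebra\<^esub> p) \<oplus>\<^bsub>presented_algebra rels\<^esub> (?I +>\<^bsub>free_algebra\<^esub> q))"
      by (intro assms(4)) (auto simp: presented_algebra_def presented.quotient_carrier)
    then show ?case
      using add by (simp add: presented_algebra_def presented.quotient_ops)
        (simp add: monoid_algebra_simps)
  qed
  then show ?thesis using p by simp
qed

text \<open>The classes of words span the presented algebra. This is the test used for the coalgebra
  and comodule axioms, whose two sides are treated as linear maps only.\<close>

lemma presented_linear_eqI:
  assumes M: "kvec M"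
    and f: "f \<in> linear_maps (presented_algebra rels) M"
    and g: "g \<in> linear_maps (presented_algebra rels) M"
    and eq: "\<And>v. f (word_class rels v) = g (word_class rels v)"
    and "t \<in> carrier (presented_algebra rels)"
  shows "f t = g t"
  using assms(5)
proof (induction rule: presented_induct)
  case zero
  show ?case
    using linear_maps_zero[OF presented_algebra.kvec_axioms M f]
      linear_maps_zero[OF presented_algebra.kvec_axioms M g] by simp
qed (simp_all add: linear_mapsD(2,3)[OF f] linear_mapsD(2,3)[OF g] eq)

text \<open>Agreement passes from generators to words by multiplicativity and from words to the
  carrier by linearity. Outside the carrier both maps are \<open>undefined\<close> by
  extensionality, which gives equality as functions.\<close>

lemma presented_hom_unique:
  assumes "kalg B" and f: "f \<in> alg_hom (presented_algebra rels) B"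
    and g: "g \<in> alg_hom (presented_algebra rels) B"
    and eq: "\<And>a. f (presented_gen rels a) = g (presented_gen rels a)"
  shows "f = g"
proof
  interpret B: kalg B by fact
  fix t
  have words: "f (word_class rels v) = g (word_class rels v)" for v
  proof (induction v)
    case Nil
    show ?case by (simp add: word_class_Nil alg_homD(5)[OF f] alg_homD(5)[OF g])
  next
    case (Cons a v)
    show ?case
      using word_class_append[of "[a]" v] Cons eq[of a]
      by (simp add: word_class_gen alg_homD(3)[OF f] alg_homD(3)[OF g])
  qed
  show "f t = g t"
  proof (cases "t \<in> carrier (presented_algebra rels)")
    case True
    with presented_linear_eqI[OF B.kvec_axioms alg_hom_linear[OF f] alg_hom_linear[OF g] words]
    show ?thesis .
  next
    case False
    then show ?thesis
      using alg_homD(6)[OF f] alg_homD(6)[OF g] by (simp add: extensional_def)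
  qed
qed

lemma presented_hom_exists:
  fixes B :: "('k, 'b, 'n) module_scheme"
  assumes B: "kalg B"
    and F: "\<And>v. F v \<in> carrier B"
    and F_Nil: "F [] = \<one>\<^bsub>B\<^esub>"
    and F_append: "\<And>v w. F (v @ w) = F v \<otimes>\<^bsub>B\<^esub> F w"
    and F_rels: "\<And>r. r \<in> rels \<Longrightarrow> lin_ext B F r = \<zero>\<^bsub>B\<^esub>"
  shows "\<exists>h\<in>alg_hom (presented_algebra rels) B. \<forall>v. h (word_class rels v) = F v"
proof
  interpret B: kalg B by fact
  let ?I = "Idl\<^bsub>free_algebra\<^esub> rels" and ?L = "lin_ext B F"
  \<comment> \<open>Restriction to the carrier supplies the extensionality that
    \<open>alg_hom\<close> demands.\<close>
  define h where "h = restrict (\<lambda>t. the_elem (?L ` t)) (carrier (presented_algebra rels))"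
  have Pi: "F \<in> carrier free_monoid \<rightarrow> carrier B" using F by auto
  have lin: "?L \<in> linear_maps free_algebra B"
    by (rule B.lin_ext_linear[OF Pi])
  have mult: "?L (p \<otimes>\<^bsub>free_algebra\<^esub> q) = ?L p \<otimes>\<^bsub>B\<^esub> ?L q" for p q
    by (rule lin_ext_mult[OF free_monoid B Pi])
      (simp_all add: F_append free_monoid_simps monoid_algebra_simps)
  have closed: "?L p \<in> carrier B" for p
    by (rule linear_mapsD[OF lin]) (simp add: free_algebra_carrier)
  have van: "?L x = \<zero>\<^bsub>B\<^esub>" if "x \<in> ?I" for x
    by (rule free_algebra.linear_vanishes_Idl[OF B.kvec_axioms lin _ _ that])
      (simp_all add: free_algebra_carrier mult F_rels closed)
  have h_coset: "h (?I +>\<^bsub>free_algebra\<^esub> p) = ?L p" for p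
  proof -
    have "?L ` (?I +>\<^bsub>free_algebra\<^esub> p) = {?L p}"
      by (rule presented.linear_image_coset[OF B.kvec_axioms lin van])
        (simp_all add: free_algebra_carrier)
    then show ?thesis
      by (simp add: h_def presented_algebra_def presented.quotient_carrier free_algebra_carrier)
  qed
  show "\<forall>v. h (word_class rels v) = F v"
    using F by (simp add: word_class_def h_coset B.lin_ext_single)
  have carrierE: "\<exists>p. t = ?I +>\<^bsub>free_algebra\<^esub> p" if "t \<in> carrier (presented_algebra rels)" for t
    using that by (auto simp: presented_algebra_def presented.quotient_carrier)
  note ops = presented_algebra_def presented.quotient_ops presented.quotient_smult free_algebra_carrier
  show "h \<in> alg_hom (presented_algebra rels) B"
    unfolding alg_hom_def
  proof (intro CollectI conjI IntI ring_hom_memI allI ballI)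
    show "h \<in> extensional (carrier (presented_algebra rels))" by (simp add: h_def)
    show "h \<one>\<^bsub>presented_algebra rels\<^esub> = \<one>\<^bsub>B\<^esub>"
      using F[of "[]"] by (simp add: word_class_Nil[symmetric] word_class_def h_coset B.lin_ext_single F_Nil)
  next
    fix x assume "x \<in> carrier (presented_algebra rels)"
    then obtain p where p: "x = ?I +>\<^bsub>free_algebra\<^esub> p" using carrierE by blast
    show "h x \<in> carrier B" by (simp add: p h_coset closed)
    show "h (c \<odot>\<^bsub>presented_algebra rels\<^esub> x) = c \<odot>\<^bsub>B\<^esub> h x" for c
      by (simp add: p ops h_coset[unfolded free_algebra_carrier] linear_mapsD(3)[OF lin])
    fix y assume "y \<in> carrier (presented_algebra rels)"
    then obtain q where q: "y = ?I +>\<^bsub>free_algebra\<^esub> q" using carrierE by blast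
    show "h (x \<otimes>\<^bsub>presented_algebra rels\<^esub> y) = h x \<otimes>\<^bsub>B\<^esub> h y"
      by (simp add: p q ops h_coset mult)
    show "h (x \<oplus>\<^bsub>presented_algebra rels\<^esub> y) = h x \<oplus>\<^bsub>B\<^esub> h y"
      by (simp add: p q ops h_coset linear_mapsD(2)[OF lin])
  qed
qed

end

lemma lin_ext_sum:
  fixes B :: "('k::field, 'b, 'n) module_scheme"
  assumes "kvec B" and F: "\<And>v. F v \<in> carrier B"
  shows "lin_ext B F (\<Sum>i\<in>S. Poly_Mapping.single (g i :: 'g list) (c i)) = (\<Oplus>\<^bsub>B\<^esub>i\<in>S. c i \<odot>\<^bsub>B\<^esub> F (g i))"
proof -
  interpret B: kvec B by fact
  have "F \<in> carrier free_monoid \<rightarrow> carrier B" using F by auto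
  from linear_maps_finsum[OF kalg.axioms(1)[OF free_algebra_kalg] assms(1) B.lin_ext_linear[OF this],
      of S "\<lambda>i. Poly_Mapping.single (g i) (c i)"]
  show ?thesis
    by (simp add: monoid_algebra_finsum free_monoid free_algebra_carrier B.lin_ext_single F)
qed

lemma lin_ext_sum_minus_const:
  fixes B :: "('k::field, 'b, 'n) module_scheme"
  assumes "kvec B" and F: "\<And>v :: 'g list. F v \<in> carrier B"
    and eq: "(\<Oplus>\<^bsub>B\<^esub>i\<in>S. c i \<odot>\<^bsub>B\<^esub> F (g i)) = d \<odot>\<^bsub>B\<^esub> F []"
  shows "lin_ext B F ((\<Sum>i\<in>S. Poly_Mapping.single (g i) (c i)) - Poly_Mapping.single [] d) = \<zero>\<^bsub>B\<^esub>"
proof -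
  interpret B: kvec B by fact
  let ?p = "\<Sum>i\<in>S. Poly_Mapping.single (g i) (c i)" and ?q = "Poly_Mapping.single [] d"
  have Pi: "F \<in> carrier free_monoid \<rightarrow> carrier B" using F by auto
  have "lin_ext B F ((?p - ?q) \<oplus>\<^bsub>free_algebra\<^esub> ?q) = lin_ext B F (?p - ?q) \<oplus>\<^bsub>B\<^esub> lin_ext B F ?q"
    by (rule linear_mapsD[OF B.lin_ext_linear[OF Pi]]) (simp_all add: free_algebra_carrier)
  then have "lin_ext B F (?p - ?q) \<oplus>\<^bsub>B\<^esub> d \<odot>\<^bsub>B\<^esub> F [] = d \<odot>\<^bsub>B\<^esub> F []"
    using eq lin_ext_sum[OF assms(1), where F = F and S = S and g = g and c = c] F
    by (simp add: monoid_algebra_simps(4) B.lin_ext_single F)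
  moreover have "lin_ext B F (?p - ?q) \<in> carrier B"
    by (rule linear_mapsD[OF B.lin_ext_linear[OF Pi]]) (simp_all add: free_algebra_carrier)
  ultimately show ?thesis
    using B.add.l_cancel_one'[of "d \<odot>\<^bsub>B\<^esub> F []" "lin_ext B F (?p - ?q)"] F by (simp add: B.a_comm)
qed


section \<open>Matrix coactions\<close>

text \<open>
  Both the coproduct of a matrix coalgebra, restricted to the span of a column, and a coaction
  given by a matrix have the form treated here.
\<close>

locale matrix_coaction = kalg_pair H M
  for H :: "('k::field, 'a, 'm) module_scheme" and M :: "('k, 'b, 'n) module_scheme" +
  fixes I :: "'i set" and U :: "'i \<Rightarrow> 'i \<Rightarrow> 'a" and Y :: "'i \<Rightarrow> 'b"
    and \<Delta> :: "'a \<Rightarrow> ('a \<times> 'a \<Rightarrow>\<^sub>0 'k) set" and \<rho> :: "'b \<Rightarrow> ('a \<times> 'b \<Rightarrow>\<^sub>0 'k) set"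
    and \<epsilon> :: "'a \<Rightarrow> 'k"
  assumes fin: "finite I"
    and U: "\<And>i j. i \<in> I \<Longrightarrow> j \<in> I \<Longrightarrow> U i j \<in> carrier H"
    and Y: "\<And>i. i \<in> I \<Longrightarrow> Y i \<in> carrier M"
    and \<Delta>: "\<Delta> \<in> linear_maps H (tensor_algebra H H)"
    and \<rho>: "\<rho> \<in> linear_maps M (tensor_algebra H M)"
    and \<epsilon>: "\<epsilon> \<in> linear_maps H scalar_algebra"
    and \<Delta>_U: "\<And>i j. i \<in> I \<Longrightarrow> j \<in> I \<Longrightarrow>
      \<Delta> (U i j) = (\<Oplus>\<^bsub>tensor_algebra H H\<^esub>k\<in>I. pure_tensor H H (U i k) (U k j))"
    and \<rho>_Y: "\<And>i. i \<in> I \<Longrightarrow> \<rho> (Y i) = (\<Oplus>\<^bsub>tensor_algebra H M\<^esub>k\<in>I. pure_tensor H M (U i k) (Y k))"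
    and \<epsilon>_U: "\<And>i j. i \<in> I \<Longrightarrow> j \<in> I \<Longrightarrow> \<epsilon> (U i j) = (if i = j then 1 else 0)"
begin

sublocale HH: kalg_pair H H
  by (intro kalg_pair.intro A.kalg_axioms)

text \<open>Both sides are the double sum of u^i_l \<otimes> (u^l_k \<otimes> y^k). Expanding the
  coproduct sums over l inside and over k outside, and applying the coaction twice gives the
  opposite order.\<close>

lemma coassociative:
  assumes i: "i \<in> I"
  shows "tensor_assoc H H M (tensor_map (tensor_algebra H H) M \<Delta> id (\<rho> (Y i)))
    = tensor_map H (tensor_algebra H M) id \<rho> (\<rho> (Y i))"
proof -
  let ?HH = "tensor_algebra H H" and ?HM = "tensor_algebra H M"
  let ?HHM = "tensor_algebra ?HH M" and ?HHM' = "tensor_algebra H ?HM"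
  have pHHM: "kalg_pair ?HH M" and pHHM': "kalg_pair H ?HM"
    by (intro kalg_pair.intro HH.tensor_kalg tensor_kalg A.kalg_axioms B.kalg_axioms)+
  interpret HHM: kalg_pair ?HH M by (rule pHHM)
  interpret HHM': kalg_pair H ?HM by (rule pHHM')
  note map1 = tensor_map_linear[OF kalg_pair_axioms pHHM \<Delta> id_linear]
    and map2 = tensor_map_linear[OF kalg_pair_axioms pHHM' id_linear \<rho>]
    and pure1 = tensor_map_pure[OF kalg_pair_axioms pHHM \<Delta> id_linear]
    and pure2 = tensor_map_pure[OF kalg_pair_axioms pHHM' id_linear \<rho>]
    and assoc = tensor_assoc_linear[OF A.kalg_axioms A.kalg_axioms B.kalg_axioms]
    and assoc_pure = tensor_assoc_pure[OF A.kalg_axioms A.kalg_axioms B.kalg_axioms]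
  define P where "P k l = pure_tensor H ?HM (U i l) (pure_tensor H M (U l k) (Y k))" for k l
  have P: "P k l \<in> carrier ?HHM'" if "k \<in> I" "l \<in> I" for k l
    using that i U Y by (auto simp: P_def)
  have left: "tensor_assoc H H M (pure_tensor ?HH M (\<Delta> (U i k)) (Y k)) = (\<Oplus>\<^bsub>?HHM'\<^esub>l\<in>I. P k l)"
    if k: "k \<in> I" for k
  proof -
    have "pure_tensor ?HH M (\<Delta> (U i k)) (Y k)
        = (\<Oplus>\<^bsub>?HHM\<^esub>l\<in>I. pure_tensor ?HH M (pure_tensor H H (U i l) (U l k)) (Y k))"
      unfolding \<Delta>_U[OF i k]
      by (rule linear_maps_finsum[OF HH.T.kvec_axioms HHM.T.kvec_axioms
            bilinear_mapD(1)[OF HHM.pure_bilinear]])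
        (use i k U Y in auto)
    then have "tensor_assoc H H M (pure_tensor ?HH M (\<Delta> (U i k)) (Y k)) = (\<Oplus>\<^bsub>?HHM'\<^esub>l\<in>I.
        tensor_assoc H H M (pure_tensor ?HH M (pure_tensor H H (U i l) (U l k)) (Y k)))"
      by (simp only:) (rule linear_maps_finsum[OF HHM.T.kvec_axioms HHM'.T.kvec_axioms assoc],
        use i k U Y in auto)
    also have "\<dots> = (\<Oplus>\<^bsub>?HHM'\<^esub>l\<in>I. P k l)"
      by (rule HHM'.T.finsum_cong_simple) (use i k U Y P in \<open>auto simp: assoc_pure P_def\<close>)
    finally show ?thesis .
  qed
  have "tensor_map ?HH M \<Delta> id (\<rho> (Y i))
      = (\<Oplus>\<^bsub>?HHM\<^esub>k\<in>I. tensor_map ?HH M \<Delta> id (pure_tensor H M (U i k) (Y k)))"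
    unfolding \<rho>_Y[OF i]
    by (rule linear_maps_finsum[OF T.kvec_axioms HHM.T.kvec_axioms map1]) (use i U Y in auto)
  also have "\<dots> = (\<Oplus>\<^bsub>?HHM\<^esub>k\<in>I. pure_tensor ?HH M (\<Delta> (U i k)) (Y k))"
    by (rule HHM.T.finsum_cong_simple) (use i U Y linear_mapsD(1)[OF \<Delta>] in \<open>auto simp: pure1\<close>)
  finally have "tensor_assoc H H M (tensor_map ?HH M \<Delta> id (\<rho> (Y i)))
      = (\<Oplus>\<^bsub>?HHM'\<^esub>k\<in>I. tensor_assoc H H M (pure_tensor ?HH M (\<Delta> (U i k)) (Y k)))"
    by (simp only:) (rule linear_maps_finsum[OF HHM.T.kvec_axioms HHM'.T.kvec_axioms assoc],
        use i U Y linear_mapsD(1)[OF \<Delta>] in auto)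
  also have "\<dots> = (\<Oplus>\<^bsub>?HHM'\<^esub>k\<in>I. \<Oplus>\<^bsub>?HHM'\<^esub>l\<in>I. P k l)"
    by (rule HHM'.T.finsum_cong_simple) (use P in \<open>auto simp: left intro!: HHM'.T.finsum_closed\<close>)
  also have "\<dots> = (\<Oplus>\<^bsub>?HHM'\<^esub>l\<in>I. \<Oplus>\<^bsub>?HHM'\<^esub>k\<in>I. P k l)"
    by (rule HHM'.T.finsum_swap) (use fin P in auto)
  also have "\<dots> = (\<Oplus>\<^bsub>?HHM'\<^esub>l\<in>I. tensor_map H ?HM id \<rho> (pure_tensor H M (U i l) (Y l)))"
  proof (rule HHM'.T.finsum_cong_simple)
    fix l assume l: "l \<in> I"
    have "tensor_map H ?HM id \<rho> (pure_tensor H M (U i l) (Y l)) = pure_tensor H ?HM (U i l) (\<rho> (Y l))"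
      using i l U Y by (simp add: pure2)
    also have "\<dots> = (\<Oplus>\<^bsub>?HHM'\<^esub>k\<in>I. P k l)"
      unfolding \<rho>_Y[OF l] P_def
      by (rule linear_maps_finsum[OF T.kvec_axioms HHM'.T.kvec_axioms
            bilinear_mapD(2)[OF HHM'.pure_bilinear]])
        (use i l U Y in auto)
    finally show "(\<Oplus>\<^bsub>?HHM'\<^esub>k\<in>I. P k l) = tensor_map H ?HM id \<rho> (pure_tensor H M (U i l) (Y l))" ..
    show "tensor_map H ?HM id \<rho> (pure_tensor H M (U i l) (Y l)) \<in> carrier ?HHM'"
      by (rule linear_mapsD[OF map2]) (use i l U Y in auto)
  qed
  also have "\<dots> = tensor_map H ?HM id \<rho> (\<rho> (Y i))"
    unfolding \<rho>_Y[OF i]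
    by (rule linear_maps_finsum[OF T.kvec_axioms HHM'.T.kvec_axioms map2, symmetric])
      (use i U Y in auto)
  finally show ?thesis .
qed

lemma counit_left:
  assumes i: "i \<in> I"
  shows "tensor_unit_left M (tensor_map scalar_algebra M \<epsilon> id (\<rho> (Y i))) = Y i"
proof -
  let ?K = "scalar_algebra :: ('k, 'k) module"
  have pKM: "kalg_pair ?K M"
    by (intro kalg_pair.intro scalar_algebra_kalg B.kalg_axioms)
  interpret KM: kalg_pair ?K M by (rule pKM)
  note map = tensor_map_linear[OF kalg_pair_axioms pKM \<epsilon> id_linear]
  let ?f = "\<lambda>t. tensor_unit_left M (tensor_map ?K M \<epsilon> id t)"
  have lin: "?f \<in> linear_maps (tensor_algebra H M) M"
    by (rule linear_maps_comp[OF tensor_unit_left_linear[OF B.kalg_axioms] map])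
  have "?f (\<rho> (Y i)) = (\<Oplus>\<^bsub>M\<^esub>k\<in>I. ?f (pure_tensor H M (U i k) (Y k)))"
    unfolding \<rho>_Y[OF i]
    by (rule linear_maps_finsum[OF T.kvec_axioms B.kvec_axioms lin]) (use i U Y in auto)
  also have "\<dots> = (\<Oplus>\<^bsub>M\<^esub>k\<in>I. (if k = i then 1 else 0) \<odot>\<^bsub>M\<^esub> Y k)"
    by (rule B.finsum_cong_simple)
      (use i U Y in \<open>auto simp: tensor_map_pure[OF kalg_pair_axioms pKM \<epsilon> id_linear]
        tensor_unit_left_pure[OF B.kalg_axioms] \<epsilon>_U\<close>)
  also have "\<dots> = Y i"
    using B.finsum_delta[OF fin i, of Y 1] i Y by simp
  finally show ?thesis .
qed

end

text \<open>The right counit law concerns the coalgebra and has no analogue for a left comodule, so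
  it stands outside \<open>matrix_coaction\<close>. The counit turns the column factor into a
  Kronecker symbol.\<close>

lemma matrix_counit_right:
  fixes H :: "('k::field, 'a, 'm) module_scheme"
  assumes "kalg H" "finite I" "i \<in> I" "j \<in> I"
    and U: "\<And>i j. i \<in> I \<Longrightarrow> j \<in> I \<Longrightarrow> U i j \<in> carrier H"
    and \<epsilon>: "\<epsilon> \<in> linear_maps H scalar_algebra"
    and \<epsilon>_U: "\<And>i j. i \<in> I \<Longrightarrow> j \<in> I \<Longrightarrow> \<epsilon> (U i j) = (if i = j then 1 else 0)"
  shows "tensor_unit_right H (tensor_map H scalar_algebra id \<epsilon>
    (\<Oplus>\<^bsub>tensor_algebra H H\<^esub>k\<in>I. pure_tensor H H (U i k) (U k j))) = U i j"
proof -
  let ?K = "scalar_algebra :: ('k, 'k) module"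
  interpret H: kalg H by fact
  have pHK: "kalg_pair H ?K" and pHH: "kalg_pair H H"
    by (intro kalg_pair.intro scalar_algebra_kalg H.kalg_axioms)+
  interpret HK: kalg_pair H ?K by (rule pHK)
  interpret HH: kalg_pair H H by (rule pHH)
  note map = tensor_map_linear[OF pHH pHK id_linear \<epsilon>]
  let ?f = "\<lambda>t. tensor_unit_right H (tensor_map H ?K id \<epsilon> t)"
  have lin: "?f \<in> linear_maps (tensor_algebra H H) H"
    by (rule linear_maps_comp[OF tensor_unit_right_linear[OF H.kalg_axioms] map])
  have "?f (\<Oplus>\<^bsub>tensor_algebra H H\<^esub>k\<in>I. pure_tensor H H (U i k) (U k j))
      = (\<Oplus>\<^bsub>H\<^esub>k\<in>I. ?f (pure_tensor H H (U i k) (U k j)))"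
    by (rule linear_maps_finsum[OF HH.T.kvec_axioms H.kvec_axioms lin]) (use assms in auto)
  also have "\<dots> = (\<Oplus>\<^bsub>H\<^esub>k\<in>I. (if k = j then 1 else 0) \<odot>\<^bsub>H\<^esub> U i k)"
    by (rule H.finsum_cong_simple)
      (use assms in \<open>auto simp: tensor_map_pure[OF pHH pHK id_linear \<epsilon>]
        tensor_unit_right_pure[OF H.kalg_axioms] \<epsilon>_U\<close>)
  also have "\<dots> = U i j"
    using H.finsum_delta[OF assms(2,4), of "U i" 1] assms by simp
  finally show ?thesis .
qed

section \<open>Multilinear forms\<close>

lemma form_expand_entry:
  fixes w :: "('k::field ^ 'n) list \<Rightarrow> 'k"
  assumes form: "form_on_space m w" and len: "length pre + 1 + length post = m"
  shows "w (pre @ x # post) = (\<Sum>i\<in>UNIV. x $ i * w (pre @ axis i 1 # post))"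
proof -
  have lin: "w (pre @ (a *s y + b *s z) # post) = a * w (pre @ y # post) + b * w (pre @ z # post)"
    for a b y z
    using form len unfolding multilinear_form_def by blast
  have zero: "w (pre @ 0 # post) = 0"
    using lin[of 0 0 0 0] by simp
  have "w (pre @ (\<Sum>i\<in>S. x $ i *s axis i 1) # post) = (\<Sum>i\<in>S. x $ i * w (pre @ axis i 1 # post))"
    if "finite S" for S :: "'n set"
    using that
  proof (induction S)
    case (insert j S)
    then show ?case
      using lin[of "x $ j" "axis j 1" 1 "\<Sum>i\<in>S. x $ i *s axis i 1"] by simp
  qed (simp add: zero)
  from this[of UNIV] show ?thesis by (simp add: basis_expansion)
qed

text \<open>The coefficients are products of coordinates of the vectors in \<open>vs\<close>. What
  matters is that they depend neither on the other arguments nor on the place of the block, so that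
  a single combination serves all \<mu> at once.\<close>

lemma form_expand:
  fixes w :: "('k::field ^ 'n) list \<Rightarrow> 'k"
  assumes form: "form_on_space m w"
  shows "\<exists>c. \<forall>pre post. length pre + length vs + length post = m \<longrightarrow>
    w (pre @ vs @ post) = (\<Sum>\<sigma>\<in>multi (length vs). c \<sigma> * w (pre @ map (\<lambda>i. axis i 1) \<sigma> @ post))"
proof (induction vs)
  case Nil
  have "{\<sigma> :: 'n list. \<sigma> = []} = {[]}" by auto
  then show ?case by (intro exI[of _ "\<lambda>_. 1"]) simp
next
  case (Cons x vs)
  then obtain c where c: "\<And>pre post. length pre + length vs + length post = m \<Longrightarrow>
    w (pre @ vs @ post) = (\<Sum>\<sigma>\<in>multi (length vs). c \<sigma> * w (pre @ map (\<lambda>i. axis i 1) \<sigma> @ post))"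
    by blast
  show ?case
  proof (intro exI[of _ "\<lambda>\<sigma>. x $ hd \<sigma> * c (tl \<sigma>)"] allI impI)
    fix pre post :: "('k ^ 'n) list"
    assume len: "length pre + length (x # vs) + length post = m"
    have "w (pre @ (x # vs) @ post)
        = (\<Sum>i\<in>UNIV. x $ i * w (pre @ axis i 1 # (vs @ post)))"
      using form_expand_entry[OF form, of pre "vs @ post" x] len by simp
    also have "\<dots> = (\<Sum>i\<in>UNIV. x $ i * (\<Sum>\<sigma>\<in>multi (length vs).
        c \<sigma> * w (pre @ axis i 1 # map (\<lambda>i. axis i 1) \<sigma> @ post)))"
    proof (rule sum.cong)
      fix i
      show "x $ i * w (pre @ axis i 1 # (vs @ post)) = x $ i * (\<Sum>\<sigma>\<in>multi (length vs).
          c \<sigma> * w (pre @ axis i 1 # map (\<lambda>i. axis i 1) \<sigma> @ post))"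
        using c[of "pre @ [axis i 1]" post] len by simp
    qed simp
    finally show "w (pre @ (x # vs) @ post) = (\<Sum>\<sigma>\<in>multi (length (x # vs)).
        x $ hd \<sigma> * c (tl \<sigma>) * w (pre @ map (\<lambda>i. axis i 1) \<sigma> @ post))"
      by (simp add: sum_lists_Cons sum_distrib_left mult.assoc)
  qed
qed

text \<open>The cyclic rule takes the last argument to the front through \<open>Q\<close>. Removing
  the entries of \<open>ys\<close> from the end keeps their order.\<close>

lemma form_rotate:
  fixes w :: "('k::field ^ 'n) list \<Rightarrow> 'k"
  assumes Q: "\<And>xs x. length xs = m - 1 \<Longrightarrow> w (xs @ [x]) = w (Q x # xs)"
    and "length xs + length ys = m"
  shows "w (xs @ ys) = w (map Q ys @ xs)"
  using assms(2)
proof (induction ys arbitrary: xs rule: rev_induct)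
  case (snoc y ys)
  then show ?case
    using Q[of "xs @ ys" y] snoc.IH[of "Q y # xs"] by simp
qed simp

text \<open>In the second claim the block \<kappa> is rotated to the front, which applies
  \<open>Q\<close> to its basis vectors, and the result is expanded in the basis. In the first claim
  the basis vectors of the block are written as images under \<open>Q\<close> of their preimages;
  the block can then be rotated to the back, where the preimages are expanded. In both cases the
  coefficients depend on \<kappa> but not on \<mu>.\<close>

lemma preregular_comps_rotate:
  fixes w :: "('k::field ^ 'n) list \<Rightarrow> 'k"
  assumes "preregular m w" and "length \<kappa> + l = m"
  shows "\<exists>c. \<forall>\<mu>\<in>multi l. comps w (\<kappa> @ \<mu>) = (\<Sum>\<sigma>\<in>multi (length \<kappa>). c \<sigma> * comps w (\<mu> @ \<sigma>))"
    and "\<exists>c. \<forall>\<mu>\<in>multi l. comps w (\<mu> @ \<kappa>) = (\<Sum>\<sigma>\<in>multi (length \<kappa>). c \<sigma> * comps w (\<sigma> @ \<mu>))"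
proof -
  obtain Q where Q: "bij Q" "\<And>xs x. length xs = m - 1 \<Longrightarrow> w (xs @ [x]) = w (Q x # xs)"
    using assms(1) unfolding preregular_def by blast
  have form: "form_on_space m w" using assms(1) unfolding preregular_def by blast
  let ?e = "map (\<lambda>i. axis i 1) :: 'n list \<Rightarrow> ('k ^ 'n) list"
  obtain R where R: "\<And>x. Q (R x) = x"
    using bij_is_surj[OF Q(1)] by (metis surj_f_inv_f)
  have Q_R: "map Q (map R xs) = xs" for xs
    by (simp add: R map_idI)
  from form_expand[OF form, of "map R (?e \<kappa>)"]
  obtain c where c: "\<And>pre post. length pre + length \<kappa> + length post = m \<Longrightarrow>
      w (pre @ map R (?e \<kappa>) @ post) = (\<Sum>\<sigma>\<in>multi (length \<kappa>). c \<sigma> * w (pre @ ?e \<sigma> @ post))"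
    by auto
  have "comps w (\<kappa> @ \<mu>) = (\<Sum>\<sigma>\<in>multi (length \<kappa>). c \<sigma> * comps w (\<mu> @ \<sigma>))" if "\<mu> \<in> multi l" for \<mu>
  proof -
    have "comps w (\<kappa> @ \<mu>) = w (map Q (map R (?e \<kappa>)) @ ?e \<mu>)"
      unfolding Q_R by (simp add: comps_def)
    also have "\<dots> = w (?e \<mu> @ map R (?e \<kappa>))"
      by (rule form_rotate[symmetric]) (use Q(2) assms(2) that in auto)
    also have "\<dots> = (\<Sum>\<sigma>\<in>multi (length \<kappa>). c \<sigma> * comps w (\<mu> @ \<sigma>))"
      using c[of "?e \<mu>" "[]"] assms(2) that by (simp add: comps_def)
    finally show ?thesis .
  qed
  then show "\<exists>c. \<forall>\<mu>\<in>multi l. comps w (\<kappa> @ \<mu>) = (\<Sum>\<sigma>\<in>multi (length \<kappa>). c \<sigma> * comps w (\<mu> @ \<sigma>))"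
    by blast
  from form_expand[OF form, of "map Q (?e \<kappa>)"]
  obtain d where d: "\<And>pre post. length pre + length \<kappa> + length post = m \<Longrightarrow>
      w (pre @ map Q (?e \<kappa>) @ post) = (\<Sum>\<sigma>\<in>multi (length \<kappa>). d \<sigma> * w (pre @ ?e \<sigma> @ post))"
    by auto
  have "comps w (\<mu> @ \<kappa>) = (\<Sum>\<sigma>\<in>multi (length \<kappa>). d \<sigma> * comps w (\<sigma> @ \<mu>))" if "\<mu> \<in> multi l" for \<mu>
  proof -
    have "comps w (\<mu> @ \<kappa>) = w (map Q (?e \<kappa>) @ ?e \<mu>)"
      using form_rotate[of m w Q "?e \<mu>" "?e \<kappa>"] Q(2) assms(2) that by (simp add: comps_def)
    also have "\<dots> = (\<Sum>\<sigma>\<in>multi (length \<kappa>). d \<sigma> * comps w (\<sigma> @ \<mu>))"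
      using d[of "[]" "?e \<mu>"] assms(2) that by (simp add: comps_def)
    finally show ?thesis .
  qed
  then show "\<exists>c. \<forall>\<mu>\<in>multi l. comps w (\<mu> @ \<kappa>) = (\<Sum>\<sigma>\<in>multi (length \<kappa>). c \<sigma> * comps w (\<sigma> @ \<mu>))"
    by blast
qed


section \<open>The coaction\<close>

locale preregular_pair =
  fixes m N :: nat
    and w :: "('k::field ^ 'n) list \<Rightarrow> 'k"
    and wt :: "('k ^ 'n \<Rightarrow> 'k) list \<Rightarrow> 'k"
  assumes N_le: "N \<le> m" and N_pos: "0 < N"
    and preregular: "preregular m w"
    and wt_w: "\<And>\<alpha> \<beta>. (\<Sum>\<gamma>\<in>multi (m - 1). dual_comps wt (\<alpha> # \<gamma>) * comps w (\<gamma> @ [\<beta>]))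
      = (if \<alpha> = \<beta> then 1 else 0)"
begin

abbreviation "A \<equiv> A_alg m w N"
abbreviation "H \<equiv> H_alg m w wt"
abbreviation "W \<equiv> comps w"
abbreviation "Wt \<equiv> dual_comps wt"
abbreviation "Y \<equiv> word_class (A_rels m w N)"

text \<open>The word u^\<alpha>_\<beta>. Since \<open>zip\<close> truncates, it is the intended word
  only for indices of equal length, whence the length conditions in what follows; membership in the
  carrier needs none.\<close>

definition U :: "'n list \<Rightarrow> 'n list \<Rightarrow> (('n \<times> 'n) list \<Rightarrow>\<^sub>0 'k) set" where
  "U \<alpha> \<beta> = word_class (H_rels m w wt) (zip \<alpha> \<beta>)"

lemma H_kalg: "kalg H"
  unfolding H_alg_def by (rule presentation.presented_kalg)

lemma A_kalg: "kalg A"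
  unfolding A_alg_def by (rule presentation.presented_kalg)

sublocale HA: kalg_pair H A
  by (intro kalg_pair.intro H_kalg A_kalg)

sublocale HH: kalg_pair H H
  by (intro kalg_pair.intro H_kalg)

lemma U_closed [simp, intro]: "U \<alpha> \<beta> \<in> carrier H"
  by (simp add: U_def H_alg_def presentation.word_class_closed)

lemma Y_closed [simp, intro]: "Y \<mu> \<in> carrier A"
  by (simp add: A_alg_def presentation.word_class_closed)

lemma U_Nil: "U [] [] = \<one>\<^bsub>H\<^esub>"
  by (simp add: U_def H_alg_def presentation.word_class_Nil)

lemma Y_Nil: "Y [] = \<one>\<^bsub>A\<^esub>"
  by (simp add: A_alg_def presentation.word_class_Nil)

lemma U_append:
  "length \<alpha> = length \<beta> \<Longrightarrow> U (\<alpha> @ \<alpha>') (\<beta> @ \<beta>') = U \<alpha> \<beta> \<otimes>\<^bsub>H\<^esub> U \<alpha>' \<beta>'"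
  by (simp add: U_def H_alg_def presentation.word_class_append)

lemma U_Cons: "U (a # \<alpha>) (b # \<beta>) = U [a] [b] \<otimes>\<^bsub>H\<^esub> U \<alpha> \<beta>"
  using U_append[of "[a]" "[b]" \<alpha> \<beta>] by simp

lemma Y_append: "Y (\<mu> @ \<nu>) = Y \<mu> \<otimes>\<^bsub>A\<^esub> Y \<nu>"
  by (simp add: A_alg_def presentation.word_class_append)

lemma m_pos: "0 < m"
  using N_le N_pos by simp

section \<open>The defining relations and their rotated form\<close>

lemma W_relation:
  assumes "\<beta> \<in> multi m"
  shows "(\<Oplus>\<^bsub>H\<^esub>\<alpha>\<in>multi m. W \<alpha> \<odot>\<^bsub>H\<^esub> U \<alpha> \<beta>) = W \<beta> \<odot>\<^bsub>H\<^esub> \<one>\<^bsub>H\<^esub>"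
  unfolding H_alg_def U_def
  by (rule presentation.presented_relation_const) (use assms in \<open>auto simp: H_rels_def\<close>)

lemma Wt_relation:
  assumes "\<alpha> \<in> multi m"
  shows "(\<Oplus>\<^bsub>H\<^esub>\<beta>\<in>multi m. Wt \<beta> \<odot>\<^bsub>H\<^esub> U \<alpha> \<beta>) = Wt \<alpha> \<odot>\<^bsub>H\<^esub> \<one>\<^bsub>H\<^esub>"
  unfolding H_alg_def U_def
  by (rule presentation.presented_relation_const) (use assms in \<open>auto simp: H_rels_def\<close>)

lemma Y_relation:
  assumes "\<kappa> \<in> multi (m - N)"
  shows "(\<Oplus>\<^bsub>A\<^esub>\<mu>\<in>multi N. W (\<kappa> @ \<mu>) \<odot>\<^bsub>A\<^esub> Y \<mu>) = \<zero>\<^bsub>A\<^esub>"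
  unfolding A_alg_def
  by (rule presentation.presented_relation) (use assms in \<open>auto simp: A_rels_def\<close>)

text \<open>For fixed \<kappa> the numbers W_{\<mu>\<kappa>} are a combination of the
  W_{\<sigma>\<mu>} with coefficients free of \<mu>, so the left side is a combination of defining
  relations.\<close>

lemma Y_relation_rotated:
  assumes "\<kappa> \<in> multi (m - N)"
  shows "(\<Oplus>\<^bsub>A\<^esub>\<mu>\<in>multi N. W (\<mu> @ \<kappa>) \<odot>\<^bsub>A\<^esub> Y \<mu>) = \<zero>\<^bsub>A\<^esub>"
proof -
  have "length \<kappa> + N = m" using assms N_le by simp
  from preregular_comps_rotate(2)[OF preregular this]
  obtain c where c: "\<And>\<mu>. \<mu> \<in> multi N \<Longrightarrow>
      W (\<mu> @ \<kappa>) = (\<Sum>\<sigma>\<in>multi (length \<kappa>). c \<sigma> * W (\<sigma> @ \<mu>))"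
    by blast
  have "(\<Oplus>\<^bsub>A\<^esub>\<mu>\<in>multi N. W (\<mu> @ \<kappa>) \<odot>\<^bsub>A\<^esub> Y \<mu>)
      = (\<Oplus>\<^bsub>A\<^esub>\<mu>\<in>multi N. (\<Sum>\<sigma>\<in>multi (length \<kappa>). c \<sigma> * W (\<sigma> @ \<mu>)) \<odot>\<^bsub>A\<^esub> Y \<mu>)"
    by (rule HA.B.finsum_cong_simple) (simp_all only: c, simp)
  also have "\<dots> = (\<Oplus>\<^bsub>A\<^esub>\<sigma>\<in>multi (length \<kappa>). c \<sigma> \<odot>\<^bsub>A\<^esub> (\<Oplus>\<^bsub>A\<^esub>\<mu>\<in>multi N. W (\<sigma> @ \<mu>) \<odot>\<^bsub>A\<^esub> Y \<mu>))"
    by (rule HA.B.finsum_sum_smult) auto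
  also have "\<dots> = \<zero>\<^bsub>A\<^esub>"
    by (rule HA.B.add.finprod_one_eqI) (use assms Y_relation in auto)
  finally show ?thesis .
qed

text \<open>The matrix \<open>t\<close> is the antipode of \<open>u\<close>.\<close>

lemma U_right_inverse:
  obtains t where "\<And>a b. t a b \<in> carrier H"
    and "\<And>a b. (\<Oplus>\<^bsub>H\<^esub>i\<in>UNIV. U [a] [i] \<otimes>\<^bsub>H\<^esub> t i b) = (if a = b then 1 else 0) \<odot>\<^bsub>H\<^esub> \<one>\<^bsub>H\<^esub>"
proof
  define l where "l = m - 1"
  have m: "m = Suc l" using m_pos by (simp add: l_def)
  \<comment> \<open>The antipode formula before its contraction with W. Multiplied on the left by
    the row of u at a and summed over i, it becomes the second family of relations at the index
    \<open>a # \<rho>\<close>.\<close>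
  define s where "s i \<rho> = (\<Oplus>\<^bsub>H\<^esub>\<gamma>\<in>multi l. Wt (i # \<gamma>) \<odot>\<^bsub>H\<^esub> U \<rho> \<gamma>)" for i \<rho>
  define t where "t i b = (\<Oplus>\<^bsub>H\<^esub>\<rho>\<in>multi l. W (\<rho> @ [b]) \<odot>\<^bsub>H\<^esub> s i \<rho>)" for i b
  have s: "s i \<rho> \<in> carrier H" for i \<rho>
    by (auto simp: s_def intro!: HA.A.finsum_closed)
  show t: "t a b \<in> carrier H" for a b
    using s by (auto simp: t_def intro!: HA.A.finsum_closed)
  have row: "(\<Oplus>\<^bsub>H\<^esub>i\<in>UNIV. U [a] [i] \<otimes>\<^bsub>H\<^esub> s i \<rho>) = Wt (a # \<rho>) \<odot>\<^bsub>H\<^esub> \<one>\<^bsub>H\<^esub>" if "\<rho> \<in> multi l" for a \<rho>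
  proof -
    have "(\<Oplus>\<^bsub>H\<^esub>i\<in>UNIV. U [a] [i] \<otimes>\<^bsub>H\<^esub> s i \<rho>)
        = (\<Oplus>\<^bsub>H\<^esub>i\<in>UNIV. \<Oplus>\<^bsub>H\<^esub>\<gamma>\<in>multi l. Wt (i # \<gamma>) \<odot>\<^bsub>H\<^esub> U (a # \<rho>) (i # \<gamma>))"
      by (rule HA.A.finsum_cong_simple)
        (auto simp: s_def HA.A.finsum_smult_mult_right U_Cons[of a \<rho>] intro!: HA.A.finsum_closed)
    also have "\<dots> = (\<Oplus>\<^bsub>H\<^esub>\<nu>\<in>multi (Suc l). Wt \<nu> \<odot>\<^bsub>H\<^esub> U (a # \<rho>) \<nu>)"
      by (rule HA.A.finsum_lists_Cons[symmetric]) auto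
    also have "\<dots> = Wt (a # \<rho>) \<odot>\<^bsub>H\<^esub> \<one>\<^bsub>H\<^esub>"
      using Wt_relation[of "a # \<rho>"] that m by simp
    finally show ?thesis .
  qed
  fix a b
  have "(\<Oplus>\<^bsub>H\<^esub>i\<in>UNIV. U [a] [i] \<otimes>\<^bsub>H\<^esub> t i b)
      = (\<Oplus>\<^bsub>H\<^esub>i\<in>UNIV. \<Oplus>\<^bsub>H\<^esub>\<rho>\<in>multi l. W (\<rho> @ [b]) \<odot>\<^bsub>H\<^esub> (U [a] [i] \<otimes>\<^bsub>H\<^esub> s i \<rho>))"
    by (rule HA.A.finsum_cong_simple)
      (use s in \<open>auto simp: t_def HA.A.finsum_smult_mult_right intro!: HA.A.finsum_closed\<close>)
  also have "\<dots> = (\<Oplus>\<^bsub>H\<^esub>\<rho>\<in>multi l. \<Oplus>\<^bsub>H\<^esub>i\<in>UNIV. W (\<rho> @ [b]) \<odot>\<^bsub>H\<^esub> (U [a] [i] \<otimes>\<^bsub>H\<^esub> s i \<rho>))"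
    by (rule HA.A.finsum_swap) (use s in auto)
  also have "\<dots> = (\<Oplus>\<^bsub>H\<^esub>\<rho>\<in>multi l. (Wt (a # \<rho>) * W (\<rho> @ [b])) \<odot>\<^bsub>H\<^esub> \<one>\<^bsub>H\<^esub>)"
  proof (rule HA.A.finsum_cong_simple)
    fix \<rho> :: "'n list" assume \<rho>: "\<rho> \<in> multi l"
    have "(\<Oplus>\<^bsub>H\<^esub>i\<in>UNIV. W (\<rho> @ [b]) \<odot>\<^bsub>H\<^esub> (U [a] [i] \<otimes>\<^bsub>H\<^esub> s i \<rho>))
        = W (\<rho> @ [b]) \<odot>\<^bsub>H\<^esub> (\<Oplus>\<^bsub>H\<^esub>i\<in>UNIV. U [a] [i] \<otimes>\<^bsub>H\<^esub> s i \<rho>)"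
      by (rule HA.A.smult_finsum[symmetric]) (use s in auto)
    also have "\<dots> = (W (\<rho> @ [b]) * Wt (a # \<rho>)) \<odot>\<^bsub>H\<^esub> \<one>\<^bsub>H\<^esub>"
      unfolding row[OF \<rho>] by (simp add: HA.A.smult_assoc1)
    finally show "(\<Oplus>\<^bsub>H\<^esub>i\<in>UNIV. W (\<rho> @ [b]) \<odot>\<^bsub>H\<^esub> (U [a] [i] \<otimes>\<^bsub>H\<^esub> s i \<rho>))
        = (Wt (a # \<rho>) * W (\<rho> @ [b])) \<odot>\<^bsub>H\<^esub> \<one>\<^bsub>H\<^esub>"
      by (simp add: mult.commute)
  qed auto
  also have "\<dots> = (\<Sum>\<rho>\<in>multi l. Wt (a # \<rho>) * W (\<rho> @ [b])) \<odot>\<^bsub>H\<^esub> \<one>\<^bsub>H\<^esub>"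
    by (rule HA.A.finsum_smult_left) auto
  also have "\<dots> = (if a = b then 1 else 0) \<odot>\<^bsub>H\<^esub> \<one>\<^bsub>H\<^esub>"
    using wt_w[of a b] by (simp only: l_def)
  finally show "(\<Oplus>\<^bsub>H\<^esub>i\<in>UNIV. U [a] [i] \<otimes>\<^bsub>H\<^esub> t i b) = (if a = b then 1 else 0) \<odot>\<^bsub>H\<^esub> \<one>\<^bsub>H\<^esub>" .
qed

text \<open>The inverse of a product is the product of the inverses in reverse order. The factor
  \<open>t\<close> for the head therefore stands last: the sum over the tail of \<kappa> collapses
  by induction in the middle of the product, and only then the sum over its head.\<close>

lemma U_words_right_inverse:
  "\<exists>T. (\<forall>\<kappa> \<sigma>. T \<kappa> \<sigma> \<in> carrier H) \<and> (\<forall>\<mu>\<in>multi k. \<forall>\<sigma>\<in>multi k.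
    (\<Oplus>\<^bsub>H\<^esub>\<kappa>\<in>multi k. U \<mu> \<kappa> \<otimes>\<^bsub>H\<^esub> T \<kappa> \<sigma>) = (if \<mu> = \<sigma> then 1 else 0) \<odot>\<^bsub>H\<^esub> \<one>\<^bsub>H\<^esub>)"
proof (induction k)
  case 0
  have "{\<sigma> :: 'n list. \<sigma> = []} = {[]}" by auto
  then show ?case
    by (intro exI[of _ "\<lambda>_ _. \<one>\<^bsub>H\<^esub>"]) (simp add: U_Nil)
next
  case (Suc k)
  then obtain T where T: "\<And>\<kappa> \<sigma>. T \<kappa> \<sigma> \<in> carrier H"
    and T_inv: "\<And>\<mu> \<sigma>. \<mu> \<in> multi k \<Longrightarrow> \<sigma> \<in> multi k \<Longrightarrow>
      (\<Oplus>\<^bsub>H\<^esub>\<kappa>\<in>multi k. U \<mu> \<kappa> \<otimes>\<^bsub>H\<^esub> T \<kappa> \<sigma>) = (if \<mu> = \<sigma> then 1 else 0) \<odot>\<^bsub>H\<^esub> \<one>\<^bsub>H\<^esub>"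
    by blast
  obtain t where t: "\<And>a b. t a b \<in> carrier H"
    and t_inv: "\<And>a b. (\<Oplus>\<^bsub>H\<^esub>i\<in>UNIV. U [a] [i] \<otimes>\<^bsub>H\<^esub> t i b) = (if a = b then 1 else 0) \<odot>\<^bsub>H\<^esub> \<one>\<^bsub>H\<^esub>"
    by (rule U_right_inverse) blast
  show ?case
  proof (intro exI[of _ "\<lambda>\<kappa> \<sigma>. T (tl \<kappa>) (tl \<sigma>) \<otimes>\<^bsub>H\<^esub> t (hd \<kappa>) (hd \<sigma>)"] conjI allI ballI)
    show "T (tl \<kappa>) (tl \<sigma>) \<otimes>\<^bsub>H\<^esub> t (hd \<kappa>) (hd \<sigma>) \<in> carrier H" for \<kappa> \<sigma>
      using T t by simp
    fix \<mu> \<sigma> :: "'n list" assume "\<mu> \<in> multi (Suc k)" "\<sigma> \<in> multi (Suc k)"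
    then obtain a \<mu>' b \<sigma>' where \<mu>: "\<mu> = a # \<mu>'" "\<mu>' \<in> multi k" and \<sigma>: "\<sigma> = b # \<sigma>'" "\<sigma>' \<in> multi k"
      by (auto simp: length_Suc_conv)
    define d :: 'k where "d = (if \<mu>' = \<sigma>' then 1 else 0)"
    have "(\<Oplus>\<^bsub>H\<^esub>\<kappa>\<in>multi (Suc k). U \<mu> \<kappa> \<otimes>\<^bsub>H\<^esub> (T (tl \<kappa>) (tl \<sigma>) \<otimes>\<^bsub>H\<^esub> t (hd \<kappa>) (hd \<sigma>)))
        = (\<Oplus>\<^bsub>H\<^esub>i\<in>UNIV. \<Oplus>\<^bsub>H\<^esub>\<kappa>\<in>multi k. U (a # \<mu>') (i # \<kappa>) \<otimes>\<^bsub>H\<^esub> (T \<kappa> \<sigma>' \<otimes>\<^bsub>H\<^esub> t i b))"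
      by (subst HA.A.finsum_lists_Cons) (use T t in \<open>auto simp: \<mu> \<sigma>\<close>)
    also have "\<dots> = (\<Oplus>\<^bsub>H\<^esub>i\<in>UNIV. d \<odot>\<^bsub>H\<^esub> (U [a] [i] \<otimes>\<^bsub>H\<^esub> t i b))"
    proof (rule HA.A.finsum_cong_simple)
      fix i
      have "(\<Oplus>\<^bsub>H\<^esub>\<kappa>\<in>multi k. U (a # \<mu>') (i # \<kappa>) \<otimes>\<^bsub>H\<^esub> (T \<kappa> \<sigma>' \<otimes>\<^bsub>H\<^esub> t i b))
          = (\<Oplus>\<^bsub>H\<^esub>\<kappa>\<in>multi k. U [a] [i] \<otimes>\<^bsub>H\<^esub> ((U \<mu>' \<kappa> \<otimes>\<^bsub>H\<^esub> T \<kappa> \<sigma>') \<otimes>\<^bsub>H\<^esub> t i b))"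
        by (rule HA.A.finsum_cong_simple) (use T t in \<open>auto simp: U_Cons[of a \<mu>'] HA.A.m_assoc\<close>)
      also have "\<dots> = U [a] [i] \<otimes>\<^bsub>H\<^esub> (\<Oplus>\<^bsub>H\<^esub>\<kappa>\<in>multi k. (U \<mu>' \<kappa> \<otimes>\<^bsub>H\<^esub> T \<kappa> \<sigma>') \<otimes>\<^bsub>H\<^esub> t i b)"
        by (rule HA.A.finsum_rdistr[symmetric]) (use T t in auto)
      also have "\<dots> = U [a] [i] \<otimes>\<^bsub>H\<^esub> ((\<Oplus>\<^bsub>H\<^esub>\<kappa>\<in>multi k. U \<mu>' \<kappa> \<otimes>\<^bsub>H\<^esub> T \<kappa> \<sigma>') \<otimes>\<^bsub>H\<^esub> t i b)"
        by (subst HA.A.finsum_ldistr) (use T t in auto)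
      also have "\<dots> = d \<odot>\<^bsub>H\<^esub> (U [a] [i] \<otimes>\<^bsub>H\<^esub> t i b)"
        unfolding T_inv[OF \<mu>(2) \<sigma>(2)] d_def[symmetric]
        using t by (simp add: HA.A.smult_mult_left HA.A.smult_mult_right)
      finally show "(\<Oplus>\<^bsub>H\<^esub>\<kappa>\<in>multi k. U (a # \<mu>') (i # \<kappa>) \<otimes>\<^bsub>H\<^esub> (T \<kappa> \<sigma>' \<otimes>\<^bsub>H\<^esub> t i b))
          = d \<odot>\<^bsub>H\<^esub> (U [a] [i] \<otimes>\<^bsub>H\<^esub> t i b)" .
    qed (use t in auto)
    also have "\<dots> = d \<odot>\<^bsub>H\<^esub> (\<Oplus>\<^bsub>H\<^esub>i\<in>UNIV. U [a] [i] \<otimes>\<^bsub>H\<^esub> t i b)"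
      by (rule HA.A.smult_finsum[symmetric]) (use t in auto)
    also have "\<dots> = (if \<mu> = \<sigma> then 1 else 0) \<odot>\<^bsub>H\<^esub> \<one>\<^bsub>H\<^esub>"
      unfolding t_inv by (simp add: d_def \<mu> \<sigma>)
    finally show "(\<Oplus>\<^bsub>H\<^esub>\<kappa>\<in>multi (Suc k). U \<mu> \<kappa> \<otimes>\<^bsub>H\<^esub> (T (tl \<kappa>) (tl \<sigma>) \<otimes>\<^bsub>H\<^esub> t (hd \<kappa>) (hd \<sigma>)))
        = (if \<mu> = \<sigma> then 1 else 0) \<odot>\<^bsub>H\<^esub> \<one>\<^bsub>H\<^esub>" .
  qed
qed

text \<open>
  Multiplying the first family of relations of \<open>H\<close> on the right by the inverse of the last
  \<open>m - N\<close> factors of \<open>u\<close>.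
\<close>

lemma W_relation_moved:
  obtains T where "\<And>\<kappa> \<sigma>. T \<kappa> \<sigma> \<in> carrier H"
    and "\<And>\<nu> \<sigma>. \<nu> \<in> multi N \<Longrightarrow> \<sigma> \<in> multi (m - N) \<Longrightarrow>
      (\<Oplus>\<^bsub>H\<^esub>\<mu>\<in>multi N. W (\<mu> @ \<sigma>) \<odot>\<^bsub>H\<^esub> U \<mu> \<nu>) = (\<Oplus>\<^bsub>H\<^esub>\<kappa>\<in>multi (m - N). W (\<nu> @ \<kappa>) \<odot>\<^bsub>H\<^esub> T \<kappa> \<sigma>)"
proof -
  let ?k = "m - N"
  have m: "m = N + ?k" using N_le by simp
  obtain T where T: "\<And>\<kappa> \<sigma>. T \<kappa> \<sigma> \<in> carrier H"
    and T_inv: "\<And>\<mu> \<sigma>. \<mu> \<in> multi ?k \<Longrightarrow> \<sigma> \<in> multi ?k \<Longrightarrow>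
      (\<Oplus>\<^bsub>H\<^esub>\<kappa>\<in>multi ?k. U \<mu> \<kappa> \<otimes>\<^bsub>H\<^esub> T \<kappa> \<sigma>) = (if \<mu> = \<sigma> then 1 else 0) \<odot>\<^bsub>H\<^esub> \<one>\<^bsub>H\<^esub>"
    using U_words_right_inverse[of ?k] by blast
  show ?thesis
  proof (rule that[OF T])
    fix \<nu> \<sigma> :: "'n list" assume \<nu>: "\<nu> \<in> multi N" and \<sigma>: "\<sigma> \<in> multi ?k"
    \<comment> \<open>The general term of a double count. Summation over \<mu> and \<gamma> uses the
      relation of H and gives W_{\<nu>\<kappa>} T^\<kappa>_\<sigma>; summation over \<kappa> uses
      the inverse and leaves only \<gamma> = \<sigma>.\<close>
    define P where "P \<mu> \<gamma> \<kappa> = W (\<mu> @ \<gamma>) \<odot>\<^bsub>H\<^esub> (U \<mu> \<nu> \<otimes>\<^bsub>H\<^esub> (U \<gamma> \<kappa> \<otimes>\<^bsub>H\<^esub> T \<kappa> \<sigma>))" for \<mu> \<gamma> \<kappa>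
    have P: "P \<mu> \<gamma> \<kappa> \<in> carrier H" for \<mu> \<gamma> \<kappa>
      using T by (simp add: P_def)
    have PP: "(\<Oplus>\<^bsub>H\<^esub>\<gamma>\<in>multi ?k. P \<mu> \<gamma> \<kappa>) \<in> carrier H" "(\<Oplus>\<^bsub>H\<^esub>\<kappa>\<in>multi ?k. P \<mu> \<gamma> \<kappa>) \<in> carrier H"
      for \<mu> \<gamma> \<kappa>
      using P by (auto intro!: HA.A.finsum_closed)
    have "(\<Oplus>\<^bsub>H\<^esub>\<kappa>\<in>multi ?k. W (\<nu> @ \<kappa>) \<odot>\<^bsub>H\<^esub> T \<kappa> \<sigma>)
        = (\<Oplus>\<^bsub>H\<^esub>\<kappa>\<in>multi ?k. \<Oplus>\<^bsub>H\<^esub>\<mu>\<in>multi N. \<Oplus>\<^bsub>H\<^esub>\<gamma>\<in>multi ?k. P \<mu> \<gamma> \<kappa>)"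
    proof (rule HA.A.finsum_cong_simple)
      fix \<kappa> :: "'n list" assume \<kappa>: "\<kappa> \<in> multi ?k"
      have "W (\<nu> @ \<kappa>) \<odot>\<^bsub>H\<^esub> T \<kappa> \<sigma> = (W (\<nu> @ \<kappa>) \<odot>\<^bsub>H\<^esub> \<one>\<^bsub>H\<^esub>) \<otimes>\<^bsub>H\<^esub> T \<kappa> \<sigma>"
        using T by (simp add: HA.A.smult_mult_left)
      also have "\<dots> = (\<Oplus>\<^bsub>H\<^esub>\<alpha>\<in>multi m. W \<alpha> \<odot>\<^bsub>H\<^esub> U \<alpha> (\<nu> @ \<kappa>)) \<otimes>\<^bsub>H\<^esub> T \<kappa> \<sigma>"
        using W_relation[of "\<nu> @ \<kappa>"] \<nu> \<kappa> m by simp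
      also have "\<dots> = (\<Oplus>\<^bsub>H\<^esub>\<alpha>\<in>multi (N + ?k). W \<alpha> \<odot>\<^bsub>H\<^esub> (U \<alpha> (\<nu> @ \<kappa>) \<otimes>\<^bsub>H\<^esub> T \<kappa> \<sigma>))"
        unfolding m[symmetric] by (rule HA.A.finsum_smult_mult_left) (use T in auto)
      also have "\<dots> = (\<Oplus>\<^bsub>H\<^esub>\<mu>\<in>multi N. \<Oplus>\<^bsub>H\<^esub>\<gamma>\<in>multi ?k.
          W (\<mu> @ \<gamma>) \<odot>\<^bsub>H\<^esub> (U (\<mu> @ \<gamma>) (\<nu> @ \<kappa>) \<otimes>\<^bsub>H\<^esub> T \<kappa> \<sigma>))"
        by (rule HA.A.finsum_lists_append) (use T in auto)
      also have "\<dots> = (\<Oplus>\<^bsub>H\<^esub>\<mu>\<in>multi N. \<Oplus>\<^bsub>H\<^esub>\<gamma>\<in>multi ?k. P \<mu> \<gamma> \<kappa>)"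
        by (intro HA.A.finsum_cong_simple PP P)
          (use T \<nu> in \<open>auto simp: U_append P_def HA.A.m_assoc\<close>)
      finally show "W (\<nu> @ \<kappa>) \<odot>\<^bsub>H\<^esub> T \<kappa> \<sigma> = (\<Oplus>\<^bsub>H\<^esub>\<mu>\<in>multi N. \<Oplus>\<^bsub>H\<^esub>\<gamma>\<in>multi ?k. P \<mu> \<gamma> \<kappa>)" .
    qed (use PP in \<open>auto intro!: HA.A.finsum_closed\<close>)
    also have "\<dots> = (\<Oplus>\<^bsub>H\<^esub>\<mu>\<in>multi N. \<Oplus>\<^bsub>H\<^esub>\<kappa>\<in>multi ?k. \<Oplus>\<^bsub>H\<^esub>\<gamma>\<in>multi ?k. P \<mu> \<gamma> \<kappa>)"
      by (rule HA.A.finsum_swap) (use PP in auto)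
    also have "\<dots> = (\<Oplus>\<^bsub>H\<^esub>\<mu>\<in>multi N. W (\<mu> @ \<sigma>) \<odot>\<^bsub>H\<^esub> U \<mu> \<nu>)"
    proof (rule HA.A.finsum_cong_simple)
      fix \<mu> :: "'n list"
      have inner: "(\<Oplus>\<^bsub>H\<^esub>\<kappa>\<in>multi ?k. P \<mu> \<gamma> \<kappa>)
          = (if \<gamma> = \<sigma> then 1 else 0) \<odot>\<^bsub>H\<^esub> (W (\<mu> @ \<gamma>) \<odot>\<^bsub>H\<^esub> U \<mu> \<nu>)" if \<gamma>: "\<gamma> \<in> multi ?k" for \<gamma>
      proof -
        have "(\<Oplus>\<^bsub>H\<^esub>\<kappa>\<in>multi ?k. P \<mu> \<gamma> \<kappa>)
            = W (\<mu> @ \<gamma>) \<odot>\<^bsub>H\<^esub> (\<Oplus>\<^bsub>H\<^esub>\<kappa>\<in>multi ?k. U \<mu> \<nu> \<otimes>\<^bsub>H\<^esub> (U \<gamma> \<kappa> \<otimes>\<^bsub>H\<^esub> T \<kappa> \<sigma>))"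
          unfolding P_def by (rule HA.A.smult_finsum[symmetric]) (use T in auto)
        also have "\<dots> = W (\<mu> @ \<gamma>) \<odot>\<^bsub>H\<^esub> (U \<mu> \<nu> \<otimes>\<^bsub>H\<^esub> (\<Oplus>\<^bsub>H\<^esub>\<kappa>\<in>multi ?k. U \<gamma> \<kappa> \<otimes>\<^bsub>H\<^esub> T \<kappa> \<sigma>))"
          by (subst HA.A.finsum_rdistr) (use T in auto)
        also have "\<dots> = (if \<gamma> = \<sigma> then 1 else 0) \<odot>\<^bsub>H\<^esub> (W (\<mu> @ \<gamma>) \<odot>\<^bsub>H\<^esub> U \<mu> \<nu>)"
          unfolding T_inv[OF \<gamma> \<sigma>] by (simp add: HA.A.smult_mult_right)
        finally show ?thesis .
      qed
      have "(\<Oplus>\<^bsub>H\<^esub>\<kappa>\<in>multi ?k. \<Oplus>\<^bsub>H\<^esub>\<gamma>\<in>multi ?k. P \<mu> \<gamma> \<kappa>) = (\<Oplus>\<^bsub>H\<^esub>\<gamma>\<in>multi ?k. \<Oplus>\<^bsub>H\<^esub>\<kappa>\<in>multi ?k. P \<mu> \<gamma> \<kappa>)"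
        by (rule HA.A.finsum_swap) (use P in auto)
      also have "\<dots> = (\<Oplus>\<^bsub>H\<^esub>\<gamma>\<in>multi ?k. (if \<gamma> = \<sigma> then 1 else 0) \<odot>\<^bsub>H\<^esub> (W (\<mu> @ \<gamma>) \<odot>\<^bsub>H\<^esub> U \<mu> \<nu>))"
        by (rule HA.A.finsum_cong_simple) (auto simp: inner)
      also have "\<dots> = 1 \<odot>\<^bsub>H\<^esub> (W (\<mu> @ \<sigma>) \<odot>\<^bsub>H\<^esub> U \<mu> \<nu>)"
        by (rule HA.A.finsum_delta) (use \<sigma> in auto)
      finally show "(\<Oplus>\<^bsub>H\<^esub>\<kappa>\<in>multi ?k. \<Oplus>\<^bsub>H\<^esub>\<gamma>\<in>multi ?k. P \<mu> \<gamma> \<kappa>) = W (\<mu> @ \<sigma>) \<odot>\<^bsub>H\<^esub> U \<mu> \<nu>"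
        by simp
    qed auto
    finally show "(\<Oplus>\<^bsub>H\<^esub>\<mu>\<in>multi N. W (\<mu> @ \<sigma>) \<odot>\<^bsub>H\<^esub> U \<mu> \<nu>)
        = (\<Oplus>\<^bsub>H\<^esub>\<kappa>\<in>multi ?k. W (\<nu> @ \<kappa>) \<odot>\<^bsub>H\<^esub> T \<kappa> \<sigma>)" ..
  qed
qed

definition coaction_word where
  "coaction_word \<mu> = (\<Oplus>\<^bsub>tensor_algebra H A\<^esub>\<nu>\<in>multi (length \<mu>). pure_tensor H A (U \<mu> \<nu>) (Y \<nu>))"

lemma coaction_word_closed [simp, intro]: "coaction_word \<mu> \<in> carrier (tensor_algebra H A)"
  by (auto simp: coaction_word_def intro!: HA.T.finsum_closed)

lemma coaction_word_rotated:
  assumes \<sigma>: "\<sigma> \<in> multi (m - N)"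
  shows "(\<Oplus>\<^bsub>tensor_algebra H A\<^esub>\<mu>\<in>multi N. W (\<mu> @ \<sigma>) \<odot>\<^bsub>tensor_algebra H A\<^esub> coaction_word \<mu>)
    = \<zero>\<^bsub>tensor_algebra H A\<^esub>"
proof -
  let ?T = "tensor_algebra H A" and ?k = "m - N"
  obtain T where T: "\<And>\<kappa> \<sigma>. T \<kappa> \<sigma> \<in> carrier H"
    and moved: "\<And>\<nu> \<sigma>. \<nu> \<in> multi N \<Longrightarrow> \<sigma> \<in> multi ?k \<Longrightarrow>
      (\<Oplus>\<^bsub>H\<^esub>\<mu>\<in>multi N. W (\<mu> @ \<sigma>) \<odot>\<^bsub>H\<^esub> U \<mu> \<nu>) = (\<Oplus>\<^bsub>H\<^esub>\<kappa>\<in>multi ?k. W (\<nu> @ \<kappa>) \<odot>\<^bsub>H\<^esub> T \<kappa> \<sigma>)"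
    using W_relation_moved by blast
  have "(\<Oplus>\<^bsub>?T\<^esub>\<mu>\<in>multi N. W (\<mu> @ \<sigma>) \<odot>\<^bsub>?T\<^esub> coaction_word \<mu>)
      = (\<Oplus>\<^bsub>?T\<^esub>\<mu>\<in>multi N. W (\<mu> @ \<sigma>) \<odot>\<^bsub>?T\<^esub> (\<Oplus>\<^bsub>?T\<^esub>\<nu>\<in>multi N. pure_tensor H A (U \<mu> \<nu>) (Y \<nu>)))"
    by (rule HA.T.finsum_cong_simple) (auto simp: coaction_word_def intro!: HA.T.finsum_closed)
  also have "\<dots> = (\<Oplus>\<^bsub>?T\<^esub>\<nu>\<in>multi N. pure_tensor H A (\<Oplus>\<^bsub>H\<^esub>\<mu>\<in>multi N. W (\<mu> @ \<sigma>) \<odot>\<^bsub>H\<^esub> U \<mu> \<nu>) (Y \<nu>))"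
    by (rule HA.finsum_smult_pure_left) auto
  also have "\<dots> = (\<Oplus>\<^bsub>?T\<^esub>\<nu>\<in>multi N. \<Oplus>\<^bsub>?T\<^esub>\<kappa>\<in>multi ?k. W (\<nu> @ \<kappa>) \<odot>\<^bsub>?T\<^esub> pure_tensor H A (T \<kappa> \<sigma>) (Y \<nu>))"
    by (rule HA.T.finsum_cong_simple)
      (use T \<sigma> in \<open>auto simp: moved HA.pure_finsum_left intro!: HA.T.finsum_closed\<close>)
  \<comment> \<open>The left factor no longer depends on \<nu>, so after the exchange the inner sum
    lives in A alone, where it is a rotated relation.\<close>
  also have "\<dots> = (\<Oplus>\<^bsub>?T\<^esub>\<kappa>\<in>multi ?k. \<Oplus>\<^bsub>?T\<^esub>\<nu>\<in>multi N. W (\<nu> @ \<kappa>) \<odot>\<^bsub>?T\<^esub> pure_tensor H A (T \<kappa> \<sigma>) (Y \<nu>))"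
    by (rule HA.T.finsum_swap) (use T in auto)
  also have "\<dots> = \<zero>\<^bsub>?T\<^esub>"
    by (rule HA.T.add.finprod_one_eqI)
      (use T in \<open>auto simp: HA.pure_finsum_right[symmetric] Y_relation_rotated HA.pure_zero_right\<close>)
  finally show ?thesis .
qed

text \<open>A defining relation is a combination of rotated ones with coefficients free of \<mu>, so
  \<open>coaction_word_rotated\<close> suffices.\<close>

lemma coaction_word_relation:
  assumes \<kappa>: "\<kappa> \<in> multi (m - N)"
  shows "(\<Oplus>\<^bsub>tensor_algebra H A\<^esub>\<mu>\<in>multi N. W (\<kappa> @ \<mu>) \<odot>\<^bsub>tensor_algebra H A\<^esub> coaction_word \<mu>)
    = \<zero>\<^bsub>tensor_algebra H A\<^esub>"
proof -
  let ?T = "tensor_algebra H A"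
  have "length \<kappa> + N = m" using \<kappa> N_le by simp
  from preregular_comps_rotate(1)[OF preregular this]
  obtain c where c: "\<And>\<mu>. \<mu> \<in> multi N \<Longrightarrow>
      W (\<kappa> @ \<mu>) = (\<Sum>\<sigma>\<in>multi (length \<kappa>). c \<sigma> * W (\<mu> @ \<sigma>))"
    by blast
  have "(\<Oplus>\<^bsub>?T\<^esub>\<mu>\<in>multi N. W (\<kappa> @ \<mu>) \<odot>\<^bsub>?T\<^esub> coaction_word \<mu>)
      = (\<Oplus>\<^bsub>?T\<^esub>\<mu>\<in>multi N. (\<Sum>\<sigma>\<in>multi (length \<kappa>). c \<sigma> * W (\<mu> @ \<sigma>)) \<odot>\<^bsub>?T\<^esub> coaction_word \<mu>)"
    by (rule HA.T.finsum_cong_simple) (simp_all only: c, simp)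
  also have "\<dots> = (\<Oplus>\<^bsub>?T\<^esub>\<sigma>\<in>multi (length \<kappa>). c \<sigma> \<odot>\<^bsub>?T\<^esub>
      (\<Oplus>\<^bsub>?T\<^esub>\<mu>\<in>multi N. W (\<mu> @ \<sigma>) \<odot>\<^bsub>?T\<^esub> coaction_word \<mu>))"
    by (rule HA.T.finsum_sum_smult) auto
  also have "\<dots> = \<zero>\<^bsub>?T\<^esub>"
    by (rule HA.T.add.finprod_one_eqI) (use \<kappa> coaction_word_rotated in auto)
  finally show ?thesis .
qed

lemma coaction_exists:
  "\<exists>\<rho>\<in>alg_hom A (tensor_algebra H A). \<forall>\<mu>. \<rho> (Y \<mu>) = coaction_word \<mu>"
  unfolding A_alg_def[of m w N]
proof (rule presentation.presented_hom_exists)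
  let ?T = "tensor_algebra H (presented_algebra (A_rels m w N))"
  have T: "?T = tensor_algebra H A" by (simp add: A_alg_def)
  show "kalg ?T" unfolding T by (rule HA.tensor_kalg)
  show "coaction_word \<mu> \<in> carrier ?T" for \<mu> unfolding T by simp
  have "{\<sigma> :: 'n list. \<sigma> = []} = {[]}" by auto
  then show "coaction_word [] = \<one>\<^bsub>?T\<^esub>"
    unfolding T by (simp add: coaction_word_def U_Nil Y_Nil HA.pure_one)
  show "coaction_word (\<mu> @ \<nu>) = coaction_word \<mu> \<otimes>\<^bsub>?T\<^esub> coaction_word \<nu>" for \<mu> \<nu>
    unfolding T coaction_word_def length_append
    by (rule HA.finsum_pure_append) (auto simp: U_append Y_append)
  fix r assume "r \<in> A_rels m w N"
  then obtain \<kappa> where \<kappa>: "\<kappa> \<in> multi (m - N)"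
    and r: "r = (\<Sum>\<mu>\<in>multi N. Poly_Mapping.single \<mu> (W (\<kappa> @ \<mu>)))"
    by (auto simp: A_rels_def)
  show "lin_ext ?T coaction_word r = \<zero>\<^bsub>?T\<^esub>"
    unfolding T r using coaction_word_relation[OF \<kappa>]
    by (subst lin_ext_sum[OF HA.T.kvec_axioms]) auto
qed


section \<open>The coproduct and the counit\<close>

lemma H_relsE:
  assumes "r \<in> H_rels m w wt"
  obtains \<beta> where "\<beta> \<in> multi m"
      "r = (\<Sum>\<alpha>\<in>multi m. Poly_Mapping.single (zip \<alpha> \<beta>) (W \<alpha>)) - Poly_Mapping.single [] (W \<beta>)"
  | \<alpha> where "\<alpha> \<in> multi m"
      "r = (\<Sum>\<beta>\<in>multi m. Poly_Mapping.single (zip \<alpha> \<beta>) (Wt \<beta>)) - Poly_Mapping.single [] (Wt \<alpha>)"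
  using assms unfolding H_rels_def by auto

lemma word_class_U: "word_class (H_rels m w wt) v = U (map fst v) (map snd v)"
  by (simp add: U_def zip_map_fst_snd)

definition comult_word where
  "comult_word v = (\<Oplus>\<^bsub>tensor_algebra H H\<^esub>\<kappa>\<in>multi (length v).
    pure_tensor H H (U (map fst v) \<kappa>) (U \<kappa> (map snd v)))"

lemma comult_word_closed [simp, intro]: "comult_word v \<in> carrier (tensor_algebra H H)"
  by (auto simp: comult_word_def intro!: HH.T.finsum_closed)

lemma comult_word_zip:
  assumes "\<alpha> \<in> multi l" "\<beta> \<in> multi l"
  shows "comult_word (zip \<alpha> \<beta>)
    = (\<Oplus>\<^bsub>tensor_algebra H H\<^esub>\<kappa>\<in>multi l. pure_tensor H H (U \<alpha> \<kappa>) (U \<kappa> \<beta>))"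
  using assms by (simp add: comult_word_def)

lemma comult_word_Nil: "comult_word [] = pure_tensor H H \<one>\<^bsub>H\<^esub> \<one>\<^bsub>H\<^esub>"
proof -
  have "{\<sigma> :: 'n list. \<sigma> = []} = {[]}" by auto
  then show ?thesis by (simp add: comult_word_def U_Nil)
qed

text \<open>The first family of relations is applied twice: summation over \<alpha> in the left
  factor leaves W_\<kappa> times the unit, and this W_\<kappa> is the coefficient that the same
  relation needs in the right factor.\<close>

lemma comult_word_W:
  assumes \<beta>: "\<beta> \<in> multi m"
  shows "(\<Oplus>\<^bsub>tensor_algebra H H\<^esub>\<alpha>\<in>multi m. W \<alpha> \<odot>\<^bsub>tensor_algebra H H\<^esub> comult_word (zip \<alpha> \<beta>))
    = W \<beta> \<odot>\<^bsub>tensor_algebra H H\<^esub> comult_word []"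
proof -
  let ?T = "tensor_algebra H H"
  have "(\<Oplus>\<^bsub>?T\<^esub>\<alpha>\<in>multi m. W \<alpha> \<odot>\<^bsub>?T\<^esub> comult_word (zip \<alpha> \<beta>))
      = (\<Oplus>\<^bsub>?T\<^esub>\<alpha>\<in>multi m. W \<alpha> \<odot>\<^bsub>?T\<^esub> (\<Oplus>\<^bsub>?T\<^esub>\<kappa>\<in>multi m. pure_tensor H H (U \<alpha> \<kappa>) (U \<kappa> \<beta>)))"
    by (rule HH.T.finsum_cong_simple)
      (use \<beta> in \<open>auto simp: comult_word_zip intro!: HH.T.finsum_closed\<close>)
  also have "\<dots> = (\<Oplus>\<^bsub>?T\<^esub>\<kappa>\<in>multi m. pure_tensor H H (\<Oplus>\<^bsub>H\<^esub>\<alpha>\<in>multi m. W \<alpha> \<odot>\<^bsub>H\<^esub> U \<alpha> \<kappa>) (U \<kappa> \<beta>))"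
    by (rule HH.finsum_smult_pure_left) auto
  also have "\<dots> = (\<Oplus>\<^bsub>?T\<^esub>\<kappa>\<in>multi m. W \<kappa> \<odot>\<^bsub>?T\<^esub> pure_tensor H H \<one>\<^bsub>H\<^esub> (U \<kappa> \<beta>))"
    by (rule HH.T.finsum_cong_simple) (auto simp: W_relation HH.pure_smult)
  also have "\<dots> = pure_tensor H H \<one>\<^bsub>H\<^esub> (\<Oplus>\<^bsub>H\<^esub>\<kappa>\<in>multi m. W \<kappa> \<odot>\<^bsub>H\<^esub> U \<kappa> \<beta>)"
    by (rule HH.pure_finsum_right[symmetric]) auto
  finally show ?thesis
    by (simp add: W_relation[OF \<beta>] HH.pure_smult comult_word_Nil)
qed

text \<open>Here the summed index is a lower one, so the second family of relations is applied in
  the right factor before the left.\<close>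

lemma comult_word_Wt:
  assumes \<alpha>: "\<alpha> \<in> multi m"
  shows "(\<Oplus>\<^bsub>tensor_algebra H H\<^esub>\<beta>\<in>multi m. Wt \<beta> \<odot>\<^bsub>tensor_algebra H H\<^esub> comult_word (zip \<alpha> \<beta>))
    = Wt \<alpha> \<odot>\<^bsub>tensor_algebra H H\<^esub> comult_word []"
proof -
  let ?T = "tensor_algebra H H"
  have "(\<Oplus>\<^bsub>?T\<^esub>\<beta>\<in>multi m. Wt \<beta> \<odot>\<^bsub>?T\<^esub> comult_word (zip \<alpha> \<beta>))
      = (\<Oplus>\<^bsub>?T\<^esub>\<beta>\<in>multi m. Wt \<beta> \<odot>\<^bsub>?T\<^esub> (\<Oplus>\<^bsub>?T\<^esub>\<kappa>\<in>multi m. pure_tensor H H (U \<alpha> \<kappa>) (U \<kappa> \<beta>)))"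
    by (rule HH.T.finsum_cong_simple)
      (use \<alpha> in \<open>auto simp: comult_word_zip intro!: HH.T.finsum_closed\<close>)
  also have "\<dots> = (\<Oplus>\<^bsub>?T\<^esub>\<kappa>\<in>multi m. pure_tensor H H (U \<alpha> \<kappa>) (\<Oplus>\<^bsub>H\<^esub>\<beta>\<in>multi m. Wt \<beta> \<odot>\<^bsub>H\<^esub> U \<kappa> \<beta>))"
    by (rule HH.finsum_smult_pure_right) auto
  also have "\<dots> = (\<Oplus>\<^bsub>?T\<^esub>\<kappa>\<in>multi m. Wt \<kappa> \<odot>\<^bsub>?T\<^esub> pure_tensor H H (U \<alpha> \<kappa>) \<one>\<^bsub>H\<^esub>)"
    by (rule HH.T.finsum_cong_simple) (auto simp: Wt_relation HH.pure_smult)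
  also have "\<dots> = pure_tensor H H (\<Oplus>\<^bsub>H\<^esub>\<kappa>\<in>multi m. Wt \<kappa> \<odot>\<^bsub>H\<^esub> U \<alpha> \<kappa>) \<one>\<^bsub>H\<^esub>"
    by (rule HH.pure_finsum_left[symmetric]) auto
  finally show ?thesis
    by (simp add: Wt_relation[OF \<alpha>] HH.pure_smult comult_word_Nil)
qed

lemma comult_exists:
  "\<exists>D\<in>alg_hom H (tensor_algebra H H). \<forall>v. D (word_class (H_rels m w wt) v) = comult_word v"
proof -
  have "\<exists>D\<in>alg_hom (presented_algebra (H_rels m w wt)) (tensor_algebra H H).
      \<forall>v. D (word_class (H_rels m w wt) v) = comult_word v"
  proof (rule presentation.presented_hom_exists)
    show "kalg (tensor_algebra H H)" by (rule HH.tensor_kalg)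
    show "comult_word v \<in> carrier (tensor_algebra H H)" for v by simp
    show "comult_word [] = \<one>\<^bsub>tensor_algebra H H\<^esub>" by (simp add: comult_word_Nil HH.pure_one)
    show "comult_word (v @ v') = comult_word v \<otimes>\<^bsub>tensor_algebra H H\<^esub> comult_word v'" for v v'
      unfolding comult_word_def length_append map_append
      by (rule HH.finsum_pure_append) (auto simp: U_append)
    fix r assume "r \<in> H_rels m w wt"
    then show "lin_ext (tensor_algebra H H) comult_word r = \<zero>\<^bsub>tensor_algebra H H\<^esub>"
    proof (cases rule: H_relsE)
      case (1 \<beta>)
      show ?thesis
        unfolding 1(2)
        by (rule lin_ext_sum_minus_const[OF HH.T.kvec_axioms _ comult_word_W[OF 1(1)]]) simp
    next
      case (2 \<alpha>)
      show ?thesis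
        unfolding 2(2)
        by (rule lin_ext_sum_minus_const[OF HH.T.kvec_axioms _ comult_word_Wt[OF 2(1)]]) simp
    qed
  qed
  then show ?thesis by (simp only: H_alg_def)
qed

text \<open>On a word the counit is the Kronecker symbol of its two multi-indices. It is
  multiplicative because concatenations of blocks of equal lengths agree exactly if the blocks do,
  and contraction with it merely renames an index, which gives the relations.\<close>

lemma counit_exists:
  "\<exists>e\<in>alg_hom H scalar_algebra. \<forall>v. e (word_class (H_rels m w wt) v)
    = (if map fst v = map snd v then 1 else 0)"
proof -
  interpret K: kalg "scalar_algebra :: ('k, 'k) module" by (rule scalar_algebra_kalg)
  let ?F = "\<lambda>v :: ('n \<times> 'n) list. if map fst v = map snd v then 1 else 0 :: 'k"
  have "\<exists>e\<in>alg_hom (presented_algebra (H_rels m w wt)) scalar_algebra.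
      \<forall>v. e (word_class (H_rels m w wt) v) = ?F v"
  proof (rule presentation.presented_hom_exists)
    show "kalg (scalar_algebra :: ('k, 'k) module)" by (rule scalar_algebra_kalg)
    show "?F v \<in> carrier scalar_algebra" for v by (simp add: scalar_algebra_simps)
    show "?F [] = \<one>\<^bsub>scalar_algebra\<^esub>" by (simp add: scalar_algebra_simps)
    show "?F (v @ v') = ?F v \<otimes>\<^bsub>scalar_algebra\<^esub> ?F v'" for v v'
      by (simp add: scalar_algebra_simps)
    \<comment> \<open>In the ground field vectors and coefficients may be exchanged, so the
      Kronecker symbol can take the place of the coefficient that \<open>finsum_delta\<close>
      expects.\<close>
    have delta: "(\<Oplus>\<^bsub>scalar_algebra\<^esub>\<alpha>\<in>multi m. f \<alpha> \<odot>\<^bsub>scalar_algebra\<^esub> (if \<alpha> = \<beta> then 1 else 0)) = f \<beta>"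
      if "\<beta> \<in> multi m" for \<beta> :: "'n list" and f :: "'n list \<Rightarrow> 'k"
    proof -
      have "(\<Oplus>\<^bsub>scalar_algebra\<^esub>\<alpha>\<in>multi m. f \<alpha> \<odot>\<^bsub>scalar_algebra\<^esub> (if \<alpha> = \<beta> then 1 else 0))
          = (\<Oplus>\<^bsub>scalar_algebra\<^esub>\<alpha>\<in>multi m. (if \<alpha> = \<beta> then 1 else 0) \<odot>\<^bsub>scalar_algebra\<^esub> f \<alpha>)"
        by (rule K.finsum_cong_simple) (auto simp: scalar_algebra_simps)
      also have "\<dots> = 1 \<odot>\<^bsub>scalar_algebra\<^esub> f \<beta>"
        by (rule K.finsum_delta) (use that in \<open>auto simp: scalar_algebra_simps\<close>)
      finally show ?thesis by (simp add: scalar_algebra_simps)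
    qed
    have zip1: "(\<Oplus>\<^bsub>scalar_algebra\<^esub>\<alpha>\<in>multi m. W \<alpha> \<odot>\<^bsub>scalar_algebra\<^esub> ?F (zip \<alpha> \<beta>))
        = W \<beta> \<odot>\<^bsub>scalar_algebra\<^esub> ?F []" if \<beta>: "\<beta> \<in> multi m" for \<beta>
    proof -
      have "(\<Oplus>\<^bsub>scalar_algebra\<^esub>\<alpha>\<in>multi m. W \<alpha> \<odot>\<^bsub>scalar_algebra\<^esub> ?F (zip \<alpha> \<beta>))
          = (\<Oplus>\<^bsub>scalar_algebra\<^esub>\<alpha>\<in>multi m. W \<alpha> \<odot>\<^bsub>scalar_algebra\<^esub> (if \<alpha> = \<beta> then 1 else 0))"
        by (rule K.finsum_cong_simple) (use \<beta> in \<open>auto simp: scalar_algebra_simps\<close>)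
      then show ?thesis using delta[OF \<beta>, of W] by (simp add: scalar_algebra_simps)
    qed
    have zip2: "(\<Oplus>\<^bsub>scalar_algebra\<^esub>\<beta>\<in>multi m. Wt \<beta> \<odot>\<^bsub>scalar_algebra\<^esub> ?F (zip \<alpha> \<beta>))
        = Wt \<alpha> \<odot>\<^bsub>scalar_algebra\<^esub> ?F []" if \<alpha>: "\<alpha> \<in> multi m" for \<alpha>
    proof -
      have "(\<Oplus>\<^bsub>scalar_algebra\<^esub>\<beta>\<in>multi m. Wt \<beta> \<odot>\<^bsub>scalar_algebra\<^esub> ?F (zip \<alpha> \<beta>))
          = (\<Oplus>\<^bsub>scalar_algebra\<^esub>\<beta>\<in>multi m. Wt \<beta> \<odot>\<^bsub>scalar_algebra\<^esub> (if \<beta> = \<alpha> then 1 else 0))"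
        by (rule K.finsum_cong_simple) (use \<alpha> in \<open>auto simp: scalar_algebra_simps\<close>)
      then show ?thesis using delta[OF \<alpha>, of Wt] by (simp add: scalar_algebra_simps)
    qed
    fix r assume "r \<in> H_rels m w wt"
    then show "lin_ext scalar_algebra ?F r = \<zero>\<^bsub>scalar_algebra\<^esub>"
    proof (cases rule: H_relsE)
      case 1
      show ?thesis
        unfolding 1(2)
        by (rule lin_ext_sum_minus_const[OF K.kvec_axioms _ zip1[OF 1(1)]])
          (simp add: scalar_algebra_simps)
    next
      case 2
      show ?thesis
        unfolding 2(2)
        by (rule lin_ext_sum_minus_const[OF K.kvec_axioms _ zip2[OF 2(1)]])
          (simp add: scalar_algebra_simps)
    qed
  qed
  then show ?thesis by (simp only: H_alg_def)
qed

lemma H_gen_U: "H_gen m w wt \<mu> \<nu> = U [\<mu>] [\<nu>]"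
  by (simp add: H_gen_def presentation.word_class_gen U_def)

lemma A_gen_Y: "A_gen m w N \<mu> = Y [\<mu>]"
  by (simp add: A_gen_def presentation.word_class_gen)

text \<open>\<open>H_comult\<close> is a definite description, so nothing is known about it before
  existence and uniqueness are. Once it is identified with the homomorphism built from the formula
  on words, its values on all words are available and not only those on generators.\<close>

lemma
  shows comult_hom: "H_comult m w wt \<in> alg_hom H (tensor_algebra H H)"
    and comult_U: "\<alpha> \<in> multi l \<Longrightarrow> \<beta> \<in> multi l \<Longrightarrow> H_comult m w wt (U \<alpha> \<beta>)
      = (\<Oplus>\<^bsub>tensor_algebra H H\<^esub>\<kappa>\<in>multi l. pure_tensor H H (U \<alpha> \<kappa>) (U \<kappa> \<beta>))"
proof -
  obtain D where D: "D \<in> alg_hom H (tensor_algebra H H)"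
    and D_word: "\<And>v. D (word_class (H_rels m w wt) v) = comult_word v"
    using comult_exists by blast
  have D_gen: "D (H_gen m w wt \<mu> \<nu>) = (\<Oplus>\<^bsub>tensor_algebra H H\<^esub>\<kappa>\<in>UNIV.
      pure_tensor H H (H_gen m w wt \<mu> \<kappa>) (H_gen m w wt \<kappa> \<nu>))" for \<mu> \<nu>
  proof -
    have "D (H_gen m w wt \<mu> \<nu>) = comult_word (zip [\<mu>] [\<nu>])"
      unfolding H_gen_U U_def by (rule D_word)
    also have "\<dots> = (\<Oplus>\<^bsub>tensor_algebra H H\<^esub>\<kappa>\<in>multi (Suc 0). pure_tensor H H (U [\<mu>] \<kappa>) (U \<kappa> [\<nu>]))"
      by (rule comult_word_zip) auto
    finally show ?thesis by (simp add: HH.T.finsum_lists_one H_gen_U)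
  qed
  have "H_comult m w wt = D"
    unfolding H_comult_def Let_def
  proof (rule the_equality)
    show "D \<in> alg_hom H (tensor_algebra H H) \<and> (\<forall>\<mu> \<nu>. D (H_gen m w wt \<mu> \<nu>) =
        (\<Oplus>\<^bsub>tensor_algebra H H\<^esub>\<kappa>\<in>UNIV. pure_tensor H H (H_gen m w wt \<mu> \<kappa>) (H_gen m w wt \<kappa> \<nu>)))"
      using D D_gen by blast
    fix E assume E: "E \<in> alg_hom H (tensor_algebra H H) \<and> (\<forall>\<mu> \<nu>. E (H_gen m w wt \<mu> \<nu>) =
        (\<Oplus>\<^bsub>tensor_algebra H H\<^esub>\<kappa>\<in>UNIV. pure_tensor H H (H_gen m w wt \<mu> \<kappa>) (H_gen m w wt \<kappa> \<nu>)))"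
    show "E = D"
    proof (rule presentation.presented_hom_unique[OF HH.tensor_kalg])
      show "E \<in> alg_hom (presented_algebra (H_rels m w wt)) (tensor_algebra H H)"
        "D \<in> alg_hom (presented_algebra (H_rels m w wt)) (tensor_algebra H H)"
        using E D by (simp_all add: H_alg_def)
      show "E (presented_gen (H_rels m w wt) a) = D (presented_gen (H_rels m w wt) a)" for a
        using E D_gen[of "fst a" "snd a"] by (cases a) (simp add: H_gen_def)
    qed
  qed
  then show "H_comult m w wt \<in> alg_hom H (tensor_algebra H H)" using D by simp
  show "H_comult m w wt (U \<alpha> \<beta>)
      = (\<Oplus>\<^bsub>tensor_algebra H H\<^esub>\<kappa>\<in>multi l. pure_tensor H H (U \<alpha> \<kappa>) (U \<kappa> \<beta>))"
    if "\<alpha> \<in> multi l" "\<beta> \<in> multi l"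
    using D_word[of "zip \<alpha> \<beta>"] comult_word_zip[OF that] \<open>H_comult m w wt = D\<close>
    by (simp add: U_def[of \<alpha> \<beta>])
qed

lemma
  shows counit_hom: "H_counit m w wt \<in> alg_hom H scalar_algebra"
    and counit_U: "\<alpha> \<in> multi l \<Longrightarrow> \<beta> \<in> multi l \<Longrightarrow>
      H_counit m w wt (U \<alpha> \<beta>) = (if \<alpha> = \<beta> then 1 else 0)"
proof -
  obtain e where e: "e \<in> alg_hom H scalar_algebra"
    and e_word: "\<And>v. e (word_class (H_rels m w wt) v) = (if map fst v = map snd v then 1 else 0)"
    using counit_exists by blast
  have e_U: "e (U \<alpha> \<beta>) = (if \<alpha> = \<beta> then 1 else 0)" if "length \<alpha> = length \<beta>" for \<alpha> \<beta>
    unfolding U_def e_word using that by simp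
  have "H_counit m w wt = e"
    unfolding H_counit_def
  proof (rule the_equality)
    show "e \<in> alg_hom H scalar_algebra \<and>
        (\<forall>\<mu> \<nu>. e (H_gen m w wt \<mu> \<nu>) = (if \<mu> = \<nu> then 1 else 0))"
      using e by (simp add: H_gen_U e_U)
    fix f assume f: "f \<in> alg_hom H scalar_algebra \<and>
        (\<forall>\<mu> \<nu>. f (H_gen m w wt \<mu> \<nu>) = (if \<mu> = \<nu> then 1 else 0))"
    show "f = e"
    proof (rule presentation.presented_hom_unique[OF scalar_algebra_kalg])
      show "f \<in> alg_hom (presented_algebra (H_rels m w wt)) scalar_algebra"
        "e \<in> alg_hom (presented_algebra (H_rels m w wt)) scalar_algebra"
        using f e by (simp_all add: H_alg_def)
      show "f (presented_gen (H_rels m w wt) a) = e (presented_gen (H_rels m w wt) a)" for a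
      proof -
        have "e (H_gen m w wt (fst a) (snd a)) = (if fst a = snd a then 1 else 0)"
          by (simp add: H_gen_U e_U)
        then show ?thesis using f by (cases a) (simp add: H_gen_def)
      qed
    qed
  qed
  then show "H_counit m w wt \<in> alg_hom H scalar_algebra" using e by simp
  show "H_counit m w wt (U \<alpha> \<beta>) = (if \<alpha> = \<beta> then 1 else 0)" if "\<alpha> \<in> multi l" "\<beta> \<in> multi l"
    unfolding \<open>H_counit m w wt = e\<close> using that by (intro e_U) simp
qed

section \<open>The coalgebra and comodule axioms\<close>

lemma comult_matrix_coaction:
  assumes "\<beta> \<in> multi l"
  shows "matrix_coaction H H (multi l) U (\<lambda>\<kappa>. U \<kappa> \<beta>) (H_comult m w wt) (H_comult m w wt) (H_counit m w wt)"
  by (intro matrix_coaction.intro HH.kalg_pair_axioms matrix_coaction_axioms.intro)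
    (use assms comult_U counit_U alg_hom_linear[OF comult_hom] alg_hom_linear[OF counit_hom] in auto)

lemma coaction_matrix_coaction:
  assumes "\<rho> \<in> alg_hom A (tensor_algebra H A)" "\<And>\<mu>. \<rho> (Y \<mu>) = coaction_word \<mu>"
  shows "matrix_coaction H A (multi l) U Y (H_comult m w wt) \<rho> (H_counit m w wt)"
  by (intro matrix_coaction.intro HA.kalg_pair_axioms matrix_coaction_axioms.intro)
    (use assms(2) comult_U counit_U alg_hom_linear[OF assms(1)] alg_hom_linear[OF comult_hom]
      alg_hom_linear[OF counit_hom] in \<open>auto simp: coaction_word_def\<close>)

lemma H_linear_eqI:
  assumes "kvec M" "f \<in> linear_maps H M" "g \<in> linear_maps H M"
    and "\<And>l \<alpha> \<beta>. \<alpha> \<in> multi l \<Longrightarrow> \<beta> \<in> multi l \<Longrightarrow> f (U \<alpha> \<beta>) = g (U \<alpha> \<beta>)"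
    and "x \<in> carrier H"
  shows "f x = g x"
proof (rule presentation.presented_linear_eqI[OF assms(1)])
  show "f (word_class (H_rels m w wt) v) = g (word_class (H_rels m w wt) v)" for v
    unfolding word_class_U by (rule assms(4)[of _ "length v"]) auto
qed (use assms in \<open>simp_all add: H_alg_def\<close>)

lemma H_coalgebra: "coalgebra H (H_comult m w wt) (H_counit m w wt)"
  unfolding coalgebra_def
proof (intro conjI ballI)
  let ?K = "scalar_algebra :: ('k, 'k) module"
  let ?\<Delta> = "H_comult m w wt" and ?\<epsilon> = "H_counit m w wt" and ?HH = "tensor_algebra H H"
  show "vector_space_rec H" by (rule HA.A.vector_space_rec)
  show \<Delta>: "?\<Delta> \<in> linear_maps H ?HH" by (rule alg_hom_linear[OF comult_hom])
  show \<epsilon>: "?\<epsilon> \<in> linear_maps H scalar_algebra" by (rule alg_hom_linear[OF counit_hom])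
  have pairs: "kalg_pair H H" "kalg_pair ?HH H" "kalg_pair H ?HH" "kalg_pair ?K H" "kalg_pair H ?K"
    by (intro kalg_pair.intro H_kalg HH.tensor_kalg scalar_algebra_kalg)+
  interpret H_HH: kalg_pair H ?HH by (rule pairs)
  fix x assume x: "x \<in> carrier H"
  show "tensor_assoc H H H (tensor_map ?HH H ?\<Delta> id (?\<Delta> x)) = tensor_map H ?HH id ?\<Delta> (?\<Delta> x)"
    by (rule H_linear_eqI[OF H_HH.T.kvec_axioms
          linear_maps_comp[OF tensor_assoc_linear[OF H_kalg H_kalg H_kalg]
            linear_maps_comp[OF tensor_map_linear[OF pairs(1,2) \<Delta> id_linear] \<Delta>]]
          linear_maps_comp[OF tensor_map_linear[OF pairs(1,3) id_linear \<Delta>] \<Delta>] _ x])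
      (rule matrix_coaction.coassociative[OF comult_matrix_coaction])
  show "tensor_unit_left H (tensor_map scalar_algebra H ?\<epsilon> id (?\<Delta> x)) = x"
    by (rule H_linear_eqI[OF HA.A.kvec_axioms
          linear_maps_comp[OF tensor_unit_left_linear[OF H_kalg]
            linear_maps_comp[OF tensor_map_linear[OF pairs(1,4) \<epsilon> id_linear] \<Delta>]]
          id_linear[unfolded id_def] _ x])
      (rule matrix_coaction.counit_left[OF comult_matrix_coaction])
  show "tensor_unit_right H (tensor_map H scalar_algebra id ?\<epsilon> (?\<Delta> x)) = x"
  proof (rule H_linear_eqI[OF HA.A.kvec_axioms
          linear_maps_comp[OF tensor_unit_right_linear[OF H_kalg]
            linear_maps_comp[OF tensor_map_linear[OF pairs(1,5) id_linear \<epsilon>] \<Delta>]]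
          id_linear[unfolded id_def] _ x])
    fix l and \<alpha> \<beta> :: "'n list" assume "\<alpha> \<in> multi l" "\<beta> \<in> multi l"
    then show "tensor_unit_right H (tensor_map H scalar_algebra id ?\<epsilon> (?\<Delta> (U \<alpha> \<beta>))) = U \<alpha> \<beta>"
      by (simp only: comult_U)
        (rule matrix_counit_right[OF H_kalg], auto simp: counit_U[of _ l] \<epsilon>)
  qed
qed

lemma coaction_left_comodule:
  assumes \<rho>_hom: "\<rho> \<in> alg_hom A (tensor_algebra H A)" and \<rho>_Y: "\<And>\<mu>. \<rho> (Y \<mu>) = coaction_word \<mu>"
  shows "left_comodule H (H_comult m w wt) (H_counit m w wt) A \<rho>"
  unfolding left_comodule_def
proof (intro conjI ballI H_coalgebra)
  let ?K = "scalar_algebra :: ('k, 'k) module"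
  let ?\<Delta> = "H_comult m w wt" and ?\<epsilon> = "H_counit m w wt"
  let ?HH = "tensor_algebra H H" and ?HA = "tensor_algebra H A"
  show "vector_space_rec A" by (rule HA.B.vector_space_rec)
  show \<rho>: "\<rho> \<in> linear_maps A ?HA" by (rule alg_hom_linear[OF \<rho>_hom])
  have \<Delta>: "?\<Delta> \<in> linear_maps H ?HH" by (rule alg_hom_linear[OF comult_hom])
  have \<epsilon>: "?\<epsilon> \<in> linear_maps H scalar_algebra" by (rule alg_hom_linear[OF counit_hom])
  have pairs: "kalg_pair H A" "kalg_pair ?HH A" "kalg_pair H ?HA" "kalg_pair ?K A"
    by (intro kalg_pair.intro H_kalg A_kalg HH.tensor_kalg HA.tensor_kalg scalar_algebra_kalg)+
  interpret H_HA: kalg_pair H ?HA by (rule pairs)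
  fix x assume x: "x \<in> carrier A"
  show "tensor_assoc H H A (tensor_map ?HH A ?\<Delta> id (\<rho> x)) = tensor_map H ?HA id \<rho> (\<rho> x)"
  proof (rule presentation.presented_linear_eqI[OF H_HA.T.kvec_axioms, where rels = "A_rels m w N",
        folded A_alg_def])
    show "(\<lambda>x. tensor_assoc H H A (tensor_map ?HH A ?\<Delta> id (\<rho> x))) \<in> linear_maps A (tensor_algebra H ?HA)"
      by (intro linear_maps_comp[OF tensor_assoc_linear[OF H_kalg H_kalg A_kalg]]
          linear_maps_comp[OF tensor_map_linear[OF pairs(1,2) \<Delta> id_linear]] \<rho>)
    show "(\<lambda>x. tensor_map H ?HA id \<rho> (\<rho> x)) \<in> linear_maps A (tensor_algebra H ?HA)"
      by (intro linear_maps_comp[OF tensor_map_linear[OF pairs(1,3) id_linear \<rho>]] \<rho>)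
    show "tensor_assoc H H A (tensor_map ?HH A ?\<Delta> id (\<rho> (Y \<mu>))) = tensor_map H ?HA id \<rho> (\<rho> (Y \<mu>))" for \<mu>
      by (rule matrix_coaction.coassociative[OF coaction_matrix_coaction[OF assms, of "length \<mu>"]]) simp
  qed (rule x)
  show "tensor_unit_left A (tensor_map scalar_algebra A ?\<epsilon> id (\<rho> x)) = x"
  proof (rule presentation.presented_linear_eqI[OF HA.B.kvec_axioms, where rels = "A_rels m w N",
        folded A_alg_def])
    show "(\<lambda>x. tensor_unit_left A (tensor_map scalar_algebra A ?\<epsilon> id (\<rho> x))) \<in> linear_maps A A"
      by (intro linear_maps_comp[OF tensor_unit_left_linear[OF A_kalg]]
          linear_maps_comp[OF tensor_map_linear[OF pairs(1,4) \<epsilon> id_linear]] \<rho>)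
    show "(\<lambda>x. x) \<in> linear_maps A A" by (rule id_linear[unfolded id_def])
    show "tensor_unit_left A (tensor_map scalar_algebra A ?\<epsilon> id (\<rho> (Y \<mu>))) = Y \<mu>" for \<mu>
      by (rule matrix_coaction.counit_left[OF coaction_matrix_coaction[OF assms, of "length \<mu>"]]) simp
  qed (rule x)
qed

section \<open>Existence and uniqueness of the coaction\<close>

definition is_coaction where
  "is_coaction \<rho> \<longleftrightarrow> \<rho> \<in> alg_hom A (tensor_algebra H A) \<and>
    (\<forall>\<mu>. \<rho> (A_gen m w N \<mu>) = (\<Oplus>\<^bsub>tensor_algebra H A\<^esub>\<nu>\<in>UNIV.
      pure_tensor H A (H_gen m w wt \<mu> \<nu>) (A_gen m w N \<nu>)))"

lemma coaction_word_gen: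
  "coaction_word [\<mu>] = (\<Oplus>\<^bsub>tensor_algebra H A\<^esub>\<nu>\<in>UNIV.
    pure_tensor H A (H_gen m w wt \<mu> \<nu>) (A_gen m w N \<nu>))"
  by (simp add: coaction_word_def HA.T.finsum_lists_one H_gen_U A_gen_Y)

lemma coaction_unique:
  assumes "is_coaction \<rho>" "is_coaction \<rho>'"
  shows "\<rho> = \<rho>'"
proof (rule presentation.presented_hom_unique[OF HA.tensor_kalg])
  show "\<rho> \<in> alg_hom (presented_algebra (A_rels m w N)) (tensor_algebra H A)"
    "\<rho>' \<in> alg_hom (presented_algebra (A_rels m w N)) (tensor_algebra H A)"
    using assms by (simp_all add: is_coaction_def A_alg_def)
  show "\<rho> (presented_gen (A_rels m w N) a) = \<rho>' (presented_gen (A_rels m w N) a)" for a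
    using assms by (simp add: is_coaction_def A_gen_def)
qed

theorem coaction_unique_left_comodule:
  "(\<exists>!\<rho>. is_coaction \<rho>) \<and>
    (\<forall>\<rho>. is_coaction \<rho> \<longrightarrow> left_comodule H (H_comult m w wt) (H_counit m w wt) A \<rho>)"
proof -
  obtain \<rho> where \<rho>: "\<rho> \<in> alg_hom A (tensor_algebra H A)" "\<And>\<mu>. \<rho> (Y \<mu>) = coaction_word \<mu>"
    using coaction_exists by blast
  then have "is_coaction \<rho>"
    by (simp add: is_coaction_def A_gen_Y coaction_word_gen[symmetric, unfolded A_gen_Y])
  with coaction_left_comodule[OF \<rho>] coaction_unique show ?thesis by metis
qed

end

theorem proposition15:
  fixes m N s :: nat
    and w :: "('k::{alg_closed_field, field_char_0} ^ 'n) list \<Rightarrow> 'k"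
    and wt :: "('k ^ 'n \<Rightarrow> 'k) list \<Rightarrow> 'k"
  defines "A \<equiv> A_alg m w N"
    and "x \<equiv> A_gen m w N"
    and "H \<equiv> H_alg m w wt"
    and "u \<equiv> H_gen m w wt"
  assumes "m \<ge> N" and "N \<ge> 2"
    and "s \<ge> 1" and "CARD('n) = s + 1"
    and "preregular m w"
    and "form_on_dual m wt"
    and "\<forall>\<alpha> \<beta>. (\<Sum>\<gamma> | length \<gamma> = m - 1. dual_comps wt (\<alpha> # \<gamma>) * comps w (\<gamma> @ [\<beta>]))
                 = (if \<alpha> = \<beta> then 1 else 0)"
  shows "(\<exists>!\<Delta>\<^sub>L. \<Delta>\<^sub>L \<in> alg_hom A (tensor_algebra H A) \<and>
            (\<forall>\<mu>. \<Delta>\<^sub>L (x \<mu>) = (\<Oplus>\<^bsub>tensor_algebra H A\<^esub>\<nu>\<in>UNIV. pure_tensor H A (u \<mu> \<nu>) (x \<nu>)))) \<and>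
         (\<forall>\<Delta>\<^sub>L. \<Delta>\<^sub>L \<in> alg_hom A (tensor_algebra H A) \<and>
            (\<forall>\<mu>. \<Delta>\<^sub>L (x \<mu>) = (\<Oplus>\<^bsub>tensor_algebra H A\<^esub>\<nu>\<in>UNIV. pure_tensor H A (u \<mu> \<nu>) (x \<nu>)))
            \<longrightarrow> left_comodule H (H_comult m w wt) (H_counit m w wt) A \<Delta>\<^sub>L)"
proof -
  interpret preregular_pair m N w wt
    by unfold_locales (use assms(5-) in auto)
  show ?thesis
    unfolding A_def x_def H_def u_def
    using coaction_unique_left_comodule unfolding is_coaction_def .
qed

end
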